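(* Assume the standing setup with $Z=\mathbb{Z}/p$, $p$ prime. Let $G$ be a profinite group and $N_1\le N_2$ closed normal subgroups of $G$ contained in $\bar T(G)$, with projections $\pi_i\colon G\to G/N_i$. Inflation maps $H^2(G/N_2)_{\pi_2}$ onto $H^2(G/N_1)_{\pi_1}$; let $C_G(N_1,N_2)$ be the kernel of this map. Then there is a perfect bilinear map $$N_2/(N_2\cap N_1T(G))\times C_G(N_1,N_2)\to\mathbb{Z}/p.$$
   Context: Standing setup: all homomorphisms of profinite groups are continuous. For profinite groups $\mathbb{U}$ and $G$, $T^{\mathbb{U}}(G)$ denotes the intersection of the kernels of all continuous homomorphisms $G\to\mathbb{U}$. Fix a finite abelian group $Z$ and a nonempty set $\Omega$ of central extensions of profinite groups $\omega\colon 0\to Z\to\mathbb{U}_\omega\xrightarrow{\lambda_\omega}\bar{\mathbb{U}}_\omega\to1$ such that for every $\omega$: (I) there are finitely many continuous homomorphisms $\gamma_1,\dots,\gamma_n\colon\bar{\mathbb{U}}_\omega\to\mathbb{U}_\omega$ with $\bigcap_i\operatorname{Ker}(\gamma_i)=\{1\}$; (II) $Z$ embeds as a closed subgroup of $\bar{\mathbb{U}}_\omega$. For a profinite group $G$ set $T(G)=\bigcap_{\omega\in\Omega}T^{\mathbb{U}_\omega}(G)$ and $\bar T(G)=\bigcap_{\omega\in\Omega}T^{\bar{\mathbb{U}}_\omega}(G)$. Here $H^i(G)=H^i(G,\mathbb{Z}/p)$ with trivial action. $\alpha_\omega\in H^2(\bar{\mathbb{U}}_\omega)$ is the class of $\omega$,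 and $\bar\rho^*(\alpha_\omega)$ its pullback along $\bar\rho$. For $N\trianglelefteq G$ closed with projection $\pi\colon G\to G/N$, a continuous $\bar\rho\colon G/N\to\bar{\mathbb{U}}_\omega$ is $\pi$-liftable if there is a continuous $\rho\colon G\to\mathbb{U}_\omega$ with $\lambda_\omega\circ\rho=\bar\rho\circ\pi$, and $H^2(G/N)_\pi$ is the subgroup of $H^2(G/N)$ generated by all $\bar\rho^*(\alpha_\omega)$ with $\omega\in\Omega$ and $\bar\rho$ $\pi$-liftable. A bilinear map is perfect if both induced maps to the Pontrjagin duals are isomorphisms. *)

theory Defs
  imports "HOL-Analysis.Analysis" "HOL-Algebra.Coset" "HOL-Algebra.Generated_Groups"
begin

definition topological_group :: "('a, 'm) monoid_scheme \<Rightarrow> 'a topology \<Rightarrow> bool" where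
  "topological_group G T \<longleftrightarrow> group G \<and> topspace T = carrier G
     \<and> continuous_map (prod_topology T T) T (\<lambda>(x, y). x \<otimes>\<^bsub>G\<^esub> y)
     \<and> continuous_map T T (\<lambda>x. inv\<^bsub>G\<^esub> x)"

definition profinite_group :: "('a, 'm) monoid_scheme \<Rightarrow> 'a topology \<Rightarrow> bool" where
  "profinite_group G T \<longleftrightarrow> topological_group G T \<and> compact_space T \<and> Hausdorff_space T
     \<and> (\<forall>x \<in> topspace T. connected_component_of_set T x = {x})"

definition cont_hom ::
  "('a, 'm) monoid_scheme \<Rightarrow> 'a topology \<Rightarrow> ('b, 'n) monoid_scheme \<Rightarrow> 'b topology \<Rightarrow> ('a \<Rightarrow> 'b) set" where
  "cont_hom G T H S = {f. f \<in> hom G H \<and> continuous_map T S f}"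

definition quot_top :: "('a, 'm) monoid_scheme \<Rightarrow> 'a topology \<Rightarrow> 'a set \<Rightarrow> 'a set topology" where
  "quot_top G T N = topology (\<lambda>S. S \<subseteq> rcosets\<^bsub>G\<^esub> N \<and> openin T (\<Union>S))"

definition TU :: "('a, 'm) monoid_scheme \<Rightarrow> 'a topology \<Rightarrow> ('b, 'n) monoid_scheme \<Rightarrow> 'b topology \<Rightarrow> 'a set" where
  "TU G T U S = carrier G \<inter> (\<Inter>f \<in> cont_hom G T U S. kernel G U f)"

definition Zp :: "int \<Rightarrow> int monoid" where
  "Zp p = \<lparr>carrier = {0..<p}, mult = (\<lambda>x y. (x + y) mod p), one = 0\<rparr>"

definition Zp_top :: "int \<Rightarrow> int topology" where
  "Zp_top p = discrete_topology {0..<p}"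

record ('u, 'v) cext =
  U_grp :: "'u monoid"
  U_top :: "'u topology"
  Ub_grp :: "'v monoid"
  Ub_top :: "'v topology"
  incl :: "int \<Rightarrow> 'u"
  proj :: "'u \<Rightarrow> 'v"

definition central_ext :: "int \<Rightarrow> ('u, 'v) cext \<Rightarrow> bool" where
  "central_ext p w \<longleftrightarrow>
     profinite_group (U_grp w) (U_top w) \<and> profinite_group (Ub_grp w) (Ub_top w)
     \<and> incl w \<in> cont_hom (Zp p) (Zp_top p) (U_grp w) (U_top w)
     \<and> inj_on (incl w) {0..<p}
     \<and> closedin (U_top w) (incl w ` {0..<p})
     \<and> (\<forall>z \<in> {0..<p}. \<forall>u \<in> carrier (U_grp w).
           incl w z \<otimes>\<^bsub>U_grp w\<^esub> u = u \<otimes>\<^bsub>U_grp w\<^esub> incl w z)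
     \<and> proj w \<in> cont_hom (U_grp w) (U_top w) (Ub_grp w) (Ub_top w)
     \<and> proj w ` carrier (U_grp w) = carrier (Ub_grp w)
     \<and> kernel (U_grp w) (Ub_grp w) (proj w) = incl w ` {0..<p}"

definition cond_I :: "('u, 'v) cext \<Rightarrow> bool" where
  "cond_I w \<longleftrightarrow> (\<exists>\<Gamma>. finite \<Gamma> \<and> \<Gamma> \<subseteq> cont_hom (Ub_grp w) (Ub_top w) (U_grp w) (U_top w)
      \<and> carrier (Ub_grp w) \<inter> (\<Inter>\<gamma> \<in> \<Gamma>. kernel (Ub_grp w) (U_grp w) \<gamma>) = {\<one>\<^bsub>Ub_grp w\<^esub>})"

definition cond_II :: "int \<Rightarrow> ('u, 'v) cext \<Rightarrow> bool" where
  "cond_II p w \<longleftrightarrow> (\<exists>e. e \<in> cont_hom (Zp p) (Zp_top p) (Ub_grp w) (Ub_top w)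
      \<and> inj_on e {0..<p} \<and> closedin (Ub_top w) (e ` {0..<p}))"

definition cocycles2 :: "('a, 'm) monoid_scheme \<Rightarrow> 'a topology \<Rightarrow> int \<Rightarrow> ('a \<Rightarrow> 'a \<Rightarrow> int) set" where
  "cocycles2 G T p = {f.
      continuous_map (prod_topology T T) (Zp_top p) (\<lambda>(x, y). f x y)
    \<and> (\<forall>x y. (x \<notin> carrier G \<or> y \<notin> carrier G) \<longrightarrow> f x y = 0)
    \<and> (\<forall>x \<in> carrier G. \<forall>y \<in> carrier G. \<forall>z \<in> carrier G.
         (f y z - f (x \<otimes>\<^bsub>G\<^esub> y) z + f x (y \<otimes>\<^bsub>G\<^esub> z) - f x y) mod p = 0)}"

definition cohomologous :: "('a, 'm) monoid_scheme \<Rightarrow> 'a topology \<Rightarrow> int \<Rightarrow>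
    ('a \<Rightarrow> 'a \<Rightarrow> int) \<Rightarrow> ('a \<Rightarrow> 'a \<Rightarrow> int) \<Rightarrow> bool" where
  "cohomologous G T p f g \<longleftrightarrow> (\<exists>c. continuous_map T (Zp_top p) c
     \<and> (\<forall>x \<in> carrier G. \<forall>y \<in> carrier G.
          (f x y - g x y - (c x + c y - c (x \<otimes>\<^bsub>G\<^esub> y))) mod p = 0))"

definition h2class :: "('a, 'm) monoid_scheme \<Rightarrow> 'a topology \<Rightarrow> int \<Rightarrow>
    ('a \<Rightarrow> 'a \<Rightarrow> int) \<Rightarrow> ('a \<Rightarrow> 'a \<Rightarrow> int) set" where
  "h2class G T p f = {g \<in> cocycles2 G T p. cohomologous G T p f g}"

definition H2 :: "('a, 'm) monoid_scheme \<Rightarrow> 'a topology \<Rightarrow> int \<Rightarrow> ('a \<Rightarrow> 'a \<Rightarrow> int) set monoid" where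
  "H2 G T p = \<lparr>carrier = h2class G T p ` cocycles2 G T p,
     mult = (\<lambda>X Y. h2class G T p (\<lambda>x y. if x \<in> carrier G \<and> y \<in> carrier G
                    then ((SOME f. f \<in> X) x y + (SOME g. g \<in> Y) x y) mod p else 0)),
     one = h2class G T p (\<lambda>x y. 0)\<rparr>"

definition h2pull :: "('a, 'm) monoid_scheme \<Rightarrow> 'a topology \<Rightarrow> int \<Rightarrow> ('a \<Rightarrow> 'b) \<Rightarrow>
    ('b \<Rightarrow> 'b \<Rightarrow> int) set \<Rightarrow> ('a \<Rightarrow> 'a \<Rightarrow> int) set" where
  "h2pull G T p \<phi> X = h2class G T p (\<lambda>x y. if x \<in> carrier G \<and> y \<in> carrier G
                    then (SOME f. f \<in> X) (\<phi> x) (\<phi> y) else 0)"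

definition ext_class :: "int \<Rightarrow> ('u, 'v) cext \<Rightarrow> ('v \<Rightarrow> 'v \<Rightarrow> int) set" where
  "ext_class p w = (let s = (SOME s. continuous_map (Ub_top w) (U_top w) s
                         \<and> (\<forall>x \<in> carrier (Ub_grp w). proj w (s x) = x))
     in h2class (Ub_grp w) (Ub_top w) p
        (\<lambda>x y. if x \<in> carrier (Ub_grp w) \<and> y \<in> carrier (Ub_grp w)
               then the_inv_into {0..<p} (incl w)
                  (s x \<otimes>\<^bsub>U_grp w\<^esub> s y \<otimes>\<^bsub>U_grp w\<^esub> inv\<^bsub>U_grp w\<^esub> (s (x \<otimes>\<^bsub>Ub_grp w\<^esub> y)))
               else 0))"

definition liftable :: "('a, 'm) monoid_scheme \<Rightarrow> 'a topology \<Rightarrow> 'a set \<Rightarrow> ('u, 'v) cext \<Rightarrow>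
    ('a set \<Rightarrow> 'v) \<Rightarrow> bool" where
  "liftable G T N w \<rho>b \<longleftrightarrow> (\<exists>\<rho> \<in> cont_hom G T (U_grp w) (U_top w).
      \<forall>x \<in> carrier G. proj w (\<rho> x) = \<rho>b (N #>\<^bsub>G\<^esub> x))"

definition H2_pi :: "('a, 'm) monoid_scheme \<Rightarrow> 'a topology \<Rightarrow> int \<Rightarrow> ('u, 'v) cext set \<Rightarrow>
    'a set \<Rightarrow> ('a set \<Rightarrow> 'a set \<Rightarrow> int) set set" where
  "H2_pi G T p \<Omega> N = generate (H2 (G Mod N) (quot_top G T N) p)
     {h2pull (G Mod N) (quot_top G T N) p \<rho>b (ext_class p w) | w \<rho>b.
        w \<in> \<Omega> \<and> \<rho>b \<in> cont_hom (G Mod N) (quot_top G T N) (Ub_grp w) (Ub_top w)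
        \<and> liftable G T N w \<rho>b}"

text \<open>Inflation \<open>H^2(G/N2) \<rightarrow> H^2(G/N1)\<close> for N1 \<subseteq> N2, pullback along \<open>N1 x \<mapsto> N2 x\<close>.\<close>
definition inflation :: "('a, 'm) monoid_scheme \<Rightarrow> 'a topology \<Rightarrow> int \<Rightarrow> 'a set \<Rightarrow> 'a set \<Rightarrow>
    ('a set \<Rightarrow> 'a set \<Rightarrow> int) set \<Rightarrow> ('a set \<Rightarrow> 'a set \<Rightarrow> int) set" where
  "inflation G T p N1 N2 = h2pull (G Mod N1) (quot_top G T N1) p (\<lambda>C. N2 <#>\<^bsub>G\<^esub> C)"

definition QZ :: "rat monoid" where
  "QZ = \<lparr>carrier = {q. 0 \<le> q \<and> q < 1}, mult = (\<lambda>x y. frac (x + y)), one = 0\<rparr>"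

definition QZ_top :: "rat topology" where
  "QZ_top = discrete_topology {q. 0 \<le> q \<and> q < 1}"

definition dual_grp :: "('a, 'm) monoid_scheme \<Rightarrow> 'a topology \<Rightarrow> ('a \<Rightarrow> rat) monoid" where
  "dual_grp G T = \<lparr>carrier = {ch \<in> extensional (carrier G). ch \<in> cont_hom G T QZ QZ_top},
     mult = (\<lambda>ch ps. \<lambda>x \<in> carrier G. frac (ch x + ps x)),
     one = (\<lambda>x \<in> carrier G. 0)\<rparr>"

definition Zp_to_QZ :: "int \<Rightarrow> int \<Rightarrow> rat" where
  "Zp_to_QZ p k = of_int k / of_int p"

definition bilinear_Zp :: "int \<Rightarrow> ('a, 'm) monoid_scheme \<Rightarrow> ('b, 'n) monoid_scheme \<Rightarrow>
    ('a \<Rightarrow> 'b \<Rightarrow> int) \<Rightarrow> bool" where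
  "bilinear_Zp p A C B \<longleftrightarrow>
     (\<forall>a \<in> carrier A. \<forall>c \<in> carrier C. B a c \<in> {0..<p})
   \<and> (\<forall>a \<in> carrier A. \<forall>a' \<in> carrier A. \<forall>c \<in> carrier C.
        B (a \<otimes>\<^bsub>A\<^esub> a') c = (B a c + B a' c) mod p)
   \<and> (\<forall>a \<in> carrier A. \<forall>c \<in> carrier C. \<forall>c' \<in> carrier C.
        B a (c \<otimes>\<^bsub>C\<^esub> c') = (B a c + B a c') mod p)"

definition perfect_pairing :: "int \<Rightarrow> ('a, 'm) monoid_scheme \<Rightarrow> 'a topology \<Rightarrow>
    ('b, 'n) monoid_scheme \<Rightarrow> ('a \<Rightarrow> 'b \<Rightarrow> int) \<Rightarrow> bool" where
  "perfect_pairing p A TA C B \<longleftrightarrow> bilinear_Zp p A C B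
   \<and> (\<lambda>a. \<lambda>c \<in> carrier C. Zp_to_QZ p (B a c)) \<in> iso A (dual_grp C (discrete_topology (carrier C)))
   \<and> (\<lambda>c. \<lambda>a \<in> carrier A. Zp_to_QZ p (B a c)) \<in> iso C (dual_grp A TA)"

end

theory Submission
  imports Defs "HOL-Algebra.Elementary_Groups"
begin

text \<open>
  For \<open>N \<subseteq> T\<^bsub>bar\<^esub>(G)\<close>, a class \<open>X \<in> H\<^sup>2(G/N)\<close> that dies in \<open>H\<^sup>2(G)\<close> is represented by a cocycle which
  is the coboundary of a cochain \<open>c\<close> on \<open>G\<close>; then \<open>n \<mapsto> c n - c 1\<close> is a homomorphism
  \<open>\<tau>(X) : N \<rightarrow> \<int>/p\<close>, and \<open>\<tau>\<close> is an injective inverse of transgression. It is well defined because by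
  (II) every homomorphism \<open>G \<rightarrow> \<int>/p\<close> kills \<open>N\<close>. Every \<open>\<rho> : G \<rightarrow> U\<^bsub>\<omega>\<^esub>\<close> induces a liftable \<open>\<rho>\<^bsub>bar\<^esub>\<close> on
  \<open>G/N\<close>, and \<open>\<tau>\<close> maps its class to minus the restriction of \<open>\<rho>\<close> to \<open>N\<close>. So \<open>\<tau>\<close> identifies
  \<open>H\<^sup>2(G/N)\<^bsub>\<pi>\<^esub>\<close> with the group spanned by these restrictions, whose common kernel is \<open>N \<inter> T(G)\<close>.
  Since \<open>\<tau>\<close> turns inflation into restriction to \<open>N1\<close>, the pairing \<open>(n, X) \<mapsto> \<tau>(X)(n)\<close> of \<open>N2\<close> with
  the kernel of inflation is nondegenerate modulo \<open>N2 \<inter> N1 T(G)\<close>, and compactness together with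
  linear algebra over the field with \<open>p\<close> elements makes it perfect.
\<close>

section \<open>Pairings modulo a prime\<close>

text \<open>The kernel of inflation may be infinite, so no dimension count shows that the maps to
  the duals are onto. Surjectivity is treated instead as solvability of systems of congruences
  B(n,x) = v(x) modulo \<open>p\<close> in the unknown n: elimination settles finitely many
  equations, compactness settles all at once, and characters of the compact side come from solving a
  system for an enlarged pairing. On the cohomological side cocycles are not normalised. The
  equation at (1,1) gives c(1) = f(1,1) modulo \<open>p\<close>, which need not vanish; this is why
  c(1) is subtracted. The inflated cocycle is constant on N x N, and this makes the difference
  additive on N. The class of an extension is defined through a chosen continuous section. Nothing
  can be said about it before a section is shown to exist, and the finiteness of the kernel is what
  allows an elementary construction.\<close>

lemma int_mod_cong_dvd: "(p::int) dvd a mod p - a"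
  by (simp add: mod_eq_dvd_iff [symmetric])

lemma continuous_map_Zp_top:
  "continuous_map X (Zp_top p) f \<longleftrightarrow>
     f \<in> topspace X \<rightarrow> {0..<p} \<and> (\<forall>k. openin X {x \<in> topspace X. f x = k})"
proof
  assume L: "continuous_map X (Zp_top p) f"
  have "openin X {x \<in> topspace X. f x = k}" for k
  proof (cases "k \<in> {0..<p}")
    case True
    then have "openin (Zp_top p) {k}" by (simp add: Zp_top_def)
    from openin_continuous_map_preimage[OF L this] show ?thesis by simp
  next
    case False
    then have "{x \<in> topspace X. f x = k} = {}"
      using continuous_map_funspace[OF L] by (auto simp: Zp_top_def Pi_iff)
    then show ?thesis by (metis openin_empty)
  qed
  then show "f \<in> topspace X \<rightarrow> {0..<p} \<and> (\<forall>k. openin X {x \<in> topspace X. f x = k})"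
    using continuous_map_funspace[OF L] by (auto simp: Zp_top_def)
next
  assume R: "f \<in> topspace X \<rightarrow> {0..<p} \<and> (\<forall>k. openin X {x \<in> topspace X. f x = k})"
  have "openin X {x \<in> topspace X. f x \<in> U}" for U
  proof -
    have "{x \<in> topspace X. f x \<in> U} = (\<Union>k\<in>U. {x \<in> topspace X. f x = k})" by auto
    then show ?thesis using R by auto
  qed
  with R show "continuous_map X (Zp_top p) f"
    by (auto simp: continuous_map_def Zp_top_def)
qed

text \<open>A product of discrete spaces is discrete, so \<open>F\<close> only has to respect the
  range \<open>{0..<p}\<close>.\<close>

lemma continuous_map_Zp_compose2:
  assumes f: "continuous_map X (Zp_top p) f" and g: "continuous_map X (Zp_top p) g"
    and F: "\<And>i j. i \<in> {0..<p} \<Longrightarrow> j \<in> {0..<p} \<Longrightarrow> F i j \<in> {0..<p}"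
  shows "continuous_map X (Zp_top p) (\<lambda>x. F (f x) (g x))"
proof -
  have "continuous_map X (prod_topology (Zp_top p) (Zp_top p)) (\<lambda>x. (f x, g x))"
    using f g by (simp add: continuous_map_paired)
  moreover have "continuous_map (prod_topology (Zp_top p) (Zp_top p)) (Zp_top p) (\<lambda>(i, j). F i j)"
    using F by (auto simp: Zp_top_def simp flip: prod_topology_discrete_topology)
  ultimately show ?thesis
    using continuous_map_compose by (fastforce simp: o_def)
qed

lemma continuous_map_Zp_compose:
  assumes "continuous_map X (Zp_top p) f" and "\<And>i. i \<in> {0..<p} \<Longrightarrow> F i \<in> {0..<p}"
  shows "continuous_map X (Zp_top p) (\<lambda>x. F (f x))"
  using continuous_map_Zp_compose2[OF assms(1) assms(1), of "\<lambda>i _. F i"] assms(2) by simp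

text \<open>Integer powers serve as scalar multiplication, so the groups never have to be turned
  into vector spaces over the field with \<open>p\<close> elements.\<close>

lemma additive_int_pow:
  fixes p :: int and f :: "'a \<Rightarrow> int"
  assumes "group G"
    and f: "\<And>x y. x \<in> carrier G \<Longrightarrow> y \<in> carrier G \<Longrightarrow> p dvd f (x \<otimes>\<^bsub>G\<^esub> y) - (f x + f y)"
    and x: "x \<in> carrier G"
  shows "p dvd f (x [^]\<^bsub>G\<^esub> (k::int)) - k * f x"
proof -
  interpret group G by fact
  have one: "p dvd f \<one>\<^bsub>G\<^esub>"
    using f[of "\<one>\<^bsub>G\<^esub>" "\<one>\<^bsub>G\<^esub>"] by (simp add: dvd_minus_iff)
  show ?thesis
  proof (induction k rule: int_induct[where k = 0])
    case base
    then show ?case using one by simp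
  next
    case (step1 i)
    have "p dvd f (x [^]\<^bsub>G\<^esub> i \<otimes>\<^bsub>G\<^esub> x) - (f (x [^]\<^bsub>G\<^esub> i) + f x)"
      using f x by simp
    moreover have "x [^]\<^bsub>G\<^esub> (i + 1) = x [^]\<^bsub>G\<^esub> i \<otimes>\<^bsub>G\<^esub> x"
      using x by (simp add: int_pow_mult)
    ultimately have "p dvd (f (x [^]\<^bsub>G\<^esub> (i + 1)) - (f (x [^]\<^bsub>G\<^esub> i) + f x)) + (f (x [^]\<^bsub>G\<^esub> i) - i * f x)"
      using step1 by (metis dvd_add)
    then show ?case by (simp add: algebra_simps)
  next
    case (step2 i)
    have "p dvd f (x [^]\<^bsub>G\<^esub> (i - 1) \<otimes>\<^bsub>G\<^esub> x) - (f (x [^]\<^bsub>G\<^esub> (i - 1)) + f x)"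
      using f x by simp
    moreover have "x [^]\<^bsub>G\<^esub> i = x [^]\<^bsub>G\<^esub> (i - 1) \<otimes>\<^bsub>G\<^esub> x"
      using int_pow_mult[OF x, of "i - 1" 1] x by simp
    ultimately have "p dvd (f (x [^]\<^bsub>G\<^esub> i) - i * f x) - (f (x [^]\<^bsub>G\<^esub> i) - (f (x [^]\<^bsub>G\<^esub> (i - 1)) + f x))"
      using step2 by (metis dvd_diff)
    then show ?case by (simp add: algebra_simps)
  qed
qed

text \<open>Values are unreduced integers and additivity is a divisibility, so that combinations
  such as \<open>B m x + k * \<xi> m\<close> are again pairings. \<open>M\<close> may be nonabelian,
  since it stands for subgroups such as \<open>N2\<close>.\<close>

locale mod_pairing = M: group M + C: comm_group C
  for M :: "('a, 'm) monoid_scheme" and C :: "('c, 'n) monoid_scheme" +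
  fixes p :: int and B :: "'a \<Rightarrow> 'c \<Rightarrow> int"
  assumes prime_p: "prime p"
    and add_left: "\<And>m m' x. m \<in> carrier M \<Longrightarrow> m' \<in> carrier M \<Longrightarrow> x \<in> carrier C \<Longrightarrow>
      p dvd B (m \<otimes>\<^bsub>M\<^esub> m') x - (B m x + B m' x)"
    and add_right: "\<And>m x x'. m \<in> carrier M \<Longrightarrow> x \<in> carrier C \<Longrightarrow> x' \<in> carrier C \<Longrightarrow>
      p dvd B m (x \<otimes>\<^bsub>C\<^esub> x') - (B m x + B m x')"
begin

lemma pow_left:
  "m \<in> carrier M \<Longrightarrow> x \<in> carrier C \<Longrightarrow> p dvd B (m [^]\<^bsub>M\<^esub> (k::int)) x - k * B m x"
  using additive_int_pow[OF M.group_axioms, where f = "\<lambda>m. B m x"] add_left by auto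

lemma pow_right:
  "m \<in> carrier M \<Longrightarrow> x \<in> carrier C \<Longrightarrow> p dvd B m (x [^]\<^bsub>C\<^esub> (k::int)) - k * B m x"
  using additive_int_pow[OF C.group_axioms, where f = "B m"] add_right by auto

lemma subgroup_annihilator:
  assumes S: "subgroup S M" and y: "y \<in> carrier C"
  shows "subgroup {n \<in> S. p dvd B n y} M"
proof
  show "{n \<in> S. p dvd B n y} \<subseteq> carrier M" using subgroup.subset[OF S] by auto
  show "\<one>\<^bsub>M\<^esub> \<in> {n \<in> S. p dvd B n y}"
    using add_left[of "\<one>\<^bsub>M\<^esub>" "\<one>\<^bsub>M\<^esub>" y] y subgroup.one_closed[OF S] by (simp add: dvd_minus_iff)
next
  fix a b assume "a \<in> {n \<in> S. p dvd B n y}" "b \<in> {n \<in> S. p dvd B n y}"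
  moreover from this have "a \<in> carrier M" "b \<in> carrier M" using subgroup.subset[OF S] by auto
  ultimately show "a \<otimes>\<^bsub>M\<^esub> b \<in> {n \<in> S. p dvd B n y}"
    using add_left[of a b y] y subgroup.m_closed[OF S, of a b]
    by auto (metis dvd_add dvd_diff_commute diff_add_cancel)
next
  fix a assume a: "a \<in> {n \<in> S. p dvd B n y}"
  then have "a \<in> carrier M" using subgroup.subset[OF S] by auto
  then show "inv\<^bsub>M\<^esub> a \<in> {n \<in> S. p dvd B n y}"
    using pow_left[of a y "-1"] y a subgroup.m_inv_closed[OF S, of a]
    by (auto simp: M.int_pow_neg) (metis dvd_add_left_iff)
qed

text \<open>Eliminating the equation of \<open>y\<close> replaces \<open>S\<close> by the annihilator of \<open>y\<close> and shifts \<open>v\<close> by a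
  particular solution \<open>n0\<close>.\<close>

lemma finite_system_solvable:
  assumes "finite F" and "F \<subseteq> carrier C" and "subgroup S M"
    and "\<And>x y. x \<in> carrier C \<Longrightarrow> y \<in> carrier C \<Longrightarrow> p dvd v (x \<otimes>\<^bsub>C\<^esub> y) - (v x + v y)"
    and "\<And>x. x \<in> carrier C \<Longrightarrow> \<forall>n\<in>S. p dvd B n x \<Longrightarrow> p dvd v x"
  shows "\<exists>n\<in>S. \<forall>x\<in>F. p dvd B n x - v x"
  using assms
proof (induction F arbitrary: S v rule: finite_induct)
  case empty
  then show ?case using subgroup.one_closed by blast
next
  case (insert y F)
  note S = insert.prems(2) and v = insert.prems(3) and rel = insert.prems(4)
  have y: "y \<in> carrier C" and FC: "F \<subseteq> carrier C" using insert.prems(1) by auto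
  have SM: "n \<in> carrier M" if "n \<in> S" for n using subgroup.mem_carrier[OF S that] .
  have v_pow: "p dvd v (x [^]\<^bsub>C\<^esub> (k::int)) - k * v x" if "x \<in> carrier C" for x k
    using additive_int_pow[OF C.group_axioms] v that by blast
  show ?case
  proof (cases "\<forall>n\<in>S. p dvd B n y")
    case True
    obtain n where "n \<in> S" "\<forall>x\<in>F. p dvd B n x - v x"
      using insert.IH[OF FC S v rel] by blast
    moreover have "p dvd B n y - v y"
      using True \<open>n \<in> S\<close> rel[OF y] by (simp add: dvd_diff)
    ultimately show ?thesis by auto
  next
    case False
    then obtain n1 where n1: "n1 \<in> S" "\<not> p dvd B n1 y" by blast
    then have "coprime p (B n1 y)"
      using prime_imp_coprime[OF prime_p] by simp
    \<comment> \<open>Bezout: \<open>r\<close> inverts \<open>B n1 y\<close> modulo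
      \<open>p\<close>.\<close>
    then obtain s r where "s * p + r * B n1 y = 1"
      by (metis bezout_int coprime_iff_gcd_eq_1)
    then have "r * B n1 y - 1 = p * (- s)" by (simp add: algebra_simps)
    then have r: "p dvd r * B n1 y - 1" by simp
    define S' where "S' = {n \<in> S. p dvd B n y}"
    have S': "subgroup S' M" unfolding S'_def by (rule subgroup_annihilator[OF S y])
    \<comment> \<open>The exponent makes \<open>B n0 y\<close> congruent to
      \<open>r * v y * B n1 y\<close>, that is, to \<open>v y\<close>.\<close>
    define n0 where "n0 = n1 [^]\<^bsub>M\<^esub> (r * v y)"
    have n0S: "n0 \<in> S" unfolding n0_def by (rule M.subgroup_int_pow_closed[OF S n1(1)])
    have n0: "p dvd B n0 x - r * v y * B n1 x" if "x \<in> carrier C" for x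
      unfolding n0_def using pow_left that SM[OF n1(1)] by blast
    define v' where "v' x = v x - B n0 x" for x
    have v': "p dvd v' (x \<otimes>\<^bsub>C\<^esub> z) - (v' x + v' z)" if "x \<in> carrier C" "z \<in> carrier C" for x z
      using dvd_diff[OF v[OF that] add_right[OF SM[OF n0S] that]] by (simp add: v'_def algebra_simps)
    have rel': "p dvd v' x" if x: "x \<in> carrier C" and ann: "\<forall>n\<in>S'. p dvd B n x" for x
    proof -
      \<comment> \<open>A relation \<open>x\<close> on \<open>S'\<close> becomes a relation
        \<open>z\<close> on all of \<open>S\<close> after multiplication by the power of
        \<open>y\<close> that makes it orthogonal to \<open>n1\<close>. For arbitrary
        \<open>n\<close> in \<open>S\<close>, the power \<open>t\<close> of \<open>n1\<close> below
        moves \<open>n\<close> into \<open>S'\<close>, where the hypothesis on \<open>x\<close>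
        applies.\<close>
      define q where "q = - (r * B n1 x)"
      define z where "z = x \<otimes>\<^bsub>C\<^esub> y [^]\<^bsub>C\<^esub> q"
      have z: "z \<in> carrier C" unfolding z_def using x y by simp
      have "p dvd B n z" if n: "n \<in> S" for n
      proof -
        define t where "t = - (r * B n y)"
        define n' where "n' = n \<otimes>\<^bsub>M\<^esub> n1 [^]\<^bsub>M\<^esub> t"
        have n1t: "n1 [^]\<^bsub>M\<^esub> t \<in> S" by (rule M.subgroup_int_pow_closed[OF S n1(1)])
        have n'S: "n' \<in> S" unfolding n'_def by (rule subgroup.m_closed[OF S n n1t])
        have Bn': "p dvd B n' c - (B n c + t * B n1 c)" if "c \<in> carrier C" for c
          using dvd_add[OF add_left[OF SM[OF n] SM[OF n1t] that] pow_left[OF SM[OF n1(1)] that, of t]]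
          by (simp add: n'_def algebra_simps)
        have "p dvd (B n' y - (B n y + t * B n1 y)) - B n y * (r * B n1 y - 1)"
          by (rule dvd_diff[OF Bn'[OF y] dvd_mult[OF r]])
        then have "p dvd B n' y" by (simp add: t_def algebra_simps)
        then have 1: "p dvd B n' x" using ann n'S by (simp add: S'_def)
        have "p dvd (B n z - (B n x + B n (y [^]\<^bsub>C\<^esub> q))) + (B n (y [^]\<^bsub>C\<^esub> q) - q * B n y)"
          unfolding z_def by (intro dvd_add add_right pow_right SM n x y) (simp add: y)
        from dvd_add[OF dvd_diff[OF this Bn'[OF x]] 1] show ?thesis
          by (simp add: q_def t_def algebra_simps)
      qed
      then have "p dvd v z" using rel[OF z] by blast
      moreover have "p dvd v z - (v x + q * v y)"
        using dvd_add[OF v[OF x, of "y [^]\<^bsub>C\<^esub> q"] v_pow[OF y, of q]] y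
        by (simp add: z_def algebra_simps)
      ultimately have "p dvd v x + q * v y"
        by (metis dvd_diff diff_diff_eq2 add_diff_cancel_left' add_diff_cancel_right' minus_diff_eq)
      from dvd_diff[OF this n0[OF x]] show ?thesis
        by (simp add: v'_def q_def algebra_simps)
    qed
    obtain m where m: "m \<in> S'" "\<forall>x\<in>F. p dvd B m x - v' x"
      using insert.IH[OF FC S' v' rel'] by blast
    have mS: "m \<in> S" and my: "p dvd B m y" using m(1) by (auto simp: S'_def)
    have sum: "p dvd B (m \<otimes>\<^bsub>M\<^esub> n0) x - (B m x + B n0 x)" if "x \<in> carrier C" for x
      by (rule add_left[OF SM[OF mS] SM[OF n0S] that])
    have "p dvd B (m \<otimes>\<^bsub>M\<^esub> n0) x - v x" if "x \<in> F" for x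
      using dvd_add[OF sum[of x]] m(2) that FC by (fastforce simp: v'_def)
    moreover have "p dvd B (m \<otimes>\<^bsub>M\<^esub> n0) y - v y"
    proof -
      have "p dvd (B (m \<otimes>\<^bsub>M\<^esub> n0) y - (B m y + B n0 y)) + B m y + (B n0 y - r * v y * B n1 y)
          + v y * (r * B n1 y - 1)"
        by (intro dvd_add sum n0 y my dvd_mult r)
      then show ?thesis by (simp add: algebra_simps)
    qed
    ultimately show ?thesis using subgroup.m_closed[OF S mS n0S] by auto
  qed
qed

text \<open>Each equation cuts out a closed set, the preimage of a point of a discrete space, and
  finitely many of these sets meet by \<open>finite_system_solvable\<close>. Compactness then gives
  a common point, however large \<open>C\<close> is.\<close>

lemma system_solvable:
  assumes T: "compact_space T" "topspace T = carrier M"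
    and cont: "\<And>x. x \<in> carrier C \<Longrightarrow> continuous_map T (Zp_top p) (\<lambda>m. B m x mod p)"
    and v: "\<And>x y. x \<in> carrier C \<Longrightarrow> y \<in> carrier C \<Longrightarrow> p dvd v (x \<otimes>\<^bsub>C\<^esub> y) - (v x + v y)"
    and rel: "\<And>x. x \<in> carrier C \<Longrightarrow> \<forall>n\<in>carrier M. p dvd B n x \<Longrightarrow> p dvd v x"
  shows "\<exists>n\<in>carrier M. \<forall>x\<in>carrier C. p dvd B n x - v x"
proof -
  define E where "E x = {m \<in> topspace T. B m x mod p \<in> {v x mod p}}" for x
  have E_iff: "m \<in> E x \<longleftrightarrow> m \<in> carrier M \<and> p dvd B m x - v x" for m x
    by (auto simp: E_def T(2) mod_eq_dvd_iff)
  have "closedin T (E x)" if "x \<in> carrier C" for x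
    unfolding E_def
    by (rule closedin_continuous_map_preimage[OF cont[OF that]])
       (use prime_gt_0_int[OF prime_p] in \<open>auto simp: Zp_top_def closedin_def openin_discrete_topology\<close>)
  moreover have "topspace T \<inter> \<Inter>\<F> \<noteq> {}" if \<F>: "finite \<F>" "\<F> \<subseteq> E ` carrier C" for \<F>
  proof -
    obtain F where F: "finite F" "F \<subseteq> carrier C" "\<F> = E ` F"
      using finite_subset_image[OF \<F>] by blast
    obtain n where "n \<in> carrier M" "\<forall>x\<in>F. p dvd B n x - v x"
      using finite_system_solvable[OF F(1,2) M.subgroup_self v rel] by blast
    then have "n \<in> topspace T \<inter> \<Inter>\<F>" using F(3) T(2) by (auto simp: E_iff)
    then show ?thesis by blast
  qed
  ultimately have "topspace T \<inter> \<Inter>(E ` carrier C) \<noteq> {}"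
    using T(1)[unfolded compact_space_def compactin_fip, THEN conjunct2, rule_format, of "E ` carrier C"]
    by blast
  then show ?thesis using T(2) by (fastforce simp: E_iff)
qed

text \<open>Pairing with \<open>C \<times> \<int>\<close>, the second factor acting through \<open>\<xi>\<close>, and prescribing \<open>(x, k) \<mapsto> k\<close>: a
  solution would be killed by \<open>C\<close> but not by \<open>\<xi>\<close>, so there must be an obstruction, i.e. a relation
  between \<open>\<xi>\<close> and \<open>C\<close>.\<close>

lemma character_representable:
  assumes T: "compact_space T" "topspace T = carrier M"
    and cont: "\<And>x. x \<in> carrier C \<Longrightarrow> continuous_map T (Zp_top p) (\<lambda>m. B m x mod p)"
    and chi: "\<And>m n. m \<in> carrier M \<Longrightarrow> n \<in> carrier M \<Longrightarrow> p dvd \<xi> (m \<otimes>\<^bsub>M\<^esub> n) - (\<xi> m + \<xi> n)"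
    and cont_chi: "continuous_map T (Zp_top p) (\<lambda>m. \<xi> m mod p)"
    and ann: "\<And>m. m \<in> carrier M \<Longrightarrow> \<forall>x\<in>carrier C. p dvd B m x \<Longrightarrow> p dvd \<xi> m"
  shows "\<exists>x\<in>carrier C. \<forall>m\<in>carrier M. p dvd B m x - \<xi> m"
proof (rule ccontr)
  assume none: "\<not> ?thesis"
  define D where "D = C \<times>\<times> integer_group"
  define B' where "B' m = (\<lambda>(x, k). B m x + k * \<xi> m)" for m
  have p0: "p > 0" using prime_p by (rule prime_gt_0_int)
  interpret Z: comm_group integer_group by (rule abelian_integer_group)
  interpret D: comm_group D
  proof -
    interpret group D
      unfolding D_def by (rule DirProd_group[OF C.group_axioms group_integer_group])
    show "comm_group D"
      by (rule group_comm_groupI) (auto simp: D_def C.m_comm)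
  qed
  interpret D: mod_pairing M D p B'
  proof
    show "prime p" by (rule prime_p)
    show "p dvd B' (m \<otimes>\<^bsub>M\<^esub> m') x - (B' m x + B' m' x)"
      if "m \<in> carrier M" "m' \<in> carrier M" "x \<in> carrier D" for m m' x
    proof -
      obtain y k where x: "x = (y, k)" by force
      then have "y \<in> carrier C" using that(3) by (simp add: D_def)
      from dvd_add[OF add_left[OF that(1,2) this] dvd_mult[OF chi[OF that(1,2)], of k]]
      show ?thesis by (simp add: B'_def x algebra_simps)
    qed
    show "p dvd B' m (x \<otimes>\<^bsub>D\<^esub> x') - (B' m x + B' m x')"
      if "m \<in> carrier M" "x \<in> carrier D" "x' \<in> carrier D" for m x x'
    proof -
      obtain y k y' k' where x: "x = (y, k)" "x' = (y', k')" by force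
      then have "y \<in> carrier C" "y' \<in> carrier C" using that by (simp_all add: D_def)
      from add_right[OF that(1) this] show ?thesis
        by (simp add: B'_def x D_def algebra_simps)
    qed
  qed
  have "\<exists>n\<in>carrier M. \<forall>x\<in>carrier D. p dvd B' n x - snd x"
  proof (rule D.system_solvable[OF T])
    fix x assume x: "x \<in> carrier D"
    have "continuous_map T (Zp_top p) (\<lambda>m. (B m (fst x) mod p + snd x * (\<xi> m mod p)) mod p)"
      by (rule continuous_map_Zp_compose2[OF cont cont_chi, of "fst x" "\<lambda>i j. (i + snd x * j) mod p"])
         (use x p0 in \<open>auto simp: D_def\<close>)
    moreover have "(b mod p + k * (c mod p)) mod p = (b + k * c) mod p" for b c k
      by (rule mod_add_cong[OF mod_mod_trivial mod_mult_right_eq])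
    ultimately show "continuous_map T (Zp_top p) (\<lambda>m. B' m x mod p)"
      by (simp add: B'_def case_prod_unfold)
  next
    show "p dvd snd (x \<otimes>\<^bsub>D\<^esub> y) - (snd x + snd y)" if "x \<in> carrier D" "y \<in> carrier D" for x y
      by (cases x; cases y) (simp add: D_def)
  next
    fix x assume x: "x \<in> carrier D" and rel: "\<forall>n\<in>carrier M. p dvd B' n x"
    obtain y k where yk: "x = (y, k)" by force
    then have y: "y \<in> carrier C" using x by (simp add: D_def)
    show "p dvd snd x"
    proof (rule ccontr)
      assume "\<not> p dvd snd x"
      then have "coprime p k"
        using prime_imp_coprime[OF prime_p] by (simp add: yk)
      then obtain s r where "s * p + r * k = 1"
        by (metis bezout_int coprime_iff_gcd_eq_1)
      then have r: "r * k - 1 = p * (- s)" by (simp add: algebra_simps)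
      \<comment> \<open>Since \<open>r\<close> inverts \<open>k\<close>, the relation between
        \<open>B m y\<close> and \<open>k * \<xi> m\<close> expresses \<open>\<xi>\<close> as the
        pairing with \<open>y\<close> to the power \<open>- r\<close>, which \<open>none\<close>
        excludes.\<close>
      have "p dvd B m (y [^]\<^bsub>C\<^esub> (- r)) - \<xi> m" if m: "m \<in> carrier M" for m
      proof -
        have "p dvd B m y + k * \<xi> m" using rel m by (simp add: B'_def yk)
        then have "p dvd r * (B m y + k * \<xi> m)" by (rule dvd_mult)
        moreover have "p dvd (r * k - 1) * \<xi> m" unfolding r by simp
        ultimately have "p dvd (B m (y [^]\<^bsub>C\<^esub> (- r)) - (- r) * B m y) - r * (B m y + k * \<xi> m)
            + (r * k - 1) * \<xi> m"
          using pow_right[OF m y, of "- r"] by (simp only: dvd_add dvd_diff)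
        then show ?thesis by (simp add: algebra_simps)
      qed
      moreover have "y [^]\<^bsub>C\<^esub> (- r) \<in> carrier C" using y by simp
      ultimately show False using none by blast
    qed
  qed
  then obtain n where n: "n \<in> carrier M" "\<forall>x\<in>carrier D. p dvd B' n x - snd x" by blast
  \<comment> \<open>Testing the solution on the pairs \<open>(x, 0)\<close> puts \<open>n\<close> in
    the annihilator of \<open>C\<close>, so \<open>\<xi> n\<close> vanishes modulo \<open>p\<close>;
    testing it on the identity paired with 1 forces \<open>\<xi> n\<close> to be 1.\<close>
  have "p dvd B n x" if "x \<in> carrier C" for x
    using n(2)[rule_format, of "(x, 0)"] that by (simp add: D_def B'_def)
  then have "p dvd \<xi> n" using ann n(1) by blast
  moreover have "p dvd B n \<one>\<^bsub>C\<^esub>" using \<open>\<And>x. x \<in> carrier C \<Longrightarrow> p dvd B n x\<close> by simp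
  moreover have "p dvd B n \<one>\<^bsub>C\<^esub> + \<xi> n - 1"
    using n(2)[rule_format, of "(\<one>\<^bsub>C\<^esub>, 1)"] by (simp add: D_def B'_def)
  ultimately have "p dvd (B n \<one>\<^bsub>C\<^esub> + \<xi> n) - (B n \<one>\<^bsub>C\<^esub> + \<xi> n - 1)"
    by (simp only: dvd_add dvd_diff)
  then have "p dvd 1" by (simp only: diff_diff_eq2 add_diff_cancel_left')
  then show False using prime_p by auto
qed

end

section \<open>Characters with values in Q/Z and perfect pairings\<close>

lemma Zp_to_QZ_range: "i \<in> {0..<p} \<Longrightarrow> 0 \<le> Zp_to_QZ p i \<and> Zp_to_QZ p i < 1"
  by (auto simp: Zp_to_QZ_def divide_simps)

lemma Zp_to_QZ_inject:
  "i \<in> {0..<p} \<Longrightarrow> j \<in> {0..<p} \<Longrightarrow> Zp_to_QZ p i = Zp_to_QZ p j \<longleftrightarrow> i = j"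
  by (auto simp: Zp_to_QZ_def divide_simps)

lemma frac_Zp_to_QZ_add:
  assumes "p > 0"
  shows "frac (Zp_to_QZ p i + Zp_to_QZ p j) = Zp_to_QZ p ((i + j) mod p)"
proof -
  have "Zp_to_QZ p i + Zp_to_QZ p j - Zp_to_QZ p ((i + j) mod p)
      = (of_int (i + j) - of_int ((i + j) mod p)) / of_int p"
    by (simp add: Zp_to_QZ_def add_divide_distrib diff_divide_distrib)
  also have "\<dots> = of_int ((i + j) div p * p) / of_int p"
    by (simp only: of_int_diff [symmetric] minus_mod_eq_div_mult)
  also have "\<dots> = of_int ((i + j) div p)" using assms by simp
  finally have "Zp_to_QZ p i + Zp_to_QZ p j - Zp_to_QZ p ((i + j) mod p) \<in> \<int>" by simp
  then show ?thesis
    using Zp_to_QZ_range[of "(i + j) mod p" p] assms by (simp add: frac_unique_iff)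
qed

text \<open>Meant for the value of an additive map at the identity, which is its own double modulo
  \<open>p\<close>.\<close>

lemma dvd_if_eq_double_mod:
  assumes "a = (a + a) mod (p::int)"
  shows "p dvd a"
proof -
  have "a - (a + a) = (a + a) mod p - (a + a)" using assms by simp
  then have "p dvd a - (a + a)" by (simp only: int_mod_cong_dvd)
  then show ?thesis by simp
qed

lemma hom_QZ_pow:
  assumes "group Y" and f: "f \<in> hom Y QZ" and y: "y \<in> carrier Y"
  shows "f (y [^]\<^bsub>Y\<^esub> (n::nat)) = frac (of_nat n * f y)"
proof -
  interpret group Y by fact
  have add: "f (a \<otimes>\<^bsub>Y\<^esub> b) = frac (f a + f b)" if "a \<in> carrier Y" "b \<in> carrier Y" for a b
    using hom_mult[OF f that] by (simp add: QZ_def)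
  have range: "0 \<le> f a \<and> f a < 1" if "a \<in> carrier Y" for a
    using hom_in_carrier[OF f that] by (simp add: QZ_def)
  have "f \<one>\<^bsub>Y\<^esub> \<in> \<int>"
    using add[of "\<one>\<^bsub>Y\<^esub>" "\<one>\<^bsub>Y\<^esub>"] frac_unique_iff[of "f \<one>\<^bsub>Y\<^esub> + f \<one>\<^bsub>Y\<^esub>" "f \<one>\<^bsub>Y\<^esub>"] by simp
  then have "f \<one>\<^bsub>Y\<^esub> = 0"
    using range[of "\<one>\<^bsub>Y\<^esub>"] by (metis frac_eq frac_eq_0_iff monoid.one_closed[OF monoid_axioms])
  then show ?thesis
    by (induction n) (auto simp: add y algebra_simps)
qed

text \<open>In a group of exponent \<open>p\<close> the number p f(y) is an integer for every
  character f, so f takes values in multiples of 1/p and \<open>v\<close> is the numerator. The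
  floor only makes \<open>v\<close> integer-valued by type.\<close>

lemma character_of_exponent:
  assumes "p > 0" and "group Y" and f: "f \<in> cont_hom Y TY QZ QZ_top"
    and exponent: "\<And>y. y \<in> carrier Y \<Longrightarrow> y [^]\<^bsub>Y\<^esub> p = \<one>\<^bsub>Y\<^esub>"
  obtains v where "continuous_map TY (Zp_top p) v"
    and "\<And>y. y \<in> carrier Y \<Longrightarrow> v y \<in> {0..<p} \<and> f y = Zp_to_QZ p (v y)"
    and "\<And>y z. y \<in> carrier Y \<Longrightarrow> z \<in> carrier Y \<Longrightarrow> v (y \<otimes>\<^bsub>Y\<^esub> z) = (v y + v z) mod p"
proof
  interpret group Y by fact
  have hom: "f \<in> hom Y QZ" and cont: "continuous_map TY QZ_top f"
    using f by (auto simp: cont_hom_def)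
  define v where "v y = \<lfloor>of_int p * f y\<rfloor>" for y
  have floor_range: "\<lfloor>of_int p * q\<rfloor> \<in> {0..<p}" if "0 \<le> q" "q < 1" for q :: rat
    using that \<open>p > 0\<close> by (auto simp: floor_less_iff)
  have "continuous_map QZ_top (Zp_top p) (\<lambda>q. \<lfloor>of_int p * q\<rfloor>)"
    using floor_range by (auto simp: QZ_top_def Zp_top_def)
  from continuous_map_compose[OF cont this] show "continuous_map TY (Zp_top p) v"
    by (simp add: o_def v_def[abs_def])
  show v: "v y \<in> {0..<p} \<and> f y = Zp_to_QZ p (v y)" if y: "y \<in> carrier Y" for y
  proof -
    have range: "0 \<le> f y" "f y < 1"
      using hom_in_carrier[OF hom y] by (simp_all add: QZ_def)
    have "y [^]\<^bsub>Y\<^esub> nat p = \<one>\<^bsub>Y\<^esub>"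
      using exponent[OF y] \<open>p > 0\<close> by (metis int_nat_eq int_pow_int less_le)
    then have "frac (of_nat (nat p) * f y) = 0"
      using hom_QZ_pow[OF \<open>group Y\<close> hom y, of "nat p"] hom_QZ_pow[OF \<open>group Y\<close> hom y, of 0] by simp
    then have "of_int p * f y \<in> \<int>" using \<open>p > 0\<close> by simp
    then have "of_int (v y) = of_int p * f y" by (auto simp: v_def elim: Ints_cases)
    then show ?thesis
      using floor_range[OF range] \<open>p > 0\<close> by (simp add: v_def[symmetric] Zp_to_QZ_def)
  qed
  show "v (y \<otimes>\<^bsub>Y\<^esub> z) = (v y + v z) mod p" if "y \<in> carrier Y" "z \<in> carrier Y" for y z
  proof -
    have "Zp_to_QZ p (v (y \<otimes>\<^bsub>Y\<^esub> z)) = frac (f y + f z)"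
      using v[of "y \<otimes>\<^bsub>Y\<^esub> z"] hom_mult[OF hom that] that by (simp add: QZ_def)
    also have "\<dots> = Zp_to_QZ p ((v y + v z) mod p)"
      using v that \<open>p > 0\<close> by (simp add: frac_Zp_to_QZ_add)
    finally show ?thesis
      using Zp_to_QZ_inject[of "v (y \<otimes>\<^bsub>Y\<^esub> z)" p "(v y + v z) mod p"] v that \<open>p > 0\<close> by simp
  qed
qed

text \<open>A \<open>p\<close>-th power pairs with everything to a multiple of \<open>p\<close>, so
  nondegeneracy kills it. This supplies the hypothesis of
  \<open>character_of_exponent\<close>.\<close>

lemma (in mod_pairing) exponent_left:
  assumes m: "m \<in> carrier M"
    and nondeg: "\<And>m. m \<in> carrier M \<Longrightarrow> \<forall>x\<in>carrier C. p dvd B m x \<Longrightarrow> m = \<one>\<^bsub>M\<^esub>"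
  shows "m [^]\<^bsub>M\<^esub> p = \<one>\<^bsub>M\<^esub>"
proof (rule nondeg)
  show "\<forall>x\<in>carrier C. p dvd B (m [^]\<^bsub>M\<^esub> p) x"
    using pow_left[OF m, of _ p] by (metis dvd_diff_commute dvd_triv_left zdvd_zdiffD)
qed (use m in simp)

lemma (in mod_pairing) exponent_right:
  assumes x: "x \<in> carrier C"
    and nondeg: "\<And>x. x \<in> carrier C \<Longrightarrow> \<forall>m\<in>carrier M. p dvd B m x \<Longrightarrow> x = \<one>\<^bsub>C\<^esub>"
  shows "x [^]\<^bsub>C\<^esub> p = \<one>\<^bsub>C\<^esub>"
proof (rule nondeg)
  show "\<forall>m\<in>carrier M. p dvd B m (x [^]\<^bsub>C\<^esub> p)"
    using pow_right[OF _ x, of _ p] by (metis dvd_diff_commute dvd_triv_left zdvd_zdiffD)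
qed (use x in simp)

text \<open>Serves both directions of perfectness, so the topology on \<open>Y\<close> is a
  parameter: discrete for the dual of \<open>C\<close>, the given one for the dual of
  \<open>A\<close>. \<open>nondeg\<close> yields injectivity; \<open>exponent\<close> turns a
  character into a map to Z/p, which \<open>represent\<close> realises by an element of
  \<open>X\<close>.\<close>

lemma iso_dual_grpI:
  assumes p: "p > 0" and X: "group X" and Y: "group Y" and TY: "topspace TY = carrier Y"
    and range: "\<And>x y. x \<in> carrier X \<Longrightarrow> y \<in> carrier Y \<Longrightarrow> P x y \<in> {0..<p}"
    and add1: "\<And>x x' y. x \<in> carrier X \<Longrightarrow> x' \<in> carrier X \<Longrightarrow> y \<in> carrier Y \<Longrightarrow>
      P (x \<otimes>\<^bsub>X\<^esub> x') y = (P x y + P x' y) mod p"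
    and add2: "\<And>x y y'. x \<in> carrier X \<Longrightarrow> y \<in> carrier Y \<Longrightarrow> y' \<in> carrier Y \<Longrightarrow>
      P x (y \<otimes>\<^bsub>Y\<^esub> y') = (P x y + P x y') mod p"
    and cont: "\<And>x. x \<in> carrier X \<Longrightarrow> continuous_map TY (Zp_top p) (P x)"
    and nondeg: "\<And>x. x \<in> carrier X \<Longrightarrow> \<forall>y\<in>carrier Y. P x y = 0 \<Longrightarrow> x = \<one>\<^bsub>X\<^esub>"
    and exponent: "\<And>y. y \<in> carrier Y \<Longrightarrow> y [^]\<^bsub>Y\<^esub> p = \<one>\<^bsub>Y\<^esub>"
    and represent: "\<And>v. continuous_map TY (Zp_top p) v \<Longrightarrow>
      (\<And>y z. y \<in> carrier Y \<Longrightarrow> z \<in> carrier Y \<Longrightarrow> v (y \<otimes>\<^bsub>Y\<^esub> z) = (v y + v z) mod p) \<Longrightarrow>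
      \<exists>x\<in>carrier X. \<forall>y\<in>carrier Y. p dvd P x y - v y"
  shows "(\<lambda>x. \<lambda>y\<in>carrier Y. Zp_to_QZ p (P x y)) \<in> iso X (dual_grp Y TY)"
proof -
  interpret X: group X by fact
  interpret Y: group Y by fact
  define h where "h x = (\<lambda>y\<in>carrier Y. Zp_to_QZ p (P x y))" for x
  have dual: "h x \<in> carrier (dual_grp Y TY)" if x: "x \<in> carrier X" for x
  proof -
    have "continuous_map (Zp_top p) QZ_top (Zp_to_QZ p)"
      using Zp_to_QZ_range by (auto simp: Zp_top_def QZ_top_def)
    from continuous_map_compose[OF cont[OF x] this]
    have "continuous_map TY QZ_top (h x)"
      by (rule continuous_map_eq) (simp add: h_def TY)
    moreover have "h x \<in> hom Y QZ"
      using Zp_to_QZ_range[OF range[OF x]] x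
      by (auto simp: hom_def h_def QZ_def add2 frac_Zp_to_QZ_add p)
    ultimately show ?thesis by (simp add: dual_grp_def cont_hom_def h_def)
  qed
  have "h \<in> hom X (dual_grp Y TY)"
    using dual by (intro homI) (auto simp: dual_grp_def h_def add1 frac_Zp_to_QZ_add p cong: restrict_cong)
  moreover have "inj_on h (carrier X)"
  proof (rule inj_onI)
    fix x x' assume x: "x \<in> carrier X" "x' \<in> carrier X" and eq: "h x = h x'"
    have "P (x \<otimes>\<^bsub>X\<^esub> inv\<^bsub>X\<^esub> x') y = 0" if y: "y \<in> carrier Y" for y
    proof -
      have "P x y = P x' y"
        using fun_cong[OF eq, of y] y Zp_to_QZ_inject[OF range[OF x(1) y] range[OF x(2) y]]
        by (simp add: h_def)
      moreover have "x \<otimes>\<^bsub>X\<^esub> inv\<^bsub>X\<^esub> x' \<otimes>\<^bsub>X\<^esub> x' = x"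
        using x by (simp add: X.m_assoc)
      ultimately have "(P (x \<otimes>\<^bsub>X\<^esub> inv\<^bsub>X\<^esub> x') y + P x y) mod p = P x y mod p"
        using add1[of "x \<otimes>\<^bsub>X\<^esub> inv\<^bsub>X\<^esub> x'" x' y] range[OF x(1) y] x y by simp
      then have "p dvd P (x \<otimes>\<^bsub>X\<^esub> inv\<^bsub>X\<^esub> x') y" by (simp add: mod_eq_dvd_iff)
      then show ?thesis
        using range[of "x \<otimes>\<^bsub>X\<^esub> inv\<^bsub>X\<^esub> x'" y] x y by (auto dest: zdvd_imp_le)
    qed
    then have "x \<otimes>\<^bsub>X\<^esub> inv\<^bsub>X\<^esub> x' = \<one>\<^bsub>X\<^esub>" using nondeg x by simp
    then show "x = x'" using x by (metis X.inv_solve_right' X.l_one X.one_closed)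
  qed
  moreover have "\<exists>x\<in>carrier X. f = h x" if f: "f \<in> carrier (dual_grp Y TY)" for f
  proof -
    have ext: "f \<in> extensional (carrier Y)" and ch: "f \<in> cont_hom Y TY QZ QZ_top"
      using f by (auto simp: dual_grp_def)
    obtain v where v: "continuous_map TY (Zp_top p) v"
      "\<And>y. y \<in> carrier Y \<Longrightarrow> v y \<in> {0..<p} \<and> f y = Zp_to_QZ p (v y)"
      "\<And>y z. y \<in> carrier Y \<Longrightarrow> z \<in> carrier Y \<Longrightarrow> v (y \<otimes>\<^bsub>Y\<^esub> z) = (v y + v z) mod p"
      using character_of_exponent[OF p Y ch exponent] by blast
    obtain x where x: "x \<in> carrier X" "\<forall>y\<in>carrier Y. p dvd P x y - v y"
      using represent[OF v(1) v(3)] by blast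
    have "P x y = v y" if "y \<in> carrier Y" for y
    proof -
      have "P x y mod p = v y mod p" using x(2) that by (simp add: mod_eq_dvd_iff)
      then show ?thesis using range[OF x(1) that] v(2)[OF that] by simp
    qed
    then have "f = h x" using ext v(2) by (auto simp: h_def extensional_def fun_eq_iff)
    then show ?thesis using x(1) by blast
  qed
  ultimately have "h \<in> iso X (dual_grp Y TY)"
    using dual by (auto simp: iso_def bij_betw_def)
  then show ?thesis by (simp add: h_def[abs_def])
qed

text \<open>Nondegeneracy gives injectivity and exponent \<open>p\<close> on both sides. A character
  of \<open>C\<close> is a system of equations on \<open>A\<close>, solved by
  \<open>system_solvable\<close>; a continuous character of \<open>A\<close> comes from
  \<open>C\<close> by \<open>character_representable\<close>. Both rest on the compactness of
  \<open>A\<close>.\<close>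

lemma perfect_pairingI:
  assumes "prime p" and A: "group A" and C: "comm_group C"
    and TA: "compact_space TA" "topspace TA = carrier A"
    and bil: "bilinear_Zp p A C B"
    and cont: "\<And>c. c \<in> carrier C \<Longrightarrow> continuous_map TA (Zp_top p) (\<lambda>a. B a c)"
    and left: "\<And>a. a \<in> carrier A \<Longrightarrow> \<forall>c\<in>carrier C. B a c = 0 \<Longrightarrow> a = \<one>\<^bsub>A\<^esub>"
    and right: "\<And>c. c \<in> carrier C \<Longrightarrow> \<forall>a\<in>carrier A. B a c = 0 \<Longrightarrow> c = \<one>\<^bsub>C\<^esub>"
  shows "perfect_pairing p A TA C B"
proof -
  have p: "p > 0" using \<open>prime p\<close> by (rule prime_gt_0_int)
  have range: "B a c \<in> {0..<p}" if "a \<in> carrier A" "c \<in> carrier C" for a c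
    using bil that by (simp add: bilinear_Zp_def)
  have add1: "B (a \<otimes>\<^bsub>A\<^esub> a') c = (B a c + B a' c) mod p"
    if "a \<in> carrier A" "a' \<in> carrier A" "c \<in> carrier C" for a a' c
    using bil that by (simp add: bilinear_Zp_def)
  have add2: "B a (c \<otimes>\<^bsub>C\<^esub> c') = (B a c + B a c') mod p"
    if "a \<in> carrier A" "c \<in> carrier C" "c' \<in> carrier C" for a c c'
    using bil that by (simp add: bilinear_Zp_def)
  interpret group A by fact
  interpret C: comm_group C by fact
  interpret mod_pairing A C p B
    by unfold_locales (auto simp: \<open>prime p\<close> add1 add2 int_mod_cong_dvd)
  have zero: "B a c = 0" if "p dvd B a c" "a \<in> carrier A" "c \<in> carrier C" for a c
    using that range[of a c] by (auto dest: zdvd_imp_le)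
  have left': "a = \<one>\<^bsub>A\<^esub>" if "a \<in> carrier A" "\<forall>c\<in>carrier C. p dvd B a c" for a
    using left zero that by blast
  have right': "c = \<one>\<^bsub>C\<^esub>" if "c \<in> carrier C" "\<forall>a\<in>carrier A. p dvd B a c" for c
    using right zero that by blast
  have cont': "continuous_map TA (Zp_top p) (\<lambda>a. B a c mod p)" if "c \<in> carrier C" for c
    by (rule continuous_map_eq[OF cont[OF that]]) (use range that TA in auto)
  have "(\<lambda>a. \<lambda>c\<in>carrier C. Zp_to_QZ p (B a c)) \<in> iso A (dual_grp C (discrete_topology (carrier C)))"
  proof (rule iso_dual_grpI[OF p A C.group_axioms])
    show "continuous_map (discrete_topology (carrier C)) (Zp_top p) (B a)" if "a \<in> carrier A" for a
      using range that by (auto simp: Zp_top_def)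
    show "\<exists>a\<in>carrier A. \<forall>c\<in>carrier C. p dvd B a c - v c"
      if v: "\<And>c c'. c \<in> carrier C \<Longrightarrow> c' \<in> carrier C \<Longrightarrow> v (c \<otimes>\<^bsub>C\<^esub> c') = (v c + v c') mod p" for v
    proof (rule system_solvable[OF TA cont'])
      show "p dvd v (c \<otimes>\<^bsub>C\<^esub> c') - (v c + v c')" if "c \<in> carrier C" "c' \<in> carrier C" for c c'
        using v that by (simp add: int_mod_cong_dvd)
      have "p dvd v \<one>\<^bsub>C\<^esub>"
        using v[of "\<one>\<^bsub>C\<^esub>" "\<one>\<^bsub>C\<^esub>"] by (intro dvd_if_eq_double_mod) simp
      then show "p dvd v c" if "c \<in> carrier C" "\<forall>a\<in>carrier A. p dvd B a c" for c
        using right'[OF that] by simp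
    qed
  qed (use range add1 add2 left exponent_right right' in auto)
  moreover have "(\<lambda>c. \<lambda>a\<in>carrier A. Zp_to_QZ p (B a c)) \<in> iso C (dual_grp A TA)"
  proof (rule iso_dual_grpI[OF p C.group_axioms A TA(2)])
    show "\<exists>c\<in>carrier C. \<forall>a\<in>carrier A. p dvd B a c - v a"
      if cv: "continuous_map TA (Zp_top p) v"
        and v: "\<And>a a'. a \<in> carrier A \<Longrightarrow> a' \<in> carrier A \<Longrightarrow> v (a \<otimes>\<^bsub>A\<^esub> a') = (v a + v a') mod p" for v
    proof (rule character_representable[OF TA cont'])
      show "p dvd v (a \<otimes>\<^bsub>A\<^esub> a') - (v a + v a')" if "a \<in> carrier A" "a' \<in> carrier A" for a a'
        using v that by (simp add: int_mod_cong_dvd)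
      show "continuous_map TA (Zp_top p) (\<lambda>a. v a mod p)"
        by (rule continuous_map_Zp_compose[OF cv]) (use p in auto)
      have "p dvd v \<one>\<^bsub>A\<^esub>"
        using v[of "\<one>\<^bsub>A\<^esub>" "\<one>\<^bsub>A\<^esub>"] by (intro dvd_if_eq_double_mod) simp
      then show "p dvd v a" if "a \<in> carrier A" "\<forall>c\<in>carrier C. p dvd B a c" for a
        using left'[OF that] by simp
    qed
  qed (use range add1 add2 right cont exponent_left left' in auto)
  ultimately show ?thesis using bil by (simp add: perfect_pairing_def)
qed

section \<open>Quotients of topological groups\<close>

lemma cont_homD:
  assumes "f \<in> cont_hom G T H S"
  shows "f \<in> hom G H" and "continuous_map T S f"
  using assms by (auto simp: cont_hom_def)

lemma cont_hom_compose:
  assumes "f \<in> cont_hom G T H S" and "g \<in> cont_hom H S K R"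
  shows "(\<lambda>x. g (f x)) \<in> cont_hom G T K R"
  using hom_compose[OF cont_homD(1)[OF assms(1)] cont_homD(1)[OF assms(2)]]
    continuous_map_compose[OF cont_homD(2)[OF assms(1)] cont_homD(2)[OF assms(2)]]
  by (simp add: cont_hom_def o_def)

lemma mem_Union_rcosets:
  assumes "group G" "subgroup N G" "S \<subseteq> rcosets\<^bsub>G\<^esub> N"
  shows "x \<in> \<Union>S \<longleftrightarrow> x \<in> carrier G \<and> N #>\<^bsub>G\<^esub> x \<in> S"
proof
  assume "x \<in> \<Union>S"
  then obtain C where C: "C \<in> S" "x \<in> C" by blast
  then obtain a where a: "a \<in> carrier G" "C = N #>\<^bsub>G\<^esub> a"
    using assms(3) by (auto simp: RCOSETS_def)
  then show "x \<in> carrier G \<and> N #>\<^bsub>G\<^esub> x \<in> S"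
    using C group.repr_independence[OF assms(1) _ _ assms(2), of x a]
      monoid.r_coset_subset_G[OF group.is_monoid[OF assms(1)] subgroup.subset[OF assms(2)] a(1)] by auto
next
  assume "x \<in> carrier G \<and> N #>\<^bsub>G\<^esub> x \<in> S"
  then show "x \<in> \<Union>S"
    using group.rcos_self[OF assms(1) _ assms(2)] by blast
qed

text \<open>\<open>quot_top\<close> is introduced through \<open>topology\<close>, so its open sets
  are the intended ones only once the axioms hold. The point is intersections: distinct cosets are
  disjoint, hence taking unions commutes with intersecting families of cosets.\<close>

lemma openin_quot_top:
  assumes "group G" "subgroup N G"
  shows "openin (quot_top G T N) S \<longleftrightarrow> S \<subseteq> rcosets\<^bsub>G\<^esub> N \<and> openin T (\<Union>S)"
proof -
  have "istopology (\<lambda>S. S \<subseteq> rcosets\<^bsub>G\<^esub> N \<and> openin T (\<Union>S))"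
    unfolding istopology_def
  proof (intro conjI allI impI)
    fix S S' assume S: "S \<subseteq> rcosets\<^bsub>G\<^esub> N \<and> openin T (\<Union>S)" "S' \<subseteq> rcosets\<^bsub>G\<^esub> N \<and> openin T (\<Union>S')"
    then have "\<Union>(S \<inter> S') = \<Union>S \<inter> \<Union>S'"
      using mem_Union_rcosets[OF assms, of S] mem_Union_rcosets[OF assms, of S']
        mem_Union_rcosets[OF assms, of "S \<inter> S'"] by blast
    then show "openin T (\<Union>(S \<inter> S'))" using S by (metis openin_Int)
  next
    fix \<K> assume K: "\<forall>K\<in>\<K>. K \<subseteq> rcosets\<^bsub>G\<^esub> N \<and> openin T (\<Union>K)"
    have "\<Union>(\<Union>\<K>) = (\<Union>K\<in>\<K>. \<Union>K)" by blast
    then show "openin T (\<Union>(\<Union>\<K>))" using K by auto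
  qed blast+
  then show ?thesis by (simp add: quot_top_def topology_inverse')
qed

lemma topspace_quot_top:
  assumes "group G" "subgroup N G" "topspace T = carrier G"
  shows "topspace (quot_top G T N) = rcosets\<^bsub>G\<^esub> N"
proof -
  have "openin (quot_top G T N) (rcosets\<^bsub>G\<^esub> N)"
    using assms group.rcosets_part_G[OF assms(1,2)]
    by (simp add: openin_quot_top) (metis openin_topspace)
  then show ?thesis
    using openin_quot_top[OF assms(1,2)] by (metis openin_subset openin_topspace subset_antisym)
qed

lemma continuous_map_coset:
  assumes "group G" "subgroup N G" "topspace T = carrier G"
  shows "continuous_map T (quot_top G T N) (\<lambda>x. N #>\<^bsub>G\<^esub> x)"
  unfolding continuous_map_def
proof (intro conjI allI impI)
  show "(\<lambda>x. N #>\<^bsub>G\<^esub> x) \<in> topspace T \<rightarrow> topspace (quot_top G T N)"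
    using assms by (auto simp: topspace_quot_top RCOSETS_def)
  fix U assume "openin (quot_top G T N) U"
  then have U: "U \<subseteq> rcosets\<^bsub>G\<^esub> N" "openin T (\<Union>U)"
    by (simp_all add: openin_quot_top[OF assms(1,2)])
  have "{x \<in> topspace T. N #>\<^bsub>G\<^esub> x \<in> U} = \<Union>U"
    using mem_Union_rcosets[OF assms(1,2) U(1)] assms(3) by blast
  then show "openin T {x \<in> topspace T. N #>\<^bsub>G\<^esub> x \<in> U}" using U(2) by simp
qed

lemma continuous_map_from_quot_top:
  assumes "group G" "subgroup N G" "topspace T = carrier G"
    and f: "continuous_map T Y (\<lambda>x. f (N #>\<^bsub>G\<^esub> x))"
  shows "continuous_map (quot_top G T N) Y f"
  unfolding continuous_map_def
proof (intro conjI allI impI)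
  show "f \<in> topspace (quot_top G T N) \<rightarrow> topspace Y"
    using continuous_map_funspace[OF f] assms(1-3)
    by (auto simp: topspace_quot_top RCOSETS_def Pi_iff)
  fix U assume U: "openin Y U"
  let ?P = "{C \<in> topspace (quot_top G T N). f C \<in> U}"
  have P: "?P \<subseteq> rcosets\<^bsub>G\<^esub> N" using topspace_quot_top[OF assms(1-3)] by auto
  have "\<Union>?P = {x \<in> topspace T. f (N #>\<^bsub>G\<^esub> x) \<in> U}"
    using mem_Union_rcosets[OF assms(1,2) P] assms(1-3)
    by (auto simp: topspace_quot_top RCOSETS_def)
  then show "openin (quot_top G T N) ?P"
    using openin_continuous_map_preimage[OF f U] P by (simp add: openin_quot_top[OF assms(1,2)])
qed

lemma topspace_quot_carrier:
  assumes "N \<lhd> G" "topspace T = carrier G"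
  shows "topspace (quot_top G T N) = carrier (G Mod N)"
  using assms topspace_quot_top[of G N T]
  by (simp add: normal_def FactGroup_def)

lemma factor_cont_hom:
  assumes N: "N \<lhd> G" and T: "topspace T = carrier G" and H: "group H"
    and f: "f \<in> cont_hom G T H S" and ker: "\<And>n. n \<in> N \<Longrightarrow> f n = \<one>\<^bsub>H\<^esub>"
  obtains g where "g \<in> cont_hom (G Mod N) (quot_top G T N) H S"
    and "\<And>x. x \<in> carrier G \<Longrightarrow> g (N #>\<^bsub>G\<^esub> x) = f x"
proof -
  interpret normal N G by fact
  interpret f: group_hom G H f
    using cont_homD(1)[OF f] H by (simp add: group_hom_def group_hom_axioms_def group_axioms)
  have "f x = f y" if "x \<in> carrier G" "y \<in> carrier G" "N #>\<^bsub>G\<^esub> x = N #>\<^bsub>G\<^esub> y" for x y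
  proof -
    have "y \<in> N #>\<^bsub>G\<^esub> x" using rcos_self[OF that(2) subgroup_axioms] that(3) by simp
    then obtain n where "n \<in> N" "y = n \<otimes>\<^bsub>G\<^esub> x" by (auto simp: r_coset_def)
    then show ?thesis using ker[of n] that(1) subset by auto
  qed
  then obtain g where g: "g \<in> hom (G Mod N) H" "\<And>x. x \<in> carrier G \<Longrightarrow> g (N #>\<^bsub>G\<^esub> x) = f x"
    using FactGroup_universal[OF cont_homD(1)[OF f] N] by blast
  have "continuous_map T S (\<lambda>x. g (N #>\<^bsub>G\<^esub> x))"
    by (rule continuous_map_eq[OF cont_homD(2)[OF f]]) (simp add: g(2) T)
  from continuous_map_from_quot_top[OF group_axioms subgroup_axioms T this]
  show thesis using that g by (simp add: cont_hom_def)
qed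

section \<open>Dividing a pairing by its left kernel\<close>

lemma (in mod_pairing) dvd_one_left: "x \<in> carrier C \<Longrightarrow> p dvd B \<one>\<^bsub>M\<^esub> x"
  using pow_left[of "\<one>\<^bsub>M\<^esub>" x 0] by simp

lemma (in mod_pairing) dvd_one_right: "m \<in> carrier M \<Longrightarrow> p dvd B m \<one>\<^bsub>C\<^esub>"
  using pow_right[of m "\<one>\<^bsub>C\<^esub>" 0] by simp

text \<open>Normality needs an argument because \<open>M\<close> may be nonabelian: the values of
  the pairing lie in an abelian group, so conjugation in \<open>M\<close> does not change them
  modulo \<open>p\<close>.\<close>

lemma (in mod_pairing) left_kernel_normal:
  "{m \<in> carrier M. \<forall>x\<in>carrier C. p dvd B m x} \<lhd> M" (is "?K \<lhd> M")
proof (rule M.normal_invI)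
  have sub: "subgroup {n \<in> carrier M. p dvd B n x} M" if "x \<in> carrier C" for x
    by (rule subgroup_annihilator[OF M.subgroup_self that])
  show "subgroup ?K M"
  proof (rule M.subgroupI)
    show "?K \<noteq> {}" using dvd_one_left M.one_closed by blast
    show "inv\<^bsub>M\<^esub> a \<in> ?K" if "a \<in> ?K" for a
      using that subgroup.m_inv_closed[OF sub] by auto
    show "a \<otimes>\<^bsub>M\<^esub> b \<in> ?K" if "a \<in> ?K" "b \<in> ?K" for a b
      using that subgroup.m_closed[OF sub] by auto
  qed auto
  fix g h assume g: "g \<in> carrier M" and h: "h \<in> ?K"
  have "p dvd B (g \<otimes>\<^bsub>M\<^esub> h \<otimes>\<^bsub>M\<^esub> inv\<^bsub>M\<^esub> g) x" if x: "x \<in> carrier C" for x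
  proof -
    have hM: "h \<in> carrier M" and "p dvd B h x" using h x by auto
    moreover have "p dvd B (g \<otimes>\<^bsub>M\<^esub> h \<otimes>\<^bsub>M\<^esub> inv\<^bsub>M\<^esub> g) x - (B (g \<otimes>\<^bsub>M\<^esub> h) x + B (inv\<^bsub>M\<^esub> g) x)"
      "p dvd B (g \<otimes>\<^bsub>M\<^esub> h) x - (B g x + B h x)"
      "p dvd B (g \<otimes>\<^bsub>M\<^esub> inv\<^bsub>M\<^esub> g) x - (B g x + B (inv\<^bsub>M\<^esub> g) x)"
      using g hM x by (intro add_left; simp)+
    moreover have "p dvd B (g \<otimes>\<^bsub>M\<^esub> inv\<^bsub>M\<^esub> g) x" using g dvd_one_left[OF x] by simp
    ultimately have "p dvd (B (g \<otimes>\<^bsub>M\<^esub> h \<otimes>\<^bsub>M\<^esub> inv\<^bsub>M\<^esub> g) x - (B (g \<otimes>\<^bsub>M\<^esub> h) x + B (inv\<^bsub>M\<^esub> g) x))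
        + (B (g \<otimes>\<^bsub>M\<^esub> h) x - (B g x + B h x)) + B h x
        - (B (g \<otimes>\<^bsub>M\<^esub> inv\<^bsub>M\<^esub> g) x - (B g x + B (inv\<^bsub>M\<^esub> g) x)) + B (g \<otimes>\<^bsub>M\<^esub> inv\<^bsub>M\<^esub> g) x"
      by (simp only: dvd_add dvd_diff)
    then show ?thesis by (simp only: algebra_simps) simp
  qed
  then show "g \<otimes>\<^bsub>M\<^esub> h \<otimes>\<^bsub>M\<^esub> inv\<^bsub>M\<^esub> g \<in> ?K" using g h by auto
qed

text \<open>Dividing out the left kernel restores nondegeneracy, and the quotient is compact as a
  continuous image. A chosen representative of a coset may be used because changing it alters the
  value by a multiple of \<open>p\<close>, while values lie in \<open>{0..<p}\<close>.\<close>

lemma (in mod_pairing) perfect_pairing_quotient: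
  assumes range: "\<And>m x. m \<in> carrier M \<Longrightarrow> x \<in> carrier C \<Longrightarrow> B m x \<in> {0..<p}"
    and T: "compact_space T" "topspace T = carrier M"
    and cont: "\<And>x. x \<in> carrier C \<Longrightarrow> continuous_map T (Zp_top p) (\<lambda>m. B m x)"
    and right: "\<And>x. x \<in> carrier C \<Longrightarrow> \<forall>m\<in>carrier M. B m x = 0 \<Longrightarrow> x = \<one>\<^bsub>C\<^esub>"
    and K: "K = {m \<in> carrier M. \<forall>x\<in>carrier C. B m x = 0}"
  shows "\<exists>B'. perfect_pairing p (M Mod K) (quot_top M T K) C B'"
proof -
  have zero: "p dvd B m x \<longleftrightarrow> B m x = 0" if "m \<in> carrier M" "x \<in> carrier C" for m x
    using range[OF that] by (auto dest: zdvd_imp_le)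
  have eq_mod: "i = j mod p" if "i \<in> {0..<p}" "p dvd i - j" for i j
    using that by (metis mod_eq_dvd_iff atLeastLessThan_iff mod_pos_pos_trivial)
  have "K = {m \<in> carrier M. \<forall>x\<in>carrier C. p dvd B m x}" unfolding K using zero by auto
  then have "K \<lhd> M" using left_kernel_normal by simp
  then interpret K: normal K M .
  define B' where "B' A x = B (SOME a. a \<in> A) x" for A x
  have B': "B' (K #>\<^bsub>M\<^esub> m) x = B m x" if m: "m \<in> carrier M" and x: "x \<in> carrier C" for m x
  proof -
    have "(SOME a. a \<in> K #>\<^bsub>M\<^esub> m) \<in> K #>\<^bsub>M\<^esub> m"
      using M.rcos_self[OF m K.subgroup_axioms] by (rule someI[of "\<lambda>a. a \<in> K #>\<^bsub>M\<^esub> m"])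
    moreover have "\<exists>k\<in>K. a = k \<otimes>\<^bsub>M\<^esub> m" if "a \<in> K #>\<^bsub>M\<^esub> m" for a
      using that by (auto simp: r_coset_def)
    ultimately obtain k where k: "k \<in> K" "(SOME a. a \<in> K #>\<^bsub>M\<^esub> m) = k \<otimes>\<^bsub>M\<^esub> m" by blast
    have km: "k \<in> carrier M" "B k x = 0" using k(1) x unfolding K by auto
    then have "p dvd B (k \<otimes>\<^bsub>M\<^esub> m) x - B m x" using add_left[OF km(1) m x] by simp
    then have "B (k \<otimes>\<^bsub>M\<^esub> m) x = B m x mod p" using range km m x by (intro eq_mod) auto
    then show ?thesis using range[OF m x] k by (simp add: B'_def)
  qed
  have cosets: "\<exists>m\<in>carrier M. A = K #>\<^bsub>M\<^esub> m" if "A \<in> carrier (M Mod K)" for A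
    using that by (auto simp: carrier_FactGroup)
  have cont_proj: "continuous_map T (quot_top M T K) (\<lambda>m. K #>\<^bsub>M\<^esub> m)"
    by (rule continuous_map_coset[OF M.group_axioms K.subgroup_axioms T(2)])
  have top: "topspace (quot_top M T K) = carrier (M Mod K)"
    by (rule topspace_quot_carrier[OF \<open>K \<lhd> M\<close> T(2)])
  have "perfect_pairing p (M Mod K) (quot_top M T K) C B'"
  proof (rule perfect_pairingI[OF prime_p K.factorgroup_is_group C.comm_group_axioms _ top])
    have "(\<lambda>m. K #>\<^bsub>M\<^esub> m) ` topspace T = topspace (quot_top M T K)"
      by (simp add: top T(2) carrier_FactGroup)
    then show "compact_space (quot_top M T K)"
      using image_compactin[OF _ cont_proj] T(1) unfolding compact_space_def by metis
    show "continuous_map (quot_top M T K) (Zp_top p) (\<lambda>A. B' A x)" if "x \<in> carrier C" for x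
      by (rule continuous_map_from_quot_top[OF M.group_axioms K.subgroup_axioms T(2)],
          rule continuous_map_eq[OF cont[OF that]]) (simp add: B' that T(2))
    show "A = \<one>\<^bsub>M Mod K\<^esub>" if A: "A \<in> carrier (M Mod K)" "\<forall>x\<in>carrier C. B' A x = 0" for A
    proof -
      obtain m where m: "m \<in> carrier M" "A = K #>\<^bsub>M\<^esub> m" using cosets A(1) by blast
      then have "\<forall>x\<in>carrier C. B m x = 0" using A B' by metis
      then have "m \<in> K" unfolding K using m(1) by blast
      then show ?thesis using m K.rcos_const by simp
    qed
    show "x = \<one>\<^bsub>C\<^esub>" if x: "x \<in> carrier C" "\<forall>A\<in>carrier (M Mod K). B' A x = 0" for x
      using x B' by (intro right) (auto simp: carrier_FactGroup)
    show "bilinear_Zp p (M Mod K) C B'"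
      unfolding bilinear_Zp_def
    proof (intro conjI ballI)
      show "B' A x \<in> {0..<p}" if "A \<in> carrier (M Mod K)" "x \<in> carrier C" for A x
        using that cosets range B' by metis
      show "B' (A \<otimes>\<^bsub>M Mod K\<^esub> A') x = (B' A x + B' A' x) mod p"
        if A: "A \<in> carrier (M Mod K)" "A' \<in> carrier (M Mod K)" and x: "x \<in> carrier C" for A A' x
      proof -
        obtain m m' where m: "m \<in> carrier M" "A = K #>\<^bsub>M\<^esub> m" "m' \<in> carrier M" "A' = K #>\<^bsub>M\<^esub> m'"
          using cosets A by metis
        then have "A \<otimes>\<^bsub>M Mod K\<^esub> A' = K #>\<^bsub>M\<^esub> (m \<otimes>\<^bsub>M\<^esub> m')" by (simp add: K.rcos_sum)
        then show ?thesis
          using m x by (simp add: B') (intro eq_mod range add_left M.m_closed)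
      qed
      show "B' A (x \<otimes>\<^bsub>C\<^esub> x') = (B' A x + B' A x') mod p"
        if A: "A \<in> carrier (M Mod K)" and x: "x \<in> carrier C" "x' \<in> carrier C" for A x x'
      proof -
        obtain m where m: "m \<in> carrier M" "A = K #>\<^bsub>M\<^esub> m" using cosets A by metis
        then show ?thesis
          using x by (simp add: B') (intro eq_mod range add_right C.m_closed)
      qed
    qed
  qed
  then show ?thesis by blast
qed

section \<open>The second cohomology group\<close>

text \<open>The cochain is reduced modulo \<open>p\<close> only here, so coboundaries can be built
  from arbitrary integer combinations of cochains.\<close>

lemma cohomologousI:
  assumes c: "continuous_map T (Zp_top p) (\<lambda>x. c x mod p)"
    and eq: "\<And>x y. x \<in> carrier G \<Longrightarrow> y \<in> carrier G \<Longrightarrow>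
      p dvd f x y - g x y - (c x + c y - c (x \<otimes>\<^bsub>G\<^esub> y))"
  shows "cohomologous G T p f g"
  unfolding cohomologous_def
proof (intro exI conjI ballI)
  show "continuous_map T (Zp_top p) (\<lambda>x. c x mod p)" by (rule c)
  fix x y assume xy: "x \<in> carrier G" "y \<in> carrier G"
  let ?m = "\<lambda>x. c x mod p - c x"
  have "p dvd f x y - g x y - (c x + c y - c (x \<otimes>\<^bsub>G\<^esub> y)) - ?m x - ?m y + ?m (x \<otimes>\<^bsub>G\<^esub> y)"
    by (intro dvd_add dvd_diff eq[OF xy] int_mod_cong_dvd)
  then have "p dvd f x y - g x y - (c x mod p + c y mod p - c (x \<otimes>\<^bsub>G\<^esub> y) mod p)"
    by (simp add: algebra_simps)
  then show "(f x y - g x y - (c x mod p + c y mod p - c (x \<otimes>\<^bsub>G\<^esub> y) mod p)) mod p = 0"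
    by (simp add: dvd_eq_mod_eq_0)
qed

lemma cohomologousE:
  assumes "cohomologous G T p f g"
  obtains c where "continuous_map T (Zp_top p) c"
    and "\<And>x y. x \<in> carrier G \<Longrightarrow> y \<in> carrier G \<Longrightarrow>
      p dvd f x y - g x y - (c x + c y - c (x \<otimes>\<^bsub>G\<^esub> y))"
  using assms unfolding cohomologous_def dvd_eq_mod_eq_0 by blast

locale cochains =
  fixes G :: "('a, 'm) monoid_scheme" and T :: "'a topology" and p :: int
  assumes p_pos: "p > 0"
begin

lemma continuous_map_mod:
  assumes "continuous_map X (Zp_top p) f"
  shows "continuous_map X (Zp_top p) (\<lambda>x. (k * f x) mod p)"
  by (rule continuous_map_Zp_compose[OF assms]) (use p_pos in auto)

lemma continuous_map_mod2:
  assumes "continuous_map X (Zp_top p) f" "continuous_map X (Zp_top p) g"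
  shows "continuous_map X (Zp_top p) (\<lambda>x. (f x + k * g x) mod p)"
  by (rule continuous_map_Zp_compose2[OF assms]) (use p_pos in auto)

lemma cohomologous_dvd:
  assumes "\<And>x y. x \<in> carrier G \<Longrightarrow> y \<in> carrier G \<Longrightarrow> p dvd f x y - g x y"
  shows "cohomologous G T p f g"
  by (rule cohomologousI[where c = "\<lambda>_. 0"]) (use assms p_pos in \<open>auto simp: Zp_top_def\<close>)

text \<open>Coboundaries are closed under linear combinations. Symmetry is the case
  \<open>k = -1\<close> with a trivial first summand; transitivity and compatibility with addition
  are the case \<open>k = 1\<close>.\<close>

lemma cohomologous_combine:
  assumes "cohomologous G T p f g" and "cohomologous G T p f' g'"
    and eq: "\<And>x y. x \<in> carrier G \<Longrightarrow> y \<in> carrier G \<Longrightarrow>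
      p dvd F x y - H x y - ((f x y - g x y) + k * (f' x y - g' x y))"
  shows "cohomologous G T p F H"
proof -
  obtain c where c: "continuous_map T (Zp_top p) c"
    "\<And>x y. x \<in> carrier G \<Longrightarrow> y \<in> carrier G \<Longrightarrow> p dvd f x y - g x y - (c x + c y - c (x \<otimes>\<^bsub>G\<^esub> y))"
    using cohomologousE[OF assms(1)] by blast
  obtain d where d: "continuous_map T (Zp_top p) d"
    "\<And>x y. x \<in> carrier G \<Longrightarrow> y \<in> carrier G \<Longrightarrow> p dvd f' x y - g' x y - (d x + d y - d (x \<otimes>\<^bsub>G\<^esub> y))"
    using cohomologousE[OF assms(2)] by blast
  show ?thesis
  proof (rule cohomologousI[OF continuous_map_mod2[OF c(1) d(1)]])
    show "p dvd F x y - H x y - ((c x + k * d x) + (c y + k * d y) - (c (x \<otimes>\<^bsub>G\<^esub> y) + k * d (x \<otimes>\<^bsub>G\<^esub> y)))"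
      if "x \<in> carrier G" "y \<in> carrier G" for x y
      using dvd_add[OF dvd_add[OF eq[OF that] c(2)[OF that]] dvd_mult[OF d(2)[OF that], of k]]
      by (simp add: algebra_simps)
  qed
qed

lemma cohomologous_refl: "cohomologous G T p f f"
  by (rule cohomologous_dvd) simp

lemma cohomologous_sym:
  assumes "cohomologous G T p f g" shows "cohomologous G T p g f"
  by (rule cohomologous_combine[OF cohomologous_refl[of f] assms, where k = "-1"]) simp

lemma cohomologous_trans:
  assumes "cohomologous G T p f g" "cohomologous G T p g h" shows "cohomologous G T p f h"
  by (rule cohomologous_combine[OF assms, where k = 1]) simp

lemma h2class_eq_iff:
  assumes "f \<in> cocycles2 G T p"
  shows "h2class G T p f = h2class G T p g \<longleftrightarrow> cohomologous G T p f g"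
proof
  assume "h2class G T p f = h2class G T p g"
  moreover have "f \<in> h2class G T p f" using assms cohomologous_refl by (simp add: h2class_def)
  ultimately show "cohomologous G T p f g" using cohomologous_sym by (auto simp: h2class_def)
next
  assume "cohomologous G T p f g"
  then show "h2class G T p f = h2class G T p g"
    using cohomologous_trans cohomologous_sym unfolding h2class_def by blast
qed

lemma h2class_self: "f \<in> cocycles2 G T p \<Longrightarrow> f \<in> h2class G T p f"
  using cohomologous_refl by (simp add: h2class_def)

lemma carrier_H2: "carrier (H2 G T p) = h2class G T p ` cocycles2 G T p"
  by (simp add: H2_def)

lemma H2_member:
  assumes "X \<in> carrier (H2 G T p)" "f \<in> X"
  shows "f \<in> cocycles2 G T p" and "X = h2class G T p f"
proof -
  obtain g where g: "g \<in> cocycles2 G T p" "X = h2class G T p g"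
    using assms(1) by (auto simp: carrier_H2)
  then show f: "f \<in> cocycles2 G T p" using assms(2) by (simp add: h2class_def)
  show "X = h2class G T p f"
    using g assms(2) h2class_eq_iff[OF g(1), of f] by (simp add: h2class_def)
qed

lemma some_H2_member:
  assumes "X \<in> carrier (H2 G T p)"
  shows "(SOME f. f \<in> X) \<in> X"
proof -
  obtain f where "f \<in> X" using assms h2class_self by (auto simp: carrier_H2)
  then show ?thesis by (rule someI[of "\<lambda>f. f \<in> X"])
qed

lemma cocycle_combine:
  assumes f: "f \<in> cocycles2 G T p" and g: "g \<in> cocycles2 G T p"
  shows "(\<lambda>x y. (f x y + k * g x y) mod p) \<in> cocycles2 G T p"
proof -
  have "continuous_map (prod_topology T T) (Zp_top p) (\<lambda>z. ((\<lambda>(x, y). f x y) z + k * (\<lambda>(x, y). g x y) z) mod p)"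
    by (rule continuous_map_mod2) (use f g in \<open>auto simp: cocycles2_def\<close>)
  then have "continuous_map (prod_topology T T) (Zp_top p) (\<lambda>(x, y). (f x y + k * g x y) mod p)"
    by (simp add: case_prod_unfold)
  moreover have "(\<forall>x y. (x \<notin> carrier G \<or> y \<notin> carrier G) \<longrightarrow> (f x y + k * g x y) mod p = 0)"
    using f g by (simp add: cocycles2_def)
  moreover have "((f y z + k * g y z) mod p - (f (x \<otimes>\<^bsub>G\<^esub> y) z + k * g (x \<otimes>\<^bsub>G\<^esub> y) z) mod p
       + (f x (y \<otimes>\<^bsub>G\<^esub> z) + k * g x (y \<otimes>\<^bsub>G\<^esub> z)) mod p - (f x y + k * g x y) mod p) mod p = 0"
    if "x \<in> carrier G" "y \<in> carrier G" "z \<in> carrier G" for x y z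
  proof -
    let ?h = "\<lambda>x y. f x y + k * g x y"
    let ?m = "\<lambda>x y. ?h x y mod p - ?h x y"
    have "p dvd f y z - f (x \<otimes>\<^bsub>G\<^esub> y) z + f x (y \<otimes>\<^bsub>G\<^esub> z) - f x y"
      "p dvd g y z - g (x \<otimes>\<^bsub>G\<^esub> y) z + g x (y \<otimes>\<^bsub>G\<^esub> z) - g x y"
      using f g that by (simp_all add: cocycles2_def dvd_eq_mod_eq_0)
    then have "p dvd (f y z - f (x \<otimes>\<^bsub>G\<^esub> y) z + f x (y \<otimes>\<^bsub>G\<^esub> z) - f x y)
        + k * (g y z - g (x \<otimes>\<^bsub>G\<^esub> y) z + g x (y \<otimes>\<^bsub>G\<^esub> z) - g x y)
        + ?m y z - ?m (x \<otimes>\<^bsub>G\<^esub> y) z + ?m x (y \<otimes>\<^bsub>G\<^esub> z) - ?m x y"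
      by (intro dvd_diff[OF dvd_add[OF dvd_diff[OF dvd_add[OF dvd_add]]]] dvd_mult int_mod_cong_dvd)
    then have "p dvd ?h y z mod p - ?h (x \<otimes>\<^bsub>G\<^esub> y) z mod p + ?h x (y \<otimes>\<^bsub>G\<^esub> z) mod p - ?h x y mod p"
      by (simp add: algebra_simps)
    then show ?thesis by (simp add: dvd_eq_mod_eq_0)
  qed
  ultimately show ?thesis by (simp add: cocycles2_def)
qed

lemma zero_cocycle: "(\<lambda>x y. 0) \<in> cocycles2 G T p"
  using p_pos by (auto simp: cocycles2_def Zp_top_def case_prod_unfold)

text \<open>The multiplication of \<open>H2\<close> adds representatives picked by choice. These are
  cohomologous to \<open>f\<close> and \<open>g\<close>, so the class of the sum can be computed
  from \<open>f\<close> and \<open>g\<close> themselves.\<close>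

lemma mult_H2:
  assumes f: "f \<in> cocycles2 G T p" and g: "g \<in> cocycles2 G T p"
  shows "h2class G T p f \<otimes>\<^bsub>H2 G T p\<^esub> h2class G T p g = h2class G T p (\<lambda>x y. (f x y + g x y) mod p)"
proof -
  have X: "h2class G T p f \<in> carrier (H2 G T p)" "h2class G T p g \<in> carrier (H2 G T p)"
    using f g by (auto simp: carrier_H2)
  define f' where "f' = (SOME f'. f' \<in> h2class G T p f)"
  define g' where "g' = (SOME g'. g' \<in> h2class G T p g)"
  have f': "cohomologous G T p f f'" and g': "cohomologous G T p g g'"
    using some_H2_member[OF X(1)] some_H2_member[OF X(2)] by (simp_all add: h2class_def f'_def g'_def)
  have "cohomologous G T p (\<lambda>x y. (f x y + g x y) mod p)
      (\<lambda>x y. if x \<in> carrier G \<and> y \<in> carrier G then (f' x y + g' x y) mod p else 0)"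
  proof (rule cohomologous_combine[OF f' g', where k = 1])
    fix x y assume "x \<in> carrier G" "y \<in> carrier G"
    then show "p dvd (f x y + g x y) mod p
        - (if x \<in> carrier G \<and> y \<in> carrier G then (f' x y + g' x y) mod p else 0)
        - ((f x y - f' x y) + 1 * (g x y - g' x y))"
      using dvd_diff[OF int_mod_cong_dvd[of p "f x y + g x y"] int_mod_cong_dvd[of p "f' x y + g' x y"]]
      by (simp add: algebra_simps)
  qed
  moreover have "(\<lambda>x y. (f x y + g x y) mod p) \<in> cocycles2 G T p"
    using cocycle_combine[OF f g, of 1] by simp
  ultimately have "h2class G T p (\<lambda>x y. (f x y + g x y) mod p) = h2class G T p
      (\<lambda>x y. if x \<in> carrier G \<and> y \<in> carrier G then (f' x y + g' x y) mod p else 0)"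
    by (simp only: h2class_eq_iff)
  then show ?thesis by (simp only: H2_def monoid.simps f'_def g'_def)
qed

lemma comm_group_H2: "comm_group (H2 G T p)"
proof (rule comm_groupI)
  have add: "(\<lambda>x y. (f x y + g x y) mod p) \<in> cocycles2 G T p"
    if "f \<in> cocycles2 G T p" "g \<in> cocycles2 G T p" for f g
    using cocycle_combine[OF that, of 1] by simp
  have one: "\<one>\<^bsub>H2 G T p\<^esub> = h2class G T p (\<lambda>x y. 0)" by (simp add: H2_def)
  note c = carrier_H2
  show "X \<otimes>\<^bsub>H2 G T p\<^esub> Y \<in> carrier (H2 G T p)"
    if "X \<in> carrier (H2 G T p)" "Y \<in> carrier (H2 G T p)" for X Y
    using that add by (auto simp: c mult_H2)
  show "\<one>\<^bsub>H2 G T p\<^esub> \<in> carrier (H2 G T p)"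
    using zero_cocycle by (auto simp: c one)
  show "X \<otimes>\<^bsub>H2 G T p\<^esub> Y \<otimes>\<^bsub>H2 G T p\<^esub> Z = X \<otimes>\<^bsub>H2 G T p\<^esub> (Y \<otimes>\<^bsub>H2 G T p\<^esub> Z)"
    if "X \<in> carrier (H2 G T p)" "Y \<in> carrier (H2 G T p)" "Z \<in> carrier (H2 G T p)" for X Y Z
    using that by (auto simp: c mult_H2 add mod_simps add.assoc)
  show "X \<otimes>\<^bsub>H2 G T p\<^esub> Y = Y \<otimes>\<^bsub>H2 G T p\<^esub> X"
    if "X \<in> carrier (H2 G T p)" "Y \<in> carrier (H2 G T p)" for X Y
    using that by (auto simp: c mult_H2 add.commute)
  show "\<one>\<^bsub>H2 G T p\<^esub> \<otimes>\<^bsub>H2 G T p\<^esub> X = X" if X: "X \<in> carrier (H2 G T p)" for X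
  proof -
    obtain f where f: "f \<in> cocycles2 G T p" "X = h2class G T p f" using X by (auto simp: c)
    have "h2class G T p (\<lambda>x y. f x y mod p) = h2class G T p f"
      using add[OF zero_cocycle f(1)] by (subst h2class_eq_iff) (auto intro: cohomologous_dvd int_mod_cong_dvd)
    then show ?thesis using f zero_cocycle by (simp add: one mult_H2)
  qed
  show "\<exists>Y\<in>carrier (H2 G T p). Y \<otimes>\<^bsub>H2 G T p\<^esub> X = \<one>\<^bsub>H2 G T p\<^esub>" if X: "X \<in> carrier (H2 G T p)" for X
  proof -
    obtain f where f: "f \<in> cocycles2 G T p" "X = h2class G T p f" using X by (auto simp: c)
    have g: "(\<lambda>x y. (- f x y) mod p) \<in> cocycles2 G T p"
      using cocycle_combine[OF zero_cocycle f(1), of "-1"] by simp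
    then have "h2class G T p (\<lambda>x y. (- f x y) mod p) \<otimes>\<^bsub>H2 G T p\<^esub> X = \<one>\<^bsub>H2 G T p\<^esub>"
      using f by (simp add: mult_H2 one mod_simps)
    then show ?thesis using g by (auto simp: c)
  qed
qed

end

section \<open>Pullback of cocycles and classes\<close>

definition pull2 :: "('a, 'm) monoid_scheme \<Rightarrow> ('a \<Rightarrow> 'b) \<Rightarrow> ('b \<Rightarrow> 'b \<Rightarrow> int) \<Rightarrow> 'a \<Rightarrow> 'a \<Rightarrow> int" where
  "pull2 G \<phi> f = (\<lambda>x y. if x \<in> carrier G \<and> y \<in> carrier G then f (\<phi> x) (\<phi> y) else 0)"

locale cochain_map = G: cochains G T p + H: cochains H S p
  for G :: "('a, 'm) monoid_scheme" and T and H :: "('b, 'n) monoid_scheme" and S and p +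
  fixes \<phi> :: "'a \<Rightarrow> 'b"
  assumes group_G: "group G" and top_G: "topspace T = carrier G"
    and phi: "\<phi> \<in> cont_hom G T H S"
begin

lemma phi_closed: "x \<in> carrier G \<Longrightarrow> \<phi> x \<in> carrier H"
  and phi_mult: "x \<in> carrier G \<Longrightarrow> y \<in> carrier G \<Longrightarrow> \<phi> (x \<otimes>\<^bsub>G\<^esub> y) = \<phi> x \<otimes>\<^bsub>H\<^esub> \<phi> y"
  using cont_homD(1)[OF phi] by (auto simp: hom_def)

lemma pull2_cocycle:
  assumes f: "f \<in> cocycles2 H S p"
  shows "pull2 G \<phi> f \<in> cocycles2 G T p"
proof -
  have "continuous_map (prod_topology T T) (prod_topology S S) (\<lambda>(x, y). (\<phi> x, \<phi> y))"
    using cont_homD(2)[OF phi] by (simp add: continuous_map_prod_top)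
  moreover have "continuous_map (prod_topology S S) (Zp_top p) (\<lambda>(x, y). f x y)"
    using f by (simp add: cocycles2_def)
  ultimately have "continuous_map (prod_topology T T) (Zp_top p) ((\<lambda>(x, y). f x y) \<circ> (\<lambda>(x, y). (\<phi> x, \<phi> y)))"
    by (rule continuous_map_compose)
  then have "continuous_map (prod_topology T T) (Zp_top p) (\<lambda>(x, y). pull2 G \<phi> f x y)"
    by (rule continuous_map_eq) (auto simp: pull2_def top_G)
  moreover have "x \<otimes>\<^bsub>G\<^esub> y \<in> carrier G" if "x \<in> carrier G" "y \<in> carrier G" for x y
    using group_G that by (simp add: group.is_monoid monoid.m_closed)
  ultimately show ?thesis
    using f by (auto simp: cocycles2_def pull2_def phi_closed phi_mult)
qed

lemma pull2_cohomologous: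
  assumes "cohomologous H S p f g"
  shows "cohomologous G T p (pull2 G \<phi> f) (pull2 G \<phi> g)"
proof -
  obtain c where c: "continuous_map S (Zp_top p) c"
    "\<And>x y. x \<in> carrier H \<Longrightarrow> y \<in> carrier H \<Longrightarrow> p dvd f x y - g x y - (c x + c y - c (x \<otimes>\<^bsub>H\<^esub> y))"
    using cohomologousE[OF assms] by blast
  have "continuous_map T (Zp_top p) (\<lambda>x. c (\<phi> x))"
    using continuous_map_compose[OF cont_homD(2)[OF phi] c(1)] by (simp add: o_def)
  from G.continuous_map_mod[OF this, of 1] show ?thesis
    by (intro cohomologousI[where c = "\<lambda>x. c (\<phi> x)"]) (auto simp: pull2_def phi_mult c(2) phi_closed)
qed

text \<open>\<open>h2pull\<close> pulls back a representative picked by choice; another one has a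
  cohomologous pullback, so any given cocycle may take its place.\<close>

lemma h2pull_class:
  assumes f: "f \<in> cocycles2 H S p"
  shows "h2pull G T p \<phi> (h2class H S p f) = h2class G T p (pull2 G \<phi> f)"
proof -
  have X: "h2class H S p f \<in> carrier (H2 H S p)" using f by (simp add: H.carrier_H2)
  define f' where "f' = (SOME f'. f' \<in> h2class H S p f)"
  have "f' \<in> h2class H S p f" using H.some_H2_member[OF X] by (simp add: f'_def)
  then have "cohomologous G T p (pull2 G \<phi> f) (pull2 G \<phi> f')"
    by (intro pull2_cohomologous) (simp add: h2class_def)
  then have "h2class G T p (pull2 G \<phi> f) = h2class G T p (pull2 G \<phi> f')"
    by (simp add: G.h2class_eq_iff[OF pull2_cocycle[OF f]])
  then show ?thesis by (simp add: h2pull_def f'_def pull2_def)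
qed

lemma h2pull_hom: "h2pull G T p \<phi> \<in> hom (H2 H S p) (H2 G T p)"
proof (rule homI)
  show "h2pull G T p \<phi> X \<in> carrier (H2 G T p)" if "X \<in> carrier (H2 H S p)" for X
    using that pull2_cocycle by (auto simp: H.carrier_H2 G.carrier_H2 h2pull_class)
  show "h2pull G T p \<phi> (X \<otimes>\<^bsub>H2 H S p\<^esub> Y) = h2pull G T p \<phi> X \<otimes>\<^bsub>H2 G T p\<^esub> h2pull G T p \<phi> Y"
    if XY: "X \<in> carrier (H2 H S p)" "Y \<in> carrier (H2 H S p)" for X Y
  proof -
    obtain f g where f: "f \<in> cocycles2 H S p" "X = h2class H S p f"
      and g: "g \<in> cocycles2 H S p" "Y = h2class H S p g"
      using XY by (auto simp: H.carrier_H2)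
    have "(\<lambda>x y. (f x y + g x y) mod p) \<in> cocycles2 H S p"
      using H.cocycle_combine[OF f(1) g(1), of 1] by simp
    moreover have "pull2 G \<phi> (\<lambda>x y. (f x y + g x y) mod p)
        = (\<lambda>x y. (pull2 G \<phi> f x y + pull2 G \<phi> g x y) mod p)"
      by (auto simp: pull2_def fun_eq_iff)
    ultimately show ?thesis
      using f g by (simp add: H.mult_H2 G.mult_H2 h2pull_class pull2_cocycle)
  qed
qed

end

lemma (in cochains) inv_H2:
  assumes f: "f \<in> cocycles2 G T p"
  shows "inv\<^bsub>H2 G T p\<^esub> h2class G T p f = h2class G T p (\<lambda>x y. (- f x y) mod p)"
proof -
  interpret H2: comm_group "H2 G T p" by (rule comm_group_H2)
  have g: "(\<lambda>x y. (- f x y) mod p) \<in> cocycles2 G T p"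
    using cocycle_combine[OF zero_cocycle f, of "-1"] by simp
  have "h2class G T p (\<lambda>x y. (- f x y) mod p) \<otimes>\<^bsub>H2 G T p\<^esub> h2class G T p f = \<one>\<^bsub>H2 G T p\<^esub>"
    using f g by (simp add: mult_H2 mod_simps) (simp add: H2_def)
  then show ?thesis using f g by (intro H2.inv_equality) (auto simp: carrier_H2)
qed

section \<open>Central extensions\<close>

text \<open>In a compact Hausdorff space components coincide with quasi-components, so total
  disconnectedness yields a clopen set separating two points; its complement is taken if it contains
  the wrong one.\<close>

lemma profinite_clopen_separation:
  assumes "profinite_group U X" and x: "x \<in> topspace X" and y: "y \<in> topspace X" and "x \<noteq> y"
  obtains W where "openin X W" "closedin X W" "x \<in> W" "y \<notin> W"
proof -
  have X: "compact_space X" "Hausdorff_space X" "connected_component_of_set X x = {x}"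
    using assms(1) x by (auto simp: profinite_group_def)
  then have "quasi_components_of X = connected_components_of X"
    by (intro quasi_eq_connected_components_of) blast
  then have "quasi_component_of X x = connected_component_of X x"
    using x by (simp add: quasi_eq_connected_components_of_pointwise)
  then have "\<not> quasi_component_of X x y" using X(3) \<open>x \<noteq> y\<close> by auto
  then obtain W where W: "closedin X W" "openin X W" "x \<in> W \<longleftrightarrow> y \<notin> W"
    using x y by (auto simp: quasi_component_of_def)
  show thesis
  proof (cases "x \<in> W")
    case True
    then show ?thesis using that W by blast
  next
    case False
    then show ?thesis using that[of "topspace X - W"] W x by blast
  qed
qed

text \<open>Below, \<open>K\<close> acts freely on \<open>U\<close> by translation. A clopen set meeting no orbit twice exists around
  every point, and finitely many of them are merged into a clopen set meeting every orbit exactly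
  once, on which the quotient map restricts to a homeomorphism.\<close>

lemma continuous_section_finite_kernel:
  assumes U: "profinite_group U X" and H: "group H" and S: "Hausdorff_space S" "topspace S = carrier H"
    and f: "f \<in> cont_hom U X H S" and onto: "f ` carrier U = carrier H"
    and fin: "finite (kernel U H f)"
  shows "\<exists>s. continuous_map S X s \<and> (\<forall>x\<in>carrier H. f (s x) = x)"
proof -
  have grp: "group U" and X: "topspace X = carrier U" "compact_space X" "Hausdorff_space X"
    and mult: "continuous_map (prod_topology X X) X (\<lambda>(x, y). x \<otimes>\<^bsub>U\<^esub> y)"
    using U by (auto simp: profinite_group_def topological_group_def)
  interpret U: group U by fact
  interpret H: group H by fact
  interpret f: group_hom U H f
    using cont_homD(1)[OF f] by (simp add: group_hom_def group_hom_axioms_def grp H)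
  define K where "K = kernel U H f"
  have K: "subgroup K U" and finK: "finite K" using f.subgroup_kernel fin by (auto simp: K_def)
  have KU: "z \<in> carrier U" if "z \<in> K" for z using subgroup.mem_carrier[OF K that] .
  have f_K: "f z = \<one>\<^bsub>H\<^esub>" if "z \<in> K" for z using that by (simp add: K_def kernel_def)
  define clopen where "clopen W \<longleftrightarrow> openin X W \<and> closedin X W" for W
  define small where "small D \<longleftrightarrow> (\<forall>d\<in>D. \<forall>z\<in>K. z \<otimes>\<^bsub>U\<^esub> d \<in> D \<longrightarrow> z = \<one>\<^bsub>U\<^esub>)" for D
  have clopen_sub: "W \<subseteq> carrier U" if "clopen W" for W
    using that openin_subset X(1) by (auto simp: clopen_def)
  have clopen_diff: "clopen (V - W)" if "clopen V" "clopen W" for V W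
    using that by (auto simp: clopen_def)
  have clopen_Un: "clopen (V \<union> W)" if "clopen V" "clopen W" for V W
    using that by (auto simp: clopen_def)
  have clopen_Int: "clopen (V \<inter> W)" if "clopen V" "clopen W" for V W
    using that by (auto simp: clopen_def)
  have clopen_top: "clopen (carrier U)" by (simp add: clopen_def flip: X(1))
  have translate: "clopen {u \<in> carrier U. z \<otimes>\<^bsub>U\<^esub> u \<in> W}" if z: "z \<in> carrier U" and W: "clopen W" for z W
  proof -
    have "continuous_map X (prod_topology X X) (\<lambda>u. (z, u))"
      using z X(1) by (auto simp: continuous_map_paired)
    then have "continuous_map X X (\<lambda>u. z \<otimes>\<^bsub>U\<^esub> u)"
      using continuous_map_compose[OF _ mult] by (fastforce simp: o_def)
    then show ?thesis
      using W openin_continuous_map_preimage closedin_continuous_map_preimage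
      unfolding clopen_def X(1)[symmetric] by blast
  qed
  have local: "\<exists>V. clopen V \<and> small V \<and> u \<in> V" if u: "u \<in> carrier U" for u
  proof -
    have "\<exists>W. clopen W \<and> u \<in> W \<and> z \<otimes>\<^bsub>U\<^esub> u \<notin> W" if z: "z \<in> K - {\<one>\<^bsub>U\<^esub>}" for z
    proof -
      have "u \<noteq> z \<otimes>\<^bsub>U\<^esub> u" using z KU u by (metis DiffE U.r_cancel_one' singletonI)
      then show ?thesis
        using profinite_clopen_separation[OF U, of u "z \<otimes>\<^bsub>U\<^esub> u"] u z KU X(1)
        by (metis DiffD1 U.m_closed clopen_def)
    qed
    then obtain W where W: "\<And>z. z \<in> K - {\<one>\<^bsub>U\<^esub>} \<Longrightarrow> clopen (W z) \<and> u \<in> W z \<and> z \<otimes>\<^bsub>U\<^esub> u \<notin> W z"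
      by metis
    \<comment> \<open>\<open>v\<close> and its translate by \<open>z\<close> in \<open>J\<close>
      cannot both lie in \<open>V J\<close>: the conditions on \<open>v\<close> put the translate
      outside \<open>W z\<close>, those on the translate put it inside.\<close>
    define V where "V J = {v \<in> carrier U. \<forall>z\<in>J. v \<in> W z \<and> z \<otimes>\<^bsub>U\<^esub> v \<notin> W z}" for J
    have "clopen (V J)" if "finite J" "J \<subseteq> K - {\<one>\<^bsub>U\<^esub>}" for J
      using that
    proof (induction J rule: finite_induct)
      case empty
      then show ?case using clopen_top by (simp add: V_def)
    next
      case (insert z J)
      have "V (insert z J) = V J \<inter> (W z - {u \<in> carrier U. z \<otimes>\<^bsub>U\<^esub> u \<in> W z})"
        using clopen_sub[of "W z"] W[of z] insert.prems by (auto simp: V_def)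
      then show ?case
        using insert W[of z] KU by (auto intro!: clopen_Int clopen_diff translate)
    qed
    then have "clopen (V (K - {\<one>\<^bsub>U\<^esub>}))" using finK by blast
    moreover have "small (V (K - {\<one>\<^bsub>U\<^esub>}))" by (auto simp: small_def V_def)
    moreover have "u \<in> V (K - {\<one>\<^bsub>U\<^esub>})" using u W by (auto simp: V_def)
    ultimately show ?thesis by blast
  qed
  have merge: "\<exists>D. clopen D \<and> small D \<and> (\<forall>v\<in>\<Union>\<V>. \<exists>z\<in>K. z \<otimes>\<^bsub>U\<^esub> v \<in> D)"
    if "finite \<V>" "\<forall>V\<in>\<V>. clopen V \<and> small V" for \<V>
    using that
  proof (induction \<V> rule: finite_induct)
    case empty
    then show ?case by (intro exI[of _ "{}"]) (auto simp: clopen_def small_def)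
  next
    case (insert V \<V>)
    then obtain D where D: "clopen D" "small D" "\<forall>v\<in>\<Union>\<V>. \<exists>z\<in>K. z \<otimes>\<^bsub>U\<^esub> v \<in> D" by auto
    have V: "clopen V" "small V" using insert.prems by auto
    \<comment> \<open>\<open>E K\<close> is the union of the orbits that meet \<open>D\<close>. Only
      the part of \<open>V\<close> outside it is added to \<open>D\<close>, so no orbit acquires a
      second point.\<close>
    define E where "E J = {u \<in> carrier U. \<exists>z\<in>J. z \<otimes>\<^bsub>U\<^esub> u \<in> D}" for J
    have "clopen (E J)" if "finite J" "J \<subseteq> K" for J
      using that
    proof (induction J rule: finite_induct)
      case empty
      then show ?case by (simp add: E_def clopen_def)
    next
      case (insert z J)
      have "E (insert z J) = {u \<in> carrier U. z \<otimes>\<^bsub>U\<^esub> u \<in> D} \<union> E J" by (auto simp: E_def)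
      then show ?case using insert KU D(1) by (auto intro!: clopen_Un translate)
    qed
    then have E: "clopen (E K)" using finK by blast
    have "small (D \<union> (V - E K))"
      unfolding small_def
    proof (intro ballI impI)
      fix d z assume d: "d \<in> D \<union> (V - E K)" and z: "z \<in> K" and zd: "z \<otimes>\<^bsub>U\<^esub> d \<in> D \<union> (V - E K)"
      have dU: "d \<in> carrier U" using d clopen_sub D(1) V(1) by blast
      have "inv\<^bsub>U\<^esub> z \<otimes>\<^bsub>U\<^esub> (z \<otimes>\<^bsub>U\<^esub> d) = d"
        using KU[OF z] dU by (simp flip: U.m_assoc)
      then have "z \<otimes>\<^bsub>U\<^esub> d \<in> E K" if "d \<in> D"
        using that subgroup.m_inv_closed[OF K z] KU[OF z] dU by (auto simp: E_def intro!: bexI[of _ "inv\<^bsub>U\<^esub> z"])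
      moreover have "d \<in> E K" if "z \<otimes>\<^bsub>U\<^esub> d \<in> D" using that z dU by (auto simp: E_def)
      ultimately show "z = \<one>\<^bsub>U\<^esub>" using d zd z D(2) V(2) unfolding small_def by blast
    qed
    moreover have "\<exists>z\<in>K. z \<otimes>\<^bsub>U\<^esub> v \<in> D \<union> (V - E K)" if "v \<in> \<Union>(insert V \<V>)" for v
    proof (cases "v \<in> V - E K")
      case True
      then have "\<one>\<^bsub>U\<^esub> \<otimes>\<^bsub>U\<^esub> v = v" using clopen_sub[OF V(1)] by auto
      then show ?thesis using True subgroup.one_closed[OF K] by (metis UnI2)
    next
      case False
      then show ?thesis using that D(3) by (auto simp: E_def)
    qed
    ultimately show ?case using clopen_Un[OF D(1) clopen_diff[OF V(1) E]] by blast
  qed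
  have cover: "\<forall>V\<in>{V. clopen V \<and> small V}. openin X V" "topspace X \<subseteq> \<Union>{V. clopen V \<and> small V}"
    using local by (auto simp: clopen_def X(1))
  obtain \<V> where \<V>: "finite \<V>" "\<V> \<subseteq> {V. clopen V \<and> small V}" "topspace X \<subseteq> \<Union>\<V>"
    using X(2)[unfolded compact_space_alt, rule_format, OF conjI[OF cover]] by blast
  obtain D where D: "clopen D" "small D" "\<forall>v\<in>\<Union>\<V>. \<exists>z\<in>K. z \<otimes>\<^bsub>U\<^esub> v \<in> D"
    using merge[OF \<V>(1)] \<V>(2) by blast
  have "\<exists>d\<in>D. f d = x" if x: "x \<in> carrier H" for x
  proof -
    obtain u where u: "u \<in> carrier U" "f u = x" using x onto by (metis imageE)
    then obtain z where z: "z \<in> K" "z \<otimes>\<^bsub>U\<^esub> u \<in> D" using D(3) \<V>(3) X(1) by blast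
    have "f (z \<otimes>\<^bsub>U\<^esub> u) = x" using u z(1) KU f_K x by simp
    then show ?thesis using z(2) by blast
  qed
  then obtain s where s: "\<And>x. x \<in> carrier H \<Longrightarrow> s x \<in> D \<and> f (s x) = x" by metis
  \<comment> \<open>Both points have the same image under \<open>f\<close>, so they lie in one
    orbit, and \<open>D\<close> contains at most one point of each orbit.\<close>
  have s_f: "s (f d) = d" if d: "d \<in> D" for d
  proof -
    have dU: "d \<in> carrier U" using d clopen_sub[OF D(1)] by auto
    have sD: "s (f d) \<in> D" "f (s (f d)) = f d" using s[of "f d"] dU by auto
    then have sU: "s (f d) \<in> carrier U" using clopen_sub[OF D(1)] by auto
    define z where "z = d \<otimes>\<^bsub>U\<^esub> inv\<^bsub>U\<^esub> s (f d)"
    have "z \<in> K" using dU sU sD(2) by (simp add: z_def K_def kernel_def)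
    moreover have zd: "z \<otimes>\<^bsub>U\<^esub> s (f d) = d" using dU sU by (simp add: z_def U.m_assoc)
    ultimately have "z = \<one>\<^bsub>U\<^esub>" using D(2) d sD(1) by (metis small_def)
    then show ?thesis using zd sU by simp
  qed
  \<comment> \<open>\<open>s\<close> is inverse to the restriction of \<open>f\<close> to
    \<open>D\<close>, so the preimage of a closed set under \<open>s\<close> is the image under
    \<open>f\<close> of a compact subset of \<open>D\<close>, which is closed in a Hausdorff
    space.\<close>
  have "continuous_map S X s"
    unfolding continuous_map_closedin
  proof (intro conjI allI impI)
    show "s \<in> topspace S \<rightarrow> topspace X" using s clopen_sub[OF D(1)] S(2) X(1) by auto
    fix C assume "closedin X C"
    then have "compactin X (D \<inter> C)"
      using D(1) X(2) closedin_compact_space by (auto simp: clopen_def)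
    then have "closedin S (f ` (D \<inter> C))"
      using image_compactin[OF _ cont_homD(2)[OF f]] compactin_imp_closedin S(1) by blast
    moreover have "{x \<in> topspace S. s x \<in> C} = f ` (D \<inter> C)"
    proof (intro equalityI subsetI)
      fix x assume "x \<in> {x \<in> topspace S. s x \<in> C}"
      then have "s x \<in> D \<inter> C" "x = f (s x)" using s[of x] S(2) by auto
      then show "x \<in> f ` (D \<inter> C)" by (rule rev_image_eqI)
    next
      fix x assume "x \<in> f ` (D \<inter> C)"
      then obtain d where "d \<in> D" "d \<in> C" "x = f d" by blast
      then show "x \<in> {x \<in> topspace S. s x \<in> C}"
        using s_f[of d] clopen_sub[OF D(1)] S(2) by auto
    qed
    ultimately show "closedin S {x \<in> topspace S. s x \<in> C}" by simp
  qed
  then show ?thesis using s by blast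
qed

section \<open>The cocycle of a central extension\<close>

definition ext_section :: "('u, 'v) cext \<Rightarrow> 'v \<Rightarrow> 'u" where
  "ext_section w = (SOME s. continuous_map (Ub_top w) (U_top w) s
     \<and> (\<forall>x \<in> carrier (Ub_grp w). proj w (s x) = x))"

definition ext_cocycle :: "int \<Rightarrow> ('u, 'v) cext \<Rightarrow> 'v \<Rightarrow> 'v \<Rightarrow> int" where
  "ext_cocycle p w = (\<lambda>x y. if x \<in> carrier (Ub_grp w) \<and> y \<in> carrier (Ub_grp w)
     then the_inv_into {0..<p} (incl w) (ext_section w x \<otimes>\<^bsub>U_grp w\<^esub> ext_section w y
       \<otimes>\<^bsub>U_grp w\<^esub> inv\<^bsub>U_grp w\<^esub> (ext_section w (x \<otimes>\<^bsub>Ub_grp w\<^esub> y)))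
     else 0)"

lemma ext_class_eq: "ext_class p w = h2class (Ub_grp w) (Ub_top w) p (ext_cocycle p w)"
  unfolding ext_class_def ext_cocycle_def ext_section_def Let_def by (rule refl)

locale central_extension =
  fixes p :: int and w :: "('u, 'v) cext"
  assumes p_pos: "p > 0" and ext: "central_ext p w"
begin

abbreviation "U \<equiv> U_grp w"
abbreviation "V \<equiv> Ub_grp w"
abbreviation "s \<equiv> ext_section w"

text \<open>Extending the inclusion to all integers makes it additive without any reduction, with
  kernel the multiples of \<open>p\<close>; identities in the central subgroup then become
  divisibilities.\<close>

definition "iota k = incl w (k mod p)"
definition "coord u = the_inv_into {0..<p} (incl w) u"

sublocale U: group U
  using ext by (simp add: central_ext_def profinite_group_def topological_group_def)

sublocale V: group V
  using ext by (simp add: central_ext_def profinite_group_def topological_group_def)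

lemma topspace_U: "topspace (U_top w) = carrier U" and topspace_V: "topspace (Ub_top w) = carrier V"
  and Hausdorff_U: "Hausdorff_space (U_top w)" and Hausdorff_V: "Hausdorff_space (Ub_top w)"
  and mult_U: "continuous_map (prod_topology (U_top w) (U_top w)) (U_top w) (\<lambda>(x, y). x \<otimes>\<^bsub>U\<^esub> y)"
  and mult_V: "continuous_map (prod_topology (Ub_top w) (Ub_top w)) (Ub_top w) (\<lambda>(x, y). x \<otimes>\<^bsub>V\<^esub> y)"
  and inv_U: "continuous_map (U_top w) (U_top w) (\<lambda>x. inv\<^bsub>U\<^esub> x)"
  using ext by (simp_all add: central_ext_def profinite_group_def topological_group_def)

lemma proj_cont_hom: "proj w \<in> cont_hom U (U_top w) V (Ub_top w)"
  and proj_onto: "proj w ` carrier U = carrier V"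
  and kernel_proj: "kernel U V (proj w) = incl w ` {0..<p}"
  and inj_incl: "inj_on (incl w) {0..<p}"
  using ext by (simp_all add: central_ext_def)

sublocale proj: group_hom U V "proj w"
  using cont_homD(1)[OF proj_cont_hom]
  by (simp add: group_hom_def group_hom_axioms_def U.group_axioms V.group_axioms)

lemma iota_closed [simp]: "iota k \<in> carrier U"
  and iota_central: "u \<in> carrier U \<Longrightarrow> u \<otimes>\<^bsub>U\<^esub> iota k = iota k \<otimes>\<^bsub>U\<^esub> u"
proof -
  have i: "incl w \<in> hom (Zp p) U" using ext by (simp add: central_ext_def cont_hom_def)
  have "k mod p \<in> carrier (Zp p)" using p_pos by (simp add: Zp_def)
  from hom_in_carrier[OF i this] show "iota k \<in> carrier U" by (simp add: iota_def)
  show "u \<otimes>\<^bsub>U\<^esub> iota k = iota k \<otimes>\<^bsub>U\<^esub> u" if "u \<in> carrier U"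
    using ext p_pos that by (simp add: central_ext_def iota_def)
qed

lemma iota_add: "iota j \<otimes>\<^bsub>U\<^esub> iota k = iota (j + k)"
proof -
  have i: "incl w \<in> hom (Zp p) U" using ext by (simp add: central_ext_def cont_hom_def)
  show ?thesis
    using hom_mult[OF i, of "j mod p" "k mod p"] p_pos by (simp add: Zp_def iota_def mod_simps)
qed

lemma iota_eq_iff: "iota j = iota k \<longleftrightarrow> p dvd j - k"
  using inj_on_eq_iff[OF inj_incl, of "j mod p" "k mod p"] p_pos
  by (simp add: iota_def mod_eq_dvd_iff)

lemma iota_coord: "u \<in> kernel U V (proj w) \<Longrightarrow> iota (coord u) = u"
  and coord_range: "u \<in> kernel U V (proj w) \<Longrightarrow> coord u \<in> {0..<p}"
proof -
  assume "u \<in> kernel U V (proj w)"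
  then have u: "u \<in> incl w ` {0..<p}" by (simp add: kernel_proj)
  show r: "coord u \<in> {0..<p}"
    unfolding coord_def by (rule the_inv_into_into[OF inj_incl u order_refl])
  show "iota (coord u) = u"
    using r f_the_inv_into_f[OF inj_incl u] by (simp add: iota_def coord_def)
qed

text \<open>The central subgroup is finite and \<open>U\<close> is Hausdorff, so all its subsets are
  closed. The fibre over \<open>k\<close> is the complement of the preimage of such a subset, hence
  open.\<close>

lemma continuous_map_coord:
  assumes g: "continuous_map X (U_top w) g" and ker: "\<And>x. x \<in> topspace X \<Longrightarrow> g x \<in> kernel U V (proj w)"
  shows "continuous_map X (Zp_top p) (\<lambda>x. coord (g x))"
  unfolding continuous_map_Zp_top
proof (intro conjI allI)
  show "(\<lambda>x. coord (g x)) \<in> topspace X \<rightarrow> {0..<p}" using coord_range ker by blast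
  fix k
  let ?F = "kernel U V (proj w) - {u. coord u = k}"
  have "finite ?F" by (simp add: kernel_proj)
  then have "closedin (U_top w) ?F"
    by (intro closedin_Hausdorff_finite[OF Hausdorff_U]) (auto simp: topspace_U kernel_def)
  then have "closedin X {x \<in> topspace X. g x \<in> ?F}"
    by (rule closedin_continuous_map_preimage[OF g])
  then have "openin X (topspace X - {x \<in> topspace X. g x \<in> ?F})" by (rule openin_diff[OF openin_topspace])
  moreover have "topspace X - {x \<in> topspace X. g x \<in> ?F} = {x \<in> topspace X. coord (g x) = k}"
    using ker by auto
  ultimately show "openin X {x \<in> topspace X. coord (g x) = k}" by simp
qed

text \<open>This gives content to the choice made in \<open>ext_class\<close>: the kernel is a copy
  of Z/p, hence finite, so a continuous section exists and the chosen one has the required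
  properties.\<close>

lemma continuous_section: "continuous_map (Ub_top w) (U_top w) s"
  and proj_section [simp]: "x \<in> carrier V \<Longrightarrow> proj w (s x) = x"
proof -
  have "profinite_group U (U_top w)" using ext by (simp add: central_ext_def)
  then have "\<exists>s. continuous_map (Ub_top w) (U_top w) s \<and> (\<forall>x\<in>carrier V. proj w (s x) = x)"
    by (rule continuous_section_finite_kernel[OF _ V.group_axioms Hausdorff_V topspace_V
          proj_cont_hom proj_onto]) (simp add: kernel_proj)
  from someI_ex[OF this] show "continuous_map (Ub_top w) (U_top w) s"
    and "x \<in> carrier V \<Longrightarrow> proj w (s x) = x"
    by (simp_all add: ext_section_def)
qed

lemma section_closed [simp]: "x \<in> carrier V \<Longrightarrow> s x \<in> carrier U"
  using continuous_map_funspace[OF continuous_section] by (auto simp: topspace_U topspace_V)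

lemma factor_set:
  assumes "x \<in> carrier V" "y \<in> carrier V"
  shows "s x \<otimes>\<^bsub>U\<^esub> s y = iota (ext_cocycle p w x y) \<otimes>\<^bsub>U\<^esub> s (x \<otimes>\<^bsub>V\<^esub> y)"
proof -
  let ?u = "s x \<otimes>\<^bsub>U\<^esub> s y \<otimes>\<^bsub>U\<^esub> inv\<^bsub>U\<^esub> (s (x \<otimes>\<^bsub>V\<^esub> y))"
  have "?u \<in> kernel U V (proj w)" using assms by (simp add: kernel_def)
  moreover have "ext_cocycle p w x y = coord ?u" using assms by (simp add: ext_cocycle_def coord_def)
  ultimately show ?thesis using assms by (simp add: iota_coord U.m_assoc)
qed

lemma ext_cocycle: "ext_cocycle p w \<in> cocycles2 V (Ub_top w) p"
proof -
  let ?X = "prod_topology (Ub_top w) (Ub_top w)"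
  have sx: "continuous_map ?X (U_top w) (\<lambda>z. s (fst z))" "continuous_map ?X (U_top w) (\<lambda>z. s (snd z))"
    using continuous_map_compose[OF continuous_map_fst continuous_section]
      continuous_map_compose[OF continuous_map_snd continuous_section] by (simp_all add: o_def)
  have prod: "continuous_map ?X (U_top w) (\<lambda>z. a z \<otimes>\<^bsub>U\<^esub> b z)"
    if "continuous_map ?X (U_top w) a" "continuous_map ?X (U_top w) b" for a b
    using continuous_map_compose[OF continuous_map_pairedI[OF that] mult_U] by (simp add: o_def)
  have "continuous_map ?X (U_top w) (\<lambda>z. inv\<^bsub>U\<^esub> (s (fst z \<otimes>\<^bsub>V\<^esub> snd z)))"
    using continuous_map_compose[OF continuous_map_compose[OF mult_V continuous_section] inv_U]
    by (simp add: o_def case_prod_unfold)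
  then have "continuous_map ?X (Zp_top p) (\<lambda>z. coord (s (fst z) \<otimes>\<^bsub>U\<^esub> s (snd z)
      \<otimes>\<^bsub>U\<^esub> inv\<^bsub>U\<^esub> (s (fst z \<otimes>\<^bsub>V\<^esub> snd z))))"
    by (intro continuous_map_coord prod sx) (auto simp: topspace_V kernel_def)
  then have "continuous_map ?X (Zp_top p) (\<lambda>(x, y). ext_cocycle p w x y)"
    by (rule continuous_map_eq) (auto simp: topspace_V ext_cocycle_def coord_def)
  moreover have "(ext_cocycle p w y z - ext_cocycle p w (x \<otimes>\<^bsub>V\<^esub> y) z + ext_cocycle p w x (y \<otimes>\<^bsub>V\<^esub> z)
      - ext_cocycle p w x y) mod p = 0"
    if xyz: "x \<in> carrier V" "y \<in> carrier V" "z \<in> carrier V" for x y z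
  proof -
    let ?a = "ext_cocycle p w"
    let ?t = "s (x \<otimes>\<^bsub>V\<^esub> y \<otimes>\<^bsub>V\<^esub> z)"
    \<comment> \<open>The cocycle identity is associativity: both bracketings of \<open>s x\<close>,
      \<open>s y\<close>, \<open>s z\<close> are brought to a central factor times
      \<open>?t\<close>, centrality carrying \<open>iota\<close> past \<open>s x\<close>.\<close>
    have "iota (?a x y + ?a (x \<otimes>\<^bsub>V\<^esub> y) z) \<otimes>\<^bsub>U\<^esub> ?t = iota (?a x y) \<otimes>\<^bsub>U\<^esub> (s (x \<otimes>\<^bsub>V\<^esub> y) \<otimes>\<^bsub>U\<^esub> s z)"
      using xyz by (simp add: factor_set[of "x \<otimes>\<^bsub>V\<^esub> y" z] U.m_assoc flip: iota_add)
    also have "\<dots> = s x \<otimes>\<^bsub>U\<^esub> s y \<otimes>\<^bsub>U\<^esub> s z"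
      using xyz by (simp add: factor_set[of x y] U.m_assoc)
    also have "\<dots> = s x \<otimes>\<^bsub>U\<^esub> (iota (?a y z) \<otimes>\<^bsub>U\<^esub> s (y \<otimes>\<^bsub>V\<^esub> z))"
      using xyz by (simp add: factor_set[of y z, symmetric] U.m_assoc)
    also have "\<dots> = iota (?a y z) \<otimes>\<^bsub>U\<^esub> (s x \<otimes>\<^bsub>U\<^esub> s (y \<otimes>\<^bsub>V\<^esub> z))"
      using xyz by (simp add: iota_central flip: U.m_assoc)
    also have "\<dots> = iota (?a y z + ?a x (y \<otimes>\<^bsub>V\<^esub> z)) \<otimes>\<^bsub>U\<^esub> ?t"
      using xyz by (simp add: factor_set U.m_assoc V.m_assoc flip: iota_add)
    finally have "iota (?a x y + ?a (x \<otimes>\<^bsub>V\<^esub> y) z) = iota (?a y z + ?a x (y \<otimes>\<^bsub>V\<^esub> z))"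
      using xyz by simp
    then have "p dvd (?a y z + ?a x (y \<otimes>\<^bsub>V\<^esub> z)) - (?a x y + ?a (x \<otimes>\<^bsub>V\<^esub> y) z)"
      by (metis iota_eq_iff)
    then have "p dvd ?a y z - ?a (x \<otimes>\<^bsub>V\<^esub> y) z + ?a x (y \<otimes>\<^bsub>V\<^esub> z) - ?a x y"
      by (simp add: algebra_simps)
    then show ?thesis by (simp add: dvd_eq_mod_eq_0)
  qed
  ultimately show ?thesis by (simp add: cocycles2_def ext_cocycle_def)
qed

text \<open>The pullback of the extension class to \<open>U\<close> is the coboundary of the coordinate of \<open>u\<close> relative
  to \<open>s (proj u)\<close>.\<close>

definition "offset u = coord (u \<otimes>\<^bsub>U\<^esub> inv\<^bsub>U\<^esub> (s (proj w u)))"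

lemma offset_mem_kernel:
  "u \<in> carrier U \<Longrightarrow> u \<otimes>\<^bsub>U\<^esub> inv\<^bsub>U\<^esub> (s (proj w u)) \<in> kernel U V (proj w)"
  by (simp add: kernel_def)

lemma iota_offset: "u \<in> carrier U \<Longrightarrow> iota (offset u) \<otimes>\<^bsub>U\<^esub> s (proj w u) = u"
  using offset_mem_kernel[of u] by (simp add: offset_def iota_coord U.m_assoc)

lemma continuous_offset: "continuous_map (U_top w) (Zp_top p) offset"
proof -
  have "continuous_map (U_top w) (U_top w) (\<lambda>u. inv\<^bsub>U\<^esub> (s (proj w u)))"
    using continuous_map_compose[OF continuous_map_compose[OF cont_homD(2)[OF proj_cont_hom] continuous_section] inv_U]
    by (simp add: o_def)
  then have "continuous_map (U_top w) (U_top w) (\<lambda>u. u \<otimes>\<^bsub>U\<^esub> inv\<^bsub>U\<^esub> (s (proj w u)))"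
    using continuous_map_compose[OF continuous_map_pairedI[OF continuous_map_id[unfolded id_def]] mult_U]
    by (fastforce simp: o_def)
  then show ?thesis
    unfolding offset_def[abs_def] by (rule continuous_map_coord) (simp add: topspace_U offset_mem_kernel)
qed

text \<open>Writing \<open>u\<close>, \<open>v\<close> and their product as a central factor times a
  section value and collecting the central factors gives the identity. Its sign is opposite to that
  of the coboundary in \<open>cohomologous\<close>, whence the factor \<open>-1\<close> in
  \<open>antitrg_ext_class\<close>.\<close>

lemma offset_coboundary:
  assumes uv: "u \<in> carrier U" "v \<in> carrier U"
  shows "p dvd ext_cocycle p w (proj w u) (proj w v) - (offset (u \<otimes>\<^bsub>U\<^esub> v) - offset u - offset v)"
proof -
  let ?s = "s (proj w u)" and ?t = "s (proj w v)"
  have "iota (offset (u \<otimes>\<^bsub>U\<^esub> v)) \<otimes>\<^bsub>U\<^esub> s (proj w u \<otimes>\<^bsub>V\<^esub> proj w v) = u \<otimes>\<^bsub>U\<^esub> v"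
    using iota_offset[of "u \<otimes>\<^bsub>U\<^esub> v"] uv by simp
  also have "\<dots> = (iota (offset u) \<otimes>\<^bsub>U\<^esub> ?s) \<otimes>\<^bsub>U\<^esub> (iota (offset v) \<otimes>\<^bsub>U\<^esub> ?t)"
    using uv by (simp add: iota_offset)
  also have "\<dots> = iota (offset u) \<otimes>\<^bsub>U\<^esub> (?s \<otimes>\<^bsub>U\<^esub> iota (offset v)) \<otimes>\<^bsub>U\<^esub> ?t"
    using uv by (simp add: U.m_assoc)
  also have "\<dots> = iota (offset u) \<otimes>\<^bsub>U\<^esub> (iota (offset v) \<otimes>\<^bsub>U\<^esub> ?s) \<otimes>\<^bsub>U\<^esub> ?t"
    using uv by (simp add: iota_central)
  also have "\<dots> = iota (offset u) \<otimes>\<^bsub>U\<^esub> iota (offset v) \<otimes>\<^bsub>U\<^esub> (?s \<otimes>\<^bsub>U\<^esub> ?t)"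
    using uv by (simp add: U.m_assoc)
  also have "\<dots> = iota (offset u + offset v + ext_cocycle p w (proj w u) (proj w v))
      \<otimes>\<^bsub>U\<^esub> s (proj w u \<otimes>\<^bsub>V\<^esub> proj w v)"
    using uv by (simp add: factor_set U.m_assoc flip: iota_add)
  finally have "iota (offset (u \<otimes>\<^bsub>U\<^esub> v)) = iota (offset u + offset v + ext_cocycle p w (proj w u) (proj w v))"
    using uv by simp
  then have "p dvd offset u + offset v + ext_cocycle p w (proj w u) (proj w v) - offset (u \<otimes>\<^bsub>U\<^esub> v)"
    by (metis iota_eq_iff)
  then show ?thesis by (simp add: algebra_simps)
qed

text \<open>An element is recovered from its offset and its projection, and here the projection is
  that of the identity. The section need not send identity to identity, so \<open>offset\<close> of
  the identity has to be subtracted.\<close>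

lemma offset_kernel:
  assumes "u \<in> kernel U V (proj w)"
  shows "p dvd offset u - offset \<one>\<^bsub>U\<^esub> \<longleftrightarrow> u = \<one>\<^bsub>U\<^esub>"
proof -
  have u: "u \<in> carrier U" "proj w u = \<one>\<^bsub>V\<^esub>" using assms by (auto simp: kernel_def)
  have "p dvd offset u - offset \<one>\<^bsub>U\<^esub> \<longleftrightarrow> iota (offset u) = iota (offset \<one>\<^bsub>U\<^esub>)" by (simp add: iota_eq_iff)
  also have "\<dots> \<longleftrightarrow> u = \<one>\<^bsub>U\<^esub>"
  proof
    assume eq: "iota (offset u) = iota (offset \<one>\<^bsub>U\<^esub>)"
    have "u = iota (offset \<one>\<^bsub>U\<^esub>) \<otimes>\<^bsub>U\<^esub> s \<one>\<^bsub>V\<^esub>" using iota_offset[OF u(1)] u(2) eq by simp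
    also have "\<dots> = \<one>\<^bsub>U\<^esub>" using iota_offset[of "\<one>\<^bsub>U\<^esub>"] by simp
    finally show "u = \<one>\<^bsub>U\<^esub>" .
  qed simp
  finally show ?thesis .
qed

end

section \<open>Inverting transgression\<close>

text \<open>\<open>f\<close> lives on G/N, while the equation is imposed on its inflation to G. Thus
  \<open>inf_kernel\<close> below is the kernel of inflation from H^2(G/N) to H^2(G), expressed
  through cochains on G.\<close>

definition cobounds :: "('a, 'm) monoid_scheme \<Rightarrow> 'a topology \<Rightarrow> int \<Rightarrow> 'a set \<Rightarrow> ('a \<Rightarrow> int) \<Rightarrow>
    ('a set \<Rightarrow> 'a set \<Rightarrow> int) \<Rightarrow> bool" where
  "cobounds G T p N c f \<longleftrightarrow> continuous_map T (Zp_top p) c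
     \<and> (\<forall>x\<in>carrier G. \<forall>y\<in>carrier G. p dvd f (N #>\<^bsub>G\<^esub> x) (N #>\<^bsub>G\<^esub> y) - (c x + c y - c (x \<otimes>\<^bsub>G\<^esub> y)))"

definition inf_kernel :: "('a, 'm) monoid_scheme \<Rightarrow> 'a topology \<Rightarrow> int \<Rightarrow> 'a set \<Rightarrow>
    ('a set \<Rightarrow> 'a set \<Rightarrow> int) set set" where
  "inf_kernel G T p N = {X \<in> carrier (H2 (G Mod N) (quot_top G T N) p). \<exists>f\<in>X. \<exists>c. cobounds G T p N c f}"

text \<open>The inverse of transgression: if a cocycle of the class \<open>X\<close> becomes the coboundary of \<open>c\<close> on \<open>G\<close>,
  then \<open>c - c \<one>\<close> restricts to the homomorphism on \<open>N\<close> whose transgression is \<open>X\<close>.\<close>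

definition antitrg :: "('a, 'm) monoid_scheme \<Rightarrow> 'a topology \<Rightarrow> int \<Rightarrow> 'a set \<Rightarrow> 'a \<Rightarrow>
    ('a set \<Rightarrow> 'a set \<Rightarrow> int) set \<Rightarrow> int" where
  "antitrg G T p N n X =
     (let c = (SOME c. \<exists>f\<in>X. cobounds G T p N c f) in (c n - c \<one>\<^bsub>G\<^esub>) mod p)"

text \<open>\<open>hom_trivial\<close> says that restriction from H^1(G) to H^1(N) is zero. In the
  profinite setting the five-term exact sequence then makes transgression injective, with image the
  kernel of inflation, and so it has an inverse there.\<close>

locale transgression = normal N G for N and G (structure) +
  fixes T :: "'a topology" and p :: int
  assumes p_pos: "p > 0" and top: "topspace T = carrier G"
    and hom_trivial: "\<And>f n. f \<in> cont_hom G T (Zp p) (Zp_top p) \<Longrightarrow> n \<in> N \<Longrightarrow> f n = 0"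
begin

abbreviation "Q \<equiv> G Mod N"
abbreviation "TQ \<equiv> quot_top G T N"
abbreviation "HQ \<equiv> H2 Q TQ p"
abbreviation "cob \<equiv> cobounds G T p N"
abbreviation "IK \<equiv> inf_kernel G T p N"
abbreviation "tau \<equiv> antitrg G T p N"

sublocale Q: cochains Q TQ p by unfold_locales (rule p_pos)

lemma comm_group_HQ: "comm_group HQ" by (rule Q.comm_group_H2)

lemma coset_Q: "x \<in> carrier G \<Longrightarrow> N #> x \<in> carrier Q"
  by (auto simp: carrier_FactGroup)

lemma coset_mult: "x \<in> carrier G \<Longrightarrow> y \<in> carrier G \<Longrightarrow> (N #> x) \<otimes>\<^bsub>Q\<^esub> (N #> y) = N #> (x \<otimes> y)"
  by (simp add: rcos_sum)

lemma cob_continuous: "cob c f \<Longrightarrow> continuous_map T (Zp_top p) c"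
  by (simp add: cobounds_def)

lemma cob_dvd:
  "cob c f \<Longrightarrow> x \<in> carrier G \<Longrightarrow> y \<in> carrier G \<Longrightarrow>
    p dvd f (N #> x) (N #> y) - (c x + c y - c (x \<otimes> y))"
  by (simp add: cobounds_def)

lemma cobI:
  assumes c: "continuous_map T (Zp_top p) (\<lambda>x. c x mod p)"
    and eq: "\<And>x y. x \<in> carrier G \<Longrightarrow> y \<in> carrier G \<Longrightarrow>
      p dvd f (N #> x) (N #> y) - (c x + c y - c (x \<otimes> y))"
  shows "cob (\<lambda>x. c x mod p) f"
  unfolding cobounds_def
proof (intro conjI ballI c)
  fix x y assume xy: "x \<in> carrier G" "y \<in> carrier G"
  let ?m = "\<lambda>x. c x mod p - c x"
  have "p dvd f (N #> x) (N #> y) - (c x + c y - c (x \<otimes> y)) - ?m x - ?m y + ?m (x \<otimes> y)"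
    by (intro dvd_add dvd_diff eq[OF xy] int_mod_cong_dvd)
  then show "p dvd f (N #> x) (N #> y) - (c x mod p + c y mod p - c (x \<otimes> y) mod p)"
    by (simp add: algebra_simps)
qed

lemma cob_combine:
  assumes c: "cob c f" and d: "cob d g"
    and F: "\<And>x y. x \<in> carrier Q \<Longrightarrow> y \<in> carrier Q \<Longrightarrow> p dvd F x y - (f x y + k * g x y)"
  shows "cob (\<lambda>x. (c x + k * d x) mod p) F"
proof (rule cobI)
  show "continuous_map T (Zp_top p) (\<lambda>x. (c x + k * d x) mod p)"
    by (rule Q.continuous_map_mod2[OF cob_continuous[OF c] cob_continuous[OF d]])
  fix x y assume xy: "x \<in> carrier G" "y \<in> carrier G"
  have "p dvd (F (N #> x) (N #> y) - (f (N #> x) (N #> y) + k * g (N #> x) (N #> y)))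
      + (f (N #> x) (N #> y) - (c x + c y - c (x \<otimes> y)))
      + k * (g (N #> x) (N #> y) - (d x + d y - d (x \<otimes> y)))"
    by (intro dvd_add dvd_mult F coset_Q xy cob_dvd[OF c] cob_dvd[OF d])
  then show "p dvd F (N #> x) (N #> y)
      - ((c x + k * d x) + (c y + k * d y) - (c (x \<otimes> y) + k * d (x \<otimes> y)))"
    by (simp add: algebra_simps)
qed

lemma mod_diff_dvd: "p dvd (a mod p - b mod p) - (a - b)"
  using dvd_diff[OF int_mod_cong_dvd[of p a] int_mod_cong_dvd[of p b]] by (simp add: algebra_simps)

text \<open>Passing to a cohomologous cocycle adds to \<open>c\<close> a cochain inflated from G/N.
  Such a cochain is constant on \<open>N\<close>, so the difference to the value at the identity is
  unaffected.\<close>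

lemma cob_cohomologous:
  assumes c: "cob c f" and gf: "cohomologous Q TQ p g f"
  obtains d where "cob d g" and "\<And>n. n \<in> N \<Longrightarrow> p dvd (d n - d \<one>) - (c n - c \<one>)"
proof -
  obtain b where b: "continuous_map TQ (Zp_top p) b"
    "\<And>x y. x \<in> carrier Q \<Longrightarrow> y \<in> carrier Q \<Longrightarrow> p dvd g x y - f x y - (b x + b y - b (x \<otimes>\<^bsub>Q\<^esub> y))"
    using cohomologousE[OF gf] by blast
  define e where "e x = c x + b (N #> x)" for x
  have "continuous_map T (Zp_top p) (\<lambda>x. b (N #> x))"
    using continuous_map_compose[OF continuous_map_coset[OF group_axioms subgroup_axioms top] b(1)]
    by (simp add: o_def)
  from Q.continuous_map_mod2[OF cob_continuous[OF c] this, of 1]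
  have cont: "continuous_map T (Zp_top p) (\<lambda>x. e x mod p)" by (simp add: e_def)
  have "cob (\<lambda>x. e x mod p) g"
  proof (rule cobI[OF cont])
    fix x y assume xy: "x \<in> carrier G" "y \<in> carrier G"
    from dvd_add[OF b(2)[OF coset_Q coset_Q, OF xy] cob_dvd[OF c xy]]
    show "p dvd g (N #> x) (N #> y) - (e x + e y - e (x \<otimes> y))"
      unfolding coset_mult[OF xy] by (simp add: e_def algebra_simps)
  qed
  moreover have "p dvd (e n mod p - e \<one> mod p) - (c n - c \<one>)" if n: "n \<in> N" for n
  proof -
    have "N #> n = N #> \<one>" using n subset by (simp add: rcos_const coset_mult_one)
    then show ?thesis using mod_diff_dvd[of "e n" "e \<one>"] by (simp add: e_def)
  qed
  ultimately show thesis using that[of "\<lambda>x. e x mod p"] by blast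
qed

text \<open>Two cochains with the same coboundary differ by a continuous homomorphism from G to Z/p,
  which vanishes on \<open>N\<close> by \<open>hom_trivial\<close>.\<close>

lemma cob_unique:
  assumes c: "cob c f" and d: "cob d f" and n: "n \<in> N"
  shows "p dvd (c n - c \<one>) - (d n - d \<one>)"
proof -
  define h where "h x = (c x + (-1) * d x) mod p" for x
  have cont: "continuous_map T (Zp_top p) h"
    unfolding h_def[abs_def] by (rule Q.continuous_map_mod2[OF cob_continuous[OF c] cob_continuous[OF d]])
  have "cob h (\<lambda>x y. 0)"
    unfolding h_def[abs_def] by (rule cob_combine[OF c d]) simp
  have "h \<in> hom G (Zp p)"
  proof (rule homI)
    show "h x \<in> carrier (Zp p)" for x using p_pos by (simp add: Zp_def h_def)
    fix x y assume xy: "x \<in> carrier G" "y \<in> carrier G"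
    have "h (x \<otimes> y) mod p = (h x + h y) mod p"
      using cob_dvd[OF \<open>cob h (\<lambda>x y. 0)\<close> xy] by (simp add: mod_eq_dvd_iff)
    then show "h (x \<otimes> y) = h x \<otimes>\<^bsub>Zp p\<^esub> h y" by (simp add: Zp_def h_def)
  qed
  with cont have "h \<in> cont_hom G T (Zp p) (Zp_top p)" by (simp add: cont_hom_def)
  from hom_trivial[OF this n] hom_trivial[OF this subgroup.one_closed[OF subgroup_axioms]]
  have "p dvd c n - d n" "p dvd c \<one> - d \<one>" by (auto simp: h_def)
  from dvd_diff[OF this] show ?thesis by (simp add: algebra_simps)
qed

text \<open>\<open>f\<close> sees only cosets, so the equations at \<open>(\<one>, x)\<close> and
  \<open>(n, x)\<close> have the same left-hand side. For \<open>x\<close> in \<open>N\<close> this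
  gives additivity on \<open>N\<close>; when \<open>c\<close> is constant modulo \<open>p\<close> on
  \<open>N\<close>, it makes \<open>c\<close> descend to G/N.\<close>

lemma cob_translate:
  assumes c: "cob c f" and n: "n \<in> N" and x: "x \<in> carrier G"
  shows "p dvd c (n \<otimes> x) - c x - (c n - c \<one>)"
proof -
  have nG: "n \<in> carrier G" using n subset by auto
  have "N #> n = N #> \<one>" using n subset by (simp add: rcos_const coset_mult_one)
  then have "p dvd (f (N #> \<one>) (N #> x) - (c \<one> + c x - c (\<one> \<otimes> x)))
      - (f (N #> \<one>) (N #> x) - (c n + c x - c (n \<otimes> x)))"
    using dvd_diff[OF cob_dvd[OF c one_closed x] cob_dvd[OF c nG x]] by simp
  from dvd_minus_iff[THEN iffD2, OF this] show ?thesis using x by (simp add: algebra_simps)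
qed

text \<open>Independence of the choice in \<open>antitrg\<close>: \<open>cob_cohomologous\<close>
  moves to a common cocycle, and \<open>cob_unique\<close> compares the cochains there.\<close>

lemma tau_eq:
  assumes X: "X \<in> carrier HQ" and f: "f \<in> X" and c: "cob c f" and n: "n \<in> N"
  shows "tau n X = (c n - c \<one>) mod p"
proof -
  define d where "d = (SOME c. \<exists>f\<in>X. cob c f)"
  have "\<exists>f\<in>X. cob d f" 
    unfolding d_def by (rule someI_ex[of "\<lambda>c. \<exists>f\<in>X. cob c f"]) (use f c in blast)
  then obtain g where g: "g \<in> X" "cob d g" by blast
  have "cohomologous Q TQ p f g"
    using Q.H2_member[OF X f] g(1) by (simp add: h2class_def)
  then obtain e where e: "cob e f" "p dvd (e n - e \<one>) - (d n - d \<one>)"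
    using cob_cohomologous[OF g(2)] n by metis
  have "p dvd ((c n - c \<one>) - (e n - e \<one>)) + ((e n - e \<one>) - (d n - d \<one>))"
    by (rule dvd_add[OF cob_unique[OF c e(1) n] e(2)])
  then have "p dvd (c n - c \<one>) - (d n - d \<one>)" by (simp add: algebra_simps)
  then show ?thesis by (simp add: antitrg_def d_def[symmetric] mod_eq_dvd_iff dvd_diff_commute)
qed

lemma IK_E:
  assumes "X \<in> IK"
  obtains f c where "f \<in> cocycles2 Q TQ p" "X = h2class Q TQ p f" "cob c f"
    "\<And>n. n \<in> N \<Longrightarrow> tau n X = (c n - c \<one>) mod p"
proof -
  obtain f c where *: "X \<in> carrier HQ" "f \<in> X" "cob c f" using assms by (auto simp: inf_kernel_def)
  show thesis using that Q.H2_member[OF *(1,2)] *(3) tau_eq[OF *] by blast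
qed

lemma IK_I:
  assumes f: "f \<in> cocycles2 Q TQ p" and c: "cob c f"
  shows "h2class Q TQ p f \<in> IK" and "n \<in> N \<Longrightarrow> tau n (h2class Q TQ p f) = (c n - c \<one>) mod p"
proof -
  have *: "h2class Q TQ p f \<in> carrier HQ" "f \<in> h2class Q TQ p f"
    using f Q.h2class_self by (auto simp: Q.carrier_H2)
  then show "h2class Q TQ p f \<in> IK" using c by (auto simp: inf_kernel_def)
  show "n \<in> N \<Longrightarrow> tau n (h2class Q TQ p f) = (c n - c \<one>) mod p" by (rule tau_eq[OF * c])
qed

lemma tau_range: "tau n X \<in> {0..<p}"
  using p_pos by (simp add: antitrg_def Let_def)

lemma tau_add_left:
  assumes "X \<in> IK" and n: "n \<in> N" and m: "m \<in> N"
  shows "p dvd tau (n \<otimes> m) X - (tau n X + tau m X)"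
proof -
  obtain f c where c: "cob c f" and tau: "\<And>n. n \<in> N \<Longrightarrow> tau n X = (c n - c \<one>) mod p"
    using IK_E[OF assms(1)] by blast
  let ?m = "\<lambda>n. (c n - c \<one>) mod p - (c n - c \<one>)"
  have "m \<in> carrier G" using m subset by auto
  then have "p dvd ?m (n \<otimes> m) - ?m n - ?m m + (c (n \<otimes> m) - c m - (c n - c \<one>))"
    by (rule dvd_add[OF dvd_diff[OF dvd_diff] cob_translate[OF c n], OF int_mod_cong_dvd int_mod_cong_dvd int_mod_cong_dvd])
  then show ?thesis using n m by (simp add: tau algebra_simps)
qed

lemma tau_mult:
  assumes "X \<in> IK" "Y \<in> IK"
  shows "X \<otimes>\<^bsub>HQ\<^esub> Y \<in> IK" and "n \<in> N \<Longrightarrow> p dvd tau n (X \<otimes>\<^bsub>HQ\<^esub> Y) - (tau n X + tau n Y)"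
proof -
  obtain f c where f: "f \<in> cocycles2 Q TQ p" "X = h2class Q TQ p f" and c: "cob c f"
    and tauX: "\<And>n. n \<in> N \<Longrightarrow> tau n X = (c n - c \<one>) mod p"
    using IK_E[OF assms(1)] by blast
  obtain g d where g: "g \<in> cocycles2 Q TQ p" "Y = h2class Q TQ p g" and d: "cob d g"
    and tauY: "\<And>n. n \<in> N \<Longrightarrow> tau n Y = (d n - d \<one>) mod p"
    using IK_E[OF assms(2)] by blast
  have XY: "X \<otimes>\<^bsub>HQ\<^esub> Y = h2class Q TQ p (\<lambda>x y. (f x y + g x y) mod p)"
    using f g by (simp add: Q.mult_H2)
  have fg: "(\<lambda>x y. (f x y + g x y) mod p) \<in> cocycles2 Q TQ p"
    using Q.cocycle_combine[OF f(1) g(1), of 1] by simp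
  have cd: "cob (\<lambda>x. (c x + 1 * d x) mod p) (\<lambda>x y. (f x y + g x y) mod p)"
    by (rule cob_combine[OF c d]) (simp add: int_mod_cong_dvd)
  show "X \<otimes>\<^bsub>HQ\<^esub> Y \<in> IK" unfolding XY by (rule IK_I(1)[OF fg cd])
  show "p dvd tau n (X \<otimes>\<^bsub>HQ\<^esub> Y) - (tau n X + tau n Y)" if n: "n \<in> N"
  proof -
    have "tau n (X \<otimes>\<^bsub>HQ\<^esub> Y) = ((c n + 1 * d n) mod p - (c \<one> + 1 * d \<one>) mod p) mod p"
      unfolding XY by (rule IK_I(2)[OF fg cd n])
    also have "\<dots> = ((c n + d n) - (c \<one> + d \<one>)) mod p" by (simp add: mod_simps)
    also have "\<dots> = ((c n - c \<one>) mod p + (d n - d \<one>) mod p) mod p"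
      by (simp only: mod_add_eq) (simp add: algebra_simps)
    also have "\<dots> = (tau n X + tau n Y) mod p" using n by (simp add: tauX tauY)
    finally show ?thesis by (simp add: int_mod_cong_dvd)
  qed
qed

lemma subgroup_IK: "subgroup IK HQ"
proof -
  interpret HQ: comm_group HQ by (rule comm_group_HQ)
  show ?thesis
  proof (rule HQ.subgroupI)
    show "IK \<subseteq> carrier HQ" by (auto simp: inf_kernel_def)
    have "cob (\<lambda>x. 0 mod p) (\<lambda>x y. 0)" by (rule cobI) (use p_pos in \<open>auto simp: Zp_top_def\<close>)
    then show "IK \<noteq> {}" using IK_I(1)[OF Q.zero_cocycle] by blast
    show "X \<otimes>\<^bsub>HQ\<^esub> Y \<in> IK" if "X \<in> IK" "Y \<in> IK" for X Y by (rule tau_mult(1)[OF that])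
    show "inv\<^bsub>HQ\<^esub> X \<in> IK" if X: "X \<in> IK" for X
    proof -
      obtain f c where f: "f \<in> cocycles2 Q TQ p" "X = h2class Q TQ p f" and c: "cob c f"
        using IK_E[OF X] by blast
      have "(\<lambda>x y. (0 + (-1) * f x y) mod p) \<in> cocycles2 Q TQ p"
        by (rule Q.cocycle_combine[OF Q.zero_cocycle f(1)])
      moreover have "cob (\<lambda>x. (0 mod p + (-1) * c x) mod p) (\<lambda>x y. (0 + (-1) * f x y) mod p)"
        by (rule cob_combine[OF \<open>cob (\<lambda>x. 0 mod p) (\<lambda>x y. 0)\<close> c]) (rule int_mod_cong_dvd)
      ultimately show ?thesis using IK_I(1) f by (simp add: Q.inv_H2)
    qed
  qed
qed

lemma tau_continuous:
  assumes "X \<in> IK" "N' \<subseteq> N"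
  shows "continuous_map (subtopology T N') (Zp_top p) (\<lambda>n. tau n X)"
proof -
  obtain f c where c: "cob c f" and tau: "\<And>n. n \<in> N \<Longrightarrow> tau n X = (c n - c \<one>) mod p"
    using IK_E[OF assms(1)] by blast
  have "continuous_map T (Zp_top p) (\<lambda>n. (c n - c \<one>) mod p)"
    by (rule continuous_map_Zp_compose[OF cob_continuous[OF c]]) (use p_pos in auto)
  then have "continuous_map (subtopology T N') (Zp_top p) (\<lambda>n. (c n - c \<one>) mod p)"
    by (rule continuous_map_from_subtopology)
  then show ?thesis
    by (rule continuous_map_eq) (use tau assms(2) in auto)
qed

text \<open>If \<open>c\<close> takes on \<open>N\<close> only its value at the identity,
  \<open>cob_translate\<close> makes it constant on cosets. It then descends to a continuous cochain
  on G/N that has \<open>f\<close> as its coboundary.\<close>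

lemma tau_injective:
  assumes X: "X \<in> IK" and zero: "\<And>n. n \<in> N \<Longrightarrow> tau n X = 0"
  shows "X = \<one>\<^bsub>HQ\<^esub>"
proof -
  obtain f c where f: "f \<in> cocycles2 Q TQ p" "X = h2class Q TQ p f" and c: "cob c f"
    and tau: "\<And>n. n \<in> N \<Longrightarrow> tau n X = (c n - c \<one>) mod p"
    using IK_E[OF X] by blast
  have inv: "c x = c y" if xy: "x \<in> carrier G" "y \<in> carrier G" "N #> x = N #> y" for x y
  proof -
    have "y \<in> N #> x" using rcos_self[OF xy(2) subgroup_axioms] xy(3) by simp
    then obtain n where n: "n \<in> N" "y = n \<otimes> x" by (auto simp: r_coset_def)
    have "p dvd c n - c \<one>" using zero[OF n(1)] tau[OF n(1)] by auto
    with cob_translate[OF c n(1) xy(1)] have "p dvd (c y - c x - (c n - c \<one>)) + (c n - c \<one>)"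
      unfolding n(2) by (rule dvd_add)
    then have "c y mod p = c x mod p" by (simp add: mod_eq_dvd_iff)
    moreover have "c x \<in> {0..<p}" "c y \<in> {0..<p}"
      using continuous_map_funspace[OF cob_continuous[OF c]] xy top by (auto simp: Zp_top_def)
    ultimately show ?thesis by simp
  qed
  then obtain b where b: "\<And>x. x \<in> carrier G \<Longrightarrow> c x = b (N #> x)"
    using function_factors_left_gen[of "\<lambda>x. x \<in> carrier G" "\<lambda>x. N #> x" c] by metis
  have "continuous_map TQ (Zp_top p) b"
    by (rule continuous_map_from_quot_top[OF group_axioms subgroup_axioms top],
        rule continuous_map_eq[OF cob_continuous[OF c]]) (simp add: b top)
  from Q.continuous_map_mod[OF this, of 1]
  have "cohomologous Q TQ p f (\<lambda>x y. 0)"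
  proof (intro cohomologousI[where c = b])
    fix A A' assume "A \<in> carrier Q" "A' \<in> carrier Q"
    then obtain x y where xy: "x \<in> carrier G" "A = N #> x" "y \<in> carrier G" "A' = N #> y"
      by (auto simp: carrier_FactGroup)
    then show "p dvd f A A' - 0 - (b A + b A' - b (A \<otimes>\<^bsub>Q\<^esub> A'))"
      using cob_dvd[OF c xy(1,3)] by (simp add: rcos_sum b)
  qed simp
  then show ?thesis using f by (simp add: Q.h2class_eq_iff H2_def)
qed

text \<open>Both groups are left free because several pairings arise: \<open>N\<close> with all of
  \<open>IK\<close>, \<open>N1\<close> with the liftable classes of \<open>N2\<close>, and
  \<open>N2\<close> with the kernel \<open>CC\<close>.\<close>

lemma mod_pairing_tau:
  assumes "prime p" and "subgroup N' G" "N' \<subseteq> N" and S: "subgroup S HQ" "S \<subseteq> IK"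
  shows "mod_pairing (G\<lparr>carrier := N'\<rparr>) (HQ\<lparr>carrier := S\<rparr>) p tau"
proof -
  interpret HQ: comm_group HQ by (rule comm_group_HQ)
  interpret N': group "G\<lparr>carrier := N'\<rparr>" by (rule subgroup_imp_group) fact
  interpret S: comm_group "HQ\<lparr>carrier := S\<rparr>" 
    by (rule group.group_comm_groupI[OF HQ.subgroup_imp_group[OF S(1)]])
       (use subgroup.mem_carrier[OF S(1)] in \<open>simp add: HQ.m_comm\<close>)
  show ?thesis
  proof (intro mod_pairing.intro mod_pairing_axioms.intro N'.group_axioms S.comm_group_axioms \<open>prime p\<close>)
    show "p dvd tau (m \<otimes>\<^bsub>G\<lparr>carrier := N'\<rparr>\<^esub> m') X - (tau m X + tau m' X)"
      if "m \<in> carrier (G\<lparr>carrier := N'\<rparr>)" "m' \<in> carrier (G\<lparr>carrier := N'\<rparr>)"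
        "X \<in> carrier (HQ\<lparr>carrier := S\<rparr>)" for m m' X
      using that assms(3) S(2) tau_add_left[of X m m'] by auto
    show "p dvd tau m (X \<otimes>\<^bsub>HQ\<lparr>carrier := S\<rparr>\<^esub> Y) - (tau m X + tau m Y)"
      if "m \<in> carrier (G\<lparr>carrier := N'\<rparr>)" "X \<in> carrier (HQ\<lparr>carrier := S\<rparr>)"
        "Y \<in> carrier (HQ\<lparr>carrier := S\<rparr>)" for m X Y
      using that assms(3) S(2) tau_mult(2)[of X Y m] by auto
  qed
qed

text \<open>The lift makes the pullback of \<open>offset\<close> along \<open>\<rho>\<close> cobound
  the class up to sign. On \<open>N\<close> the values of \<open>\<rho>\<close> lie in the central
  kernel, where \<open>offset_kernel\<close> detects whether they are trivial.\<close>

lemma antitrg_ext_class: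
  assumes "central_ext p w" and rho: "\<rho> \<in> cont_hom G T (U_grp w) (U_top w)"
    and rhob: "\<rho>b \<in> cont_hom Q TQ (Ub_grp w) (Ub_top w)"
    and lift: "\<And>x. x \<in> carrier G \<Longrightarrow> proj w (\<rho> x) = \<rho>b (N #> x)"
  shows "h2pull Q TQ p \<rho>b (ext_class p w) \<in> IK"
    and "n \<in> N \<Longrightarrow> tau n (h2pull Q TQ p \<rho>b (ext_class p w)) = 0 \<longleftrightarrow> \<rho> n = \<one>\<^bsub>U_grp w\<^esub>"
proof -
  interpret w: central_extension p w by unfold_locales (use p_pos assms(1) in auto)
  interpret P: cochain_map Q TQ "Ub_grp w" "Ub_top w" p \<rho>b
    by unfold_locales
       (use p_pos factorgroup_is_group rhob topspace_quot_carrier[OF normal_axioms top] in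
         \<open>auto simp: group_def group_axioms_def monoid_def\<close>)
  interpret rho: group_hom G w.U \<rho>
    using cont_homD(1)[OF rho] by (simp add: group_hom_def group_hom_axioms_def group_axioms w.U.group_axioms)
  define h where "h = w.offset"
  note h = w.continuous_offset[folded h_def] w.offset_coboundary[folded h_def] w.offset_kernel[folded h_def]
  define f where "f = pull2 Q \<rho>b (ext_cocycle p w)"
  have X: "h2pull Q TQ p \<rho>b (ext_class p w) = h2class Q TQ p f"
    by (simp add: ext_class_eq P.h2pull_class[OF w.ext_cocycle] f_def)
  have f: "f \<in> cocycles2 Q TQ p" unfolding f_def by (rule P.pull2_cocycle[OF w.ext_cocycle])
  define c where "c x = (-1) * h (\<rho> x)" for x
  have "continuous_map T (Zp_top p) (\<lambda>x. h (\<rho> x))"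
    using continuous_map_compose[OF cont_homD(2)[OF rho] h(1)] by (simp add: o_def)
  then have c: "cob (\<lambda>x. c x mod p) f"
  proof (intro cobI)
    show "continuous_map T (Zp_top p) (\<lambda>x. c x mod p)" if "continuous_map T (Zp_top p) (\<lambda>x. h (\<rho> x))"
      unfolding c_def by (rule Q.continuous_map_mod[OF that])
    fix x y assume xy: "x \<in> carrier G" "y \<in> carrier G"
    then show "p dvd f (N #> x) (N #> y) - (c x + c y - c (x \<otimes> y))"
      using h(2)[of "\<rho> x" "\<rho> y"] coset_Q by (simp add: f_def pull2_def lift c_def algebra_simps)
  qed
  show "h2pull Q TQ p \<rho>b (ext_class p w) \<in> IK" unfolding X by (rule IK_I(1)[OF f c])
  show "tau n (h2pull Q TQ p \<rho>b (ext_class p w)) = 0 \<longleftrightarrow> \<rho> n = \<one>\<^bsub>U_grp w\<^esub>" if n: "n \<in> N"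
  proof -
    have nG: "n \<in> carrier G" using n subset by auto
    have "\<rho>b N = \<one>\<^bsub>w.V\<^esub>"
      using lift[OF one_closed] by (simp add: coset_mult_one subset)
    then have "\<rho> n \<in> kernel w.U w.V (proj w)"
      using lift[OF nG] nG n by (simp add: kernel_def rcos_const)
    then have "\<rho> n = \<one>\<^bsub>w.U\<^esub> \<longleftrightarrow> p dvd h (\<rho> n) - h \<one>\<^bsub>w.U\<^esub>" using h(3) by simp
    moreover have "tau n (h2pull Q TQ p \<rho>b (ext_class p w)) = (c n - c \<one>) mod p"
      unfolding X using IK_I(2)[OF f c n] by (simp add: mod_simps)
    ultimately show ?thesis
      by (simp add: c_def flip: dvd_eq_mod_eq_0) (metis dvd_diff_commute)
  qed
qed

end

section \<open>Liftable classes\<close>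

lemma h2pull_cong:
  assumes "\<And>x. x \<in> carrier G \<Longrightarrow> \<phi> x = \<psi> x"
  shows "h2pull G T p \<phi> X = h2pull G T p \<psi> X"
proof -
  have "(\<lambda>x y. if x \<in> carrier G \<and> y \<in> carrier G then (SOME f. f \<in> X) (\<phi> x) (\<phi> y) else 0)
      = (\<lambda>x y. if x \<in> carrier G \<and> y \<in> carrier G then (SOME f. f \<in> X) (\<psi> x) (\<psi> y) else 0)"
    using assms by (intro ext) auto
  then show ?thesis by (simp only: h2pull_def)
qed

lemma h2pull_compose:
  assumes "cochain_map G T H S p \<phi>" and "cochain_map H S K R p \<psi>" and X: "X \<in> carrier (H2 K R p)"
  shows "h2pull G T p \<phi> (h2pull H S p \<psi> X) = h2pull G T p (\<lambda>x. \<psi> (\<phi> x)) X"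
proof -
  interpret a: cochain_map G T H S p \<phi> by fact
  interpret b: cochain_map H S K R p \<psi> by fact
  interpret c: cochain_map G T K R p "\<lambda>x. \<psi> (\<phi> x)"
    by (intro cochain_map.intro cochain_map_axioms.intro a.G.cochains_axioms b.H.cochains_axioms
          a.group_G a.top_G cont_hom_compose[OF a.phi b.phi])
  obtain f where f: "f \<in> cocycles2 K R p" "X = h2class K R p f"
    using X by (auto simp: b.H.carrier_H2)
  have "pull2 G \<phi> (pull2 H \<psi> f) = pull2 G (\<lambda>x. \<psi> (\<phi> x)) f"
    using a.phi_closed by (auto simp: pull2_def fun_eq_iff)
  then show ?thesis
    using f by (simp add: b.h2pull_class a.h2pull_class b.pull2_cocycle c.h2pull_class)
qed

context transgression
begin

lemma cochain_map_Q:
  assumes "p > 0" "\<phi> \<in> cont_hom Q TQ H S"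
  shows "cochain_map Q TQ H S p \<phi>"
  by (intro cochain_map.intro cochains.intro cochain_map_axioms.intro factorgroup_is_group
        topspace_quot_carrier[OF normal_axioms top] assms)

end

section \<open>Inflation between two quotients\<close>

locale nested_transgression =
  N1: transgression N1 G T p + N2: transgression N2 G T p for N1 N2 and G (structure) and T p +
  assumes le: "N1 \<subseteq> N2"
begin

lemma coset_coset:
  assumes "x \<in> carrier G"
  shows "N2 <#> (N1 #> x) = N2 #> x"
proof -
  have "N2 <#> N1 = N2"
  proof (intro equalityI subsetI)
    fix a assume "a \<in> N2 <#> N1"
    then show "a \<in> N2"
      using le subgroup.m_closed[OF N2.subgroup_axioms] by (auto simp: set_mult_def)
  next
    fix a assume a: "a \<in> N2"
    have "a \<otimes> \<one> \<in> N2 <#> N1"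
      using a subgroup.one_closed[OF N1.subgroup_axioms] unfolding set_mult_def by blast
    moreover have "a \<otimes> \<one> = a" using a N2.subset by (intro N1.r_one) blast
    ultimately show "a \<in> N2 <#> N1" by (simp only:)
  qed
  then show ?thesis
    using assms by (simp add: N1.setmult_rcos_assoc N1.subset N2.subset)
qed

lemma coset_cont_hom_quot: "(\<lambda>A. N2 <#> A) \<in> cont_hom N1.Q N1.TQ N2.Q N2.TQ"
proof -
  have "continuous_map N1.TQ N2.TQ (\<lambda>A. N2 <#> A)"
  proof (rule continuous_map_from_quot_top[OF N1.group_axioms N1.subgroup_axioms N1.top])
    show "continuous_map T N2.TQ (\<lambda>x. N2 <#> (N1 #> x))"
      by (rule continuous_map_eq[OF continuous_map_coset[OF N1.group_axioms N2.subgroup_axioms N2.top]])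
         (simp add: coset_coset N1.top)
  qed
  moreover have "(\<lambda>A. N2 <#> A) \<in> hom N1.Q N2.Q"
  proof (rule homI)
    show "N2 <#> A \<in> carrier N2.Q" if "A \<in> carrier N1.Q" for A
      using that by (auto simp: carrier_FactGroup coset_coset)
    fix A A' assume "A \<in> carrier N1.Q" "A' \<in> carrier N1.Q"
    then obtain x y where xy: "x \<in> carrier G" "A = N1 #> x" "y \<in> carrier G" "A' = N1 #> y"
      by (auto simp: carrier_FactGroup)
    then show "N2 <#> (A \<otimes>\<^bsub>N1.Q\<^esub> A') = (N2 <#> A) \<otimes>\<^bsub>N2.Q\<^esub> (N2 <#> A')"
      by (simp add: N1.rcos_sum N2.rcos_sum coset_coset)
  qed
  ultimately show ?thesis by (simp add: cont_hom_def)
qed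

sublocale infl: cochain_map N1.Q N1.TQ N2.Q N2.TQ p "\<lambda>A. N2 <#> A"
  by (rule N1.cochain_map_Q[OF N1.p_pos coset_cont_hom_quot])

text \<open>A cocycle on G/N2 and its inflation to G/N1 become the same function on G, so one
  cochain \<open>c\<close> computes both sides.\<close>

lemma inflation_antitrg:
  assumes X: "X \<in> N2.IK"
  shows "inflation G T p N1 N2 X \<in> N1.IK"
    and "n \<in> N1 \<Longrightarrow> N1.tau n (inflation G T p N1 N2 X) = N2.tau n X"
proof -
  obtain f c where f: "f \<in> cocycles2 N2.Q N2.TQ p" "X = h2class N2.Q N2.TQ p f" and c: "N2.cob c f"
    and tau: "\<And>n. n \<in> N2 \<Longrightarrow> N2.tau n X = (c n - c \<one>) mod p"
    using N2.IK_E[OF X] by blast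
  have Y: "inflation G T p N1 N2 X = h2class N1.Q N1.TQ p (pull2 N1.Q (\<lambda>A. N2 <#> A) f)"
    using f by (simp add: inflation_def infl.h2pull_class)
  have g: "pull2 N1.Q (\<lambda>A. N2 <#> A) f \<in> cocycles2 N1.Q N1.TQ p"
    by (rule infl.pull2_cocycle[OF f(1)])
  have d: "N1.cob c (pull2 N1.Q (\<lambda>A. N2 <#> A) f)"
    using c N1.coset_Q by (auto simp: cobounds_def pull2_def coset_coset)
  show "inflation G T p N1 N2 X \<in> N1.IK" unfolding Y by (rule N1.IK_I(1)[OF g d])
  show "N1.tau n (inflation G T p N1 N2 X) = N2.tau n X" if "n \<in> N1"
    unfolding Y using N1.IK_I(2)[OF g d that] tau that le by auto
qed

end

section \<open>Homomorphisms to the extensions and the classes they generate\<close>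

locale lifting_setting =
  fixes p :: int and \<Omega> :: "('u, 'v) cext set" and G :: "'g monoid" and T :: "'g topology" and N
  assumes prime_p: "prime p" and nonempty: "\<Omega> \<noteq> {}"
    and ext: "\<And>w. w \<in> \<Omega> \<Longrightarrow> central_ext p w" and II: "\<And>w. w \<in> \<Omega> \<Longrightarrow> cond_II p w"
    and profinite: "profinite_group G T" and normal_N: "N \<lhd> G"
    and Tbar: "N \<subseteq> (\<Inter>w \<in> \<Omega>. TU G T (Ub_grp w) (Ub_top w))"
begin

lemma hom_Ub_trivial:
  assumes "w \<in> \<Omega>" "f \<in> cont_hom G T (Ub_grp w) (Ub_top w)" "n \<in> N"
  shows "f n = \<one>\<^bsub>Ub_grp w\<^esub>"
proof -
  have "n \<in> TU G T (Ub_grp w) (Ub_top w)" using assms(1,3) Tbar by blast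
  then show ?thesis using assms(2) by (auto simp: TU_def kernel_def)
qed

sublocale transgression N G T p
proof (intro transgression.intro transgression_axioms.intro normal_N)
  show "p > 0" by (rule prime_gt_0_int[OF prime_p])
  show "topspace T = carrier G"
    using profinite by (simp add: profinite_group_def topological_group_def)
  fix f n assume f: "f \<in> cont_hom G T (Zp p) (Zp_top p)" and n: "n \<in> N"
  \<comment> \<open>Composition with the embedding \<open>e\<close> from (II) turns \<open>f\<close>
    into a homomorphism to the quotient of an extension, which is trivial on \<open>N\<close>;
    injectivity of \<open>e\<close> gives the claim.\<close>
  obtain w where w: "w \<in> \<Omega>" using nonempty by blast
  then obtain e where e: "e \<in> cont_hom (Zp p) (Zp_top p) (Ub_grp w) (Ub_top w)" "inj_on e {0..<p}"
    using II by (auto simp: cond_II_def)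
  interpret w: central_extension p w by unfold_locales (use ext[OF w] prime_gt_0_int[OF prime_p] in auto)
  have "0 \<in> carrier (Zp p)" using prime_gt_0_int[OF prime_p] by (simp add: Zp_def)
  then have "e 0 \<otimes>\<^bsub>w.V\<^esub> e 0 = e 0" "e 0 \<in> carrier w.V"
    using hom_mult[OF cont_homD(1)[OF e(1)], of 0 0] hom_in_carrier[OF cont_homD(1)[OF e(1)]]
    by (auto simp: Zp_def)
  then have "e 0 = \<one>\<^bsub>w.V\<^esub>" by (metis w.V.l_cancel_one')
  moreover have "e (f n) = \<one>\<^bsub>w.V\<^esub>"
    by (rule hom_Ub_trivial[OF w cont_hom_compose[OF f e(1)] n])
  moreover have "f n \<in> {0..<p}"
    using hom_in_carrier[OF cont_homD(1)[OF f]] n normal_imp_subgroup[OF normal_N] subgroup.mem_carrier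
    by (fastforce simp: Zp_def)
  ultimately show "f n = 0"
    using inj_onD[OF e(2), of "f n" 0] prime_gt_0_int[OF prime_p] by simp
qed

definition "generators = {h2pull Q TQ p \<rho>b (ext_class p w) | w \<rho>b.
  w \<in> \<Omega> \<and> \<rho>b \<in> cont_hom Q TQ (Ub_grp w) (Ub_top w) \<and> liftable G T N w \<rho>b}"

lemma H2_pi_eq: "H2_pi G T p \<Omega> N = generate HQ generators"
  by (simp add: H2_pi_def generators_def)

lemma generator_antitrg:
  assumes "X \<in> generators"
  obtains w \<rho> where "w \<in> \<Omega>" "\<rho> \<in> cont_hom G T (U_grp w) (U_top w)" "X \<in> IK"
    "\<And>n. n \<in> N \<Longrightarrow> tau n X = 0 \<longleftrightarrow> \<rho> n = \<one>\<^bsub>U_grp w\<^esub>"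
proof -
  obtain w \<rho>b \<rho> where *: "X = h2pull Q TQ p \<rho>b (ext_class p w)" "w \<in> \<Omega>"
    "\<rho>b \<in> cont_hom Q TQ (Ub_grp w) (Ub_top w)" "\<rho> \<in> cont_hom G T (U_grp w) (U_top w)"
    "\<And>x. x \<in> carrier G \<Longrightarrow> proj w (\<rho> x) = \<rho>b (N #>\<^bsub>G\<^esub> x)"
    using assms by (auto simp: generators_def liftable_def)
  show thesis
    using that[OF *(2,4)] antitrg_ext_class[OF ext[OF *(2)] *(4,3,5)] *(1) by blast
qed

text \<open>\<open>proj w\<close> after \<open>\<rho>\<close> lands in the quotient of the extension
  and therefore kills \<open>N\<close>. So every \<open>\<rho>\<close> contributes a generator of
  the liftable classes.\<close>

lemma lift_descends:
  assumes w: "w \<in> \<Omega>" and rho: "\<rho> \<in> cont_hom G T (U_grp w) (U_top w)"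
  obtains \<rho>b where "\<rho>b \<in> cont_hom Q TQ (Ub_grp w) (Ub_top w)"
    "\<And>x. x \<in> carrier G \<Longrightarrow> proj w (\<rho> x) = \<rho>b (N #>\<^bsub>G\<^esub> x)"
proof -
  interpret w: central_extension p w by unfold_locales (use ext[OF w] p_pos in auto)
  have "(\<lambda>x. proj w (\<rho> x)) \<in> cont_hom G T (Ub_grp w) (Ub_top w)"
    by (rule cont_hom_compose[OF rho w.proj_cont_hom])
  from factor_cont_hom[OF normal_N top w.V.group_axioms this hom_Ub_trivial[OF w this]]
  show thesis using that by metis
qed

lemma generators_subset: "generators \<subseteq> IK"
  by (metis generator_antitrg subsetI)

lemma subgroup_H2_pi: "subgroup (H2_pi G T p \<Omega> N) HQ" and H2_pi_subset: "H2_pi G T p \<Omega> N \<subseteq> IK"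
proof -
  interpret HQ: comm_group HQ by (rule comm_group_HQ)
  show "subgroup (H2_pi G T p \<Omega> N) HQ"
    unfolding H2_pi_eq
    using generators_subset subgroup.subset[OF subgroup_IK] by (intro HQ.generate_is_subgroup) blast
  show "H2_pi G T p \<Omega> N \<subseteq> IK"
    unfolding H2_pi_eq by (rule HQ.generate_subgroup_incl[OF generators_subset subgroup_IK])
qed

lemma tau_zero_iff: "p dvd tau n X \<longleftrightarrow> tau n X = 0"
  using tau_range[of n X] by (auto dest: zdvd_imp_le)

text \<open>Additivity in the class reduces the vanishing of \<open>tau n\<close> to generators. By
  \<open>lift_descends\<close> the generators account for every \<open>\<rho>\<close>, and each of
  them tests whether \<open>\<rho> n\<close> is trivial.\<close>

lemma antitrg_annihilator:
  assumes n: "n \<in> N"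
  shows "(\<forall>X\<in>H2_pi G T p \<Omega> N. tau n X = 0) \<longleftrightarrow> n \<in> (\<Inter>w \<in> \<Omega>. TU G T (U_grp w) (U_top w))"
proof
  assume zero: "\<forall>X\<in>H2_pi G T p \<Omega> N. tau n X = 0"
  have "\<rho> n = \<one>\<^bsub>U_grp w\<^esub>" if w: "w \<in> \<Omega>" and rho: "\<rho> \<in> cont_hom G T (U_grp w) (U_top w)" for w \<rho>
  proof -
    obtain \<rho>b where rhob: "\<rho>b \<in> cont_hom Q TQ (Ub_grp w) (Ub_top w)"
      "\<And>x. x \<in> carrier G \<Longrightarrow> proj w (\<rho> x) = \<rho>b (N #>\<^bsub>G\<^esub> x)"
      using lift_descends[OF w rho] by blast
    have "h2pull Q TQ p \<rho>b (ext_class p w) \<in> generators"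
      using w rhob rho by (auto simp: generators_def liftable_def)
    then have "h2pull Q TQ p \<rho>b (ext_class p w) \<in> H2_pi G T p \<Omega> N"
      unfolding H2_pi_eq by (rule generate.incl)
    then show ?thesis using antitrg_ext_class(2)[OF ext[OF w] rho rhob n] zero by blast
  qed
  then show "n \<in> (\<Inter>w \<in> \<Omega>. TU G T (U_grp w) (U_top w))"
    using n subset by (intro INT_I) (auto simp: TU_def kernel_def)
next
  assume TU: "n \<in> (\<Inter>w \<in> \<Omega>. TU G T (U_grp w) (U_top w))"
  interpret HQ: comm_group HQ by (rule comm_group_HQ)
  interpret P: mod_pairing "G\<lparr>carrier := N\<rparr>" "HQ\<lparr>carrier := IK\<rparr>" p tau
    by (rule mod_pairing_tau[OF prime_p subgroup_axioms order_refl subgroup_IK order_refl])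
  have zero: "tau n X = 0 \<and> X \<in> IK" if gen: "X \<in> generators" for X
  proof -
    obtain w \<rho> where w: "w \<in> \<Omega>" "\<rho> \<in> cont_hom G T (U_grp w) (U_top w)" "X \<in> IK"
      "\<And>n. n \<in> N \<Longrightarrow> tau n X = 0 \<longleftrightarrow> \<rho> n = \<one>\<^bsub>U_grp w\<^esub>"
      using generator_antitrg[OF gen] by blast
    have "n \<in> TU G T (U_grp w) (U_top w)" using TU w(1) by blast
    then have "\<rho> n = \<one>\<^bsub>U_grp w\<^esub>" using w(2) by (auto simp: TU_def kernel_def)
    then show ?thesis using w(3) w(4)[OF n] by simp
  qed
  have "tau n X = 0 \<and> X \<in> IK" if "X \<in> generate HQ generators" for X
    using that
  proof (induction rule: generate.induct)
    case one
    have "p dvd tau n \<one>\<^bsub>HQ\<^esub>" using P.dvd_one_right[of n] n by simp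
    then show ?case using tau_zero_iff subgroup.one_closed[OF subgroup_IK] by blast
  next
    case (incl h)
    then show ?case by (rule zero)
  next
    case (inv h)
    have h: "tau n h = 0" "h \<in> IK" using zero[OF inv] by auto
    have hH: "h \<in> carrier HQ" by (rule subgroup.mem_carrier[OF subgroup_IK h(2)])
    have i: "inv\<^bsub>HQ\<^esub> h \<in> IK" by (rule subgroup.m_inv_closed[OF subgroup_IK h(2)])
    have "p dvd tau n \<one>\<^bsub>HQ\<^esub> - (tau n h + tau n (inv\<^bsub>HQ\<^esub> h))"
      using tau_mult(2)[OF h(2) i n] hH by simp
    moreover have "p dvd tau n \<one>\<^bsub>HQ\<^esub>" using P.dvd_one_right[of n] n by simp
    ultimately have "p dvd tau n (inv\<^bsub>HQ\<^esub> h)" using h(1) by (metis add_0 dvd_diff_right_iff)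
    then show ?case using tau_zero_iff i by blast
  next
    case (eng h1 h2)
    then have "p dvd tau n (h1 \<otimes>\<^bsub>HQ\<^esub> h2)" using tau_mult(2)[OF _ _ n, of h1 h2] by simp
    then show ?case using tau_zero_iff tau_mult(1) eng by blast
  qed
  then show "\<forall>X\<in>H2_pi G T p \<Omega> N. tau n X = 0" by (simp add: H2_pi_eq)
qed

end

section \<open>Inflation of liftable classes, its kernel, and the pairing\<close>

locale nested_setting =
  N1: lifting_setting p \<Omega> G T N1 + N2: lifting_setting p \<Omega> G T N2 for p \<Omega> G T N1 N2 +
  assumes le: "N1 \<subseteq> N2" and closed1: "closedin T N1" and closed2: "closedin T N2"
begin

sublocale nested_transgression N1 N2 G T p
  by (intro nested_transgression.intro nested_transgression_axioms.intro
        N1.transgression_axioms N2.transgression_axioms le)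

abbreviation "infl \<equiv> inflation G T p N1 N2"

lemma inflation_hom: "infl \<in> hom N2.HQ N1.HQ"
  using infl.h2pull_hom by (simp add: inflation_def)

lemma inflation_generator:
  assumes "w \<in> \<Omega>" "\<rho>b \<in> cont_hom N2.Q N2.TQ (Ub_grp w) (Ub_top w)"
  shows "infl (h2pull N2.Q N2.TQ p \<rho>b (ext_class p w))
    = h2pull N1.Q N1.TQ p (\<lambda>A. \<rho>b (N2 <#>\<^bsub>G\<^esub> A)) (ext_class p w)"
proof -
  interpret w: central_extension p w by unfold_locales (use N1.ext[OF assms(1)] N1.p_pos in auto)
  have map: "cochain_map N2.Q N2.TQ w.V (Ub_top w) p \<rho>b"
    by (rule N2.cochain_map_Q[OF N1.p_pos assms(2)])
  then interpret P: cochain_map N2.Q N2.TQ w.V "Ub_top w" p \<rho>b .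
  have "ext_class p w \<in> carrier (H2 w.V (Ub_top w) p)"
    using w.ext_cocycle by (simp add: ext_class_eq P.H.carrier_H2)
  from h2pull_compose[OF infl.cochain_map_axioms map this] show ?thesis by (simp add: inflation_def)
qed

text \<open>Both generating sets come from the same homomorphisms \<open>\<rho>\<close> on G: each
  induces a map on G/N2, and the map it induces on G/N1 factors through that one.\<close>

lemma inflation_generators: "infl ` N2.generators = N1.generators"
proof (intro equalityI subsetI)
  fix Y assume "Y \<in> infl ` N2.generators"
  then obtain w \<rho>b \<rho> where *: "Y = infl (h2pull N2.Q N2.TQ p \<rho>b (ext_class p w))" "w \<in> \<Omega>"
    "\<rho>b \<in> cont_hom N2.Q N2.TQ (Ub_grp w) (Ub_top w)" "\<rho> \<in> cont_hom G T (U_grp w) (U_top w)"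
    "\<And>x. x \<in> carrier G \<Longrightarrow> proj w (\<rho> x) = \<rho>b (N2 #>\<^bsub>G\<^esub> x)"
    by (auto simp: N2.generators_def liftable_def)
  have "liftable G T N1 w (\<lambda>A. \<rho>b (N2 <#>\<^bsub>G\<^esub> A))"
    using *(4,5) by (auto simp: liftable_def coset_coset)
  moreover have "(\<lambda>A. \<rho>b (N2 <#>\<^bsub>G\<^esub> A)) \<in> cont_hom N1.Q N1.TQ (Ub_grp w) (Ub_top w)"
    by (rule cont_hom_compose[OF coset_cont_hom_quot *(3)])
  ultimately show "Y \<in> N1.generators"
    using *(1,2) inflation_generator[OF *(2,3)] unfolding N1.generators_def by blast
next
  fix Y assume "Y \<in> N1.generators"
  then obtain w \<rho>a \<rho> where *: "Y = h2pull N1.Q N1.TQ p \<rho>a (ext_class p w)" "w \<in> \<Omega>"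
    "\<rho> \<in> cont_hom G T (U_grp w) (U_top w)"
    "\<And>x. x \<in> carrier G \<Longrightarrow> proj w (\<rho> x) = \<rho>a (N1 #>\<^bsub>G\<^esub> x)"
    by (auto simp: N1.generators_def liftable_def)
  obtain \<rho>b where b: "\<rho>b \<in> cont_hom N2.Q N2.TQ (Ub_grp w) (Ub_top w)"
    "\<And>x. x \<in> carrier G \<Longrightarrow> proj w (\<rho> x) = \<rho>b (N2 #>\<^bsub>G\<^esub> x)"
    using N2.lift_descends[OF *(2,3)] by blast
  have "Y = h2pull N1.Q N1.TQ p (\<lambda>A. \<rho>b (N2 <#>\<^bsub>G\<^esub> A)) (ext_class p w)"
    unfolding *(1) using *(4) b(2) by (intro h2pull_cong) (auto simp: carrier_FactGroup coset_coset)
  also have "\<dots> = infl (h2pull N2.Q N2.TQ p \<rho>b (ext_class p w))"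
    by (rule inflation_generator[OF *(2) b(1), symmetric])
  finally have "Y = infl (h2pull N2.Q N2.TQ p \<rho>b (ext_class p w))" .
  moreover have "h2pull N2.Q N2.TQ p \<rho>b (ext_class p w) \<in> N2.generators"
    using *(2,3) b unfolding N2.generators_def liftable_def by blast
  ultimately show "Y \<in> infl ` N2.generators" by blast
qed

lemma inflation_image: "infl ` H2_pi G T p \<Omega> N2 = H2_pi G T p \<Omega> N1"
proof -
  interpret H1: comm_group N1.HQ by (rule N1.comm_group_HQ)
  interpret H2: comm_group N2.HQ by (rule N2.comm_group_HQ)
  interpret group_hom N2.HQ N1.HQ infl
    using inflation_hom by (simp add: group_hom_def group_hom_axioms_def H1.group_axioms H2.group_axioms)
  have "N2.generators \<subseteq> carrier N2.HQ"
    using N2.generators_subset subgroup.subset[OF N2.subgroup_IK] by blast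
  from generate_img[OF this] show ?thesis
    by (simp add: N1.H2_pi_eq N2.H2_pi_eq inflation_generators)
qed

definition "CC = {X \<in> H2_pi G T p \<Omega> N2. infl X = \<one>\<^bsub>N1.HQ\<^esub>}"

lemma subgroup_CC: "subgroup CC N2.HQ"
proof -
  interpret H1: comm_group N1.HQ by (rule N1.comm_group_HQ)
  interpret H2: comm_group N2.HQ by (rule N2.comm_group_HQ)
  interpret h: group_hom N2.HQ N1.HQ infl
    using inflation_hom by (simp add: group_hom_def group_hom_axioms_def H1.group_axioms H2.group_axioms)
  have "CC = H2_pi G T p \<Omega> N2 \<inter> kernel N2.HQ N1.HQ infl"
    using subgroup.subset[OF N2.subgroup_H2_pi] by (auto simp: CC_def kernel_def)
  then show ?thesis
    using H2.subgroups_Inter_pair[OF N2.subgroup_H2_pi h.subgroup_kernel] by simp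
qed

lemma CC_subset: "CC \<subseteq> N2.IK"
  using N2.H2_pi_subset by (auto simp: CC_def)

lemma compact_N: "compact_space (subtopology T N1)" "compact_space (subtopology T N2)"
  by (intro compact_space_subtopology closedin_compact_space closed1 closed2;
      use N1.profinite in \<open>simp add: profinite_group_def\<close>)+

lemma topspace_N:
  "topspace (subtopology T N1) = N1" "topspace (subtopology T N2) = N2"
  using N1.subset N2.subset N1.top by auto

definition "TG = carrier G \<inter> (\<Inter>w \<in> \<Omega>. TU G T (U_grp w) (U_top w))"

text \<open>If \<open>n\<close> is killed by \<open>CC\<close>, then \<open>X \<mapsto> tau n X\<close> respects all relations that hold on \<open>N1\<close>, so it
  agrees with \<open>X \<mapsto> tau m X\<close> for some \<open>m \<in> N1\<close>; hence \<open>m\<^sup>-\<^sup>1 n\<close> lies in \<open>T(G)\<close>.\<close>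

lemma annihilator_CC:
  "{n \<in> N2. \<forall>X\<in>CC. N2.tau n X = 0} = N2 \<inter> (N1 <#>\<^bsub>G\<^esub> TG)"
proof (intro equalityI subsetI)
  fix n assume "n \<in> {n \<in> N2. \<forall>X\<in>CC. N2.tau n X = 0}"
  then have n: "n \<in> N2" and zero: "\<And>X. X \<in> CC \<Longrightarrow> N2.tau n X = 0" by auto
  interpret P: mod_pairing "G\<lparr>carrier := N1\<rparr>" "N2.HQ\<lparr>carrier := H2_pi G T p \<Omega> N2\<rparr>" p N2.tau
    by (rule N2.mod_pairing_tau[OF N1.prime_p N1.subgroup_axioms le N2.subgroup_H2_pi N2.H2_pi_subset])
  have "\<exists>m\<in>carrier (G\<lparr>carrier := N1\<rparr>). \<forall>X\<in>carrier (N2.HQ\<lparr>carrier := H2_pi G T p \<Omega> N2\<rparr>).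
      p dvd N2.tau m X - N2.tau n X"
  proof (rule P.system_solvable[OF compact_N(1)])
    show "topspace (subtopology T N1) = carrier (G\<lparr>carrier := N1\<rparr>)" using topspace_N by simp
    show "continuous_map (subtopology T N1) (Zp_top p) (\<lambda>m. N2.tau m X mod p)"
      if "X \<in> carrier (N2.HQ\<lparr>carrier := H2_pi G T p \<Omega> N2\<rparr>)" for X
      using N2.Q.continuous_map_mod[OF N2.tau_continuous[of X N1], of 1] that N2.H2_pi_subset le by auto
    show "p dvd N2.tau n (X \<otimes>\<^bsub>N2.HQ\<lparr>carrier := H2_pi G T p \<Omega> N2\<rparr>\<^esub> Y) - (N2.tau n X + N2.tau n Y)"
      if "X \<in> carrier (N2.HQ\<lparr>carrier := H2_pi G T p \<Omega> N2\<rparr>)"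
        "Y \<in> carrier (N2.HQ\<lparr>carrier := H2_pi G T p \<Omega> N2\<rparr>)" for X Y
      using N2.tau_mult(2)[of X Y n] that N2.H2_pi_subset n by auto
    fix X assume X: "X \<in> carrier (N2.HQ\<lparr>carrier := H2_pi G T p \<Omega> N2\<rparr>)"
      and rel: "\<forall>m\<in>carrier (G\<lparr>carrier := N1\<rparr>). p dvd N2.tau m X"
    then have XH: "X \<in> H2_pi G T p \<Omega> N2" and XI: "X \<in> N2.IK" using N2.H2_pi_subset by auto
    \<comment> \<open>A class pairing trivially with \<open>N1\<close> inflates to a class with zero
      \<open>tau\<close> on \<open>N1\<close>, hence to the identity by injectivity; so it lies in
      \<open>CC\<close>, where \<open>n\<close> is assumed to act trivially.\<close>
    have "N1.tau m (infl X) = 0" if "m \<in> N1" for m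
      using rel that inflation_antitrg(2)[OF XI that] N2.tau_zero_iff by simp
    then have "infl X = \<one>\<^bsub>N1.HQ\<^esub>" by (rule N1.tau_injective[OF inflation_antitrg(1)[OF XI]])
    then show "p dvd N2.tau n X" using zero XH by (simp add: CC_def)
  qed
  then obtain m where m: "m \<in> N1" "\<And>X. X \<in> H2_pi G T p \<Omega> N2 \<Longrightarrow> p dvd N2.tau m X - N2.tau n X"
    by auto
  have mG: "m \<in> carrier G" "m \<in> N2" and nG: "n \<in> carrier G" using m(1) n le N2.subset by auto
  define t where "t = inv\<^bsub>G\<^esub> m \<otimes>\<^bsub>G\<^esub> n"
  have t: "t \<in> N2" unfolding t_def by (intro subgroup.m_closed[OF N2.subgroup_axioms]
        subgroup.m_inv_closed[OF N2.subgroup_axioms] mG(2) n)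
  have mt: "m \<otimes>\<^bsub>G\<^esub> t = n" unfolding t_def using mG nG by (simp flip: N1.m_assoc)
  have "N2.tau t X = 0" if X: "X \<in> H2_pi G T p \<Omega> N2" for X
  proof -
    have "p dvd N2.tau n X - (N2.tau m X + N2.tau t X)"
      using N2.tau_add_left[OF _ mG(2) t, of X] X N2.H2_pi_subset mt by auto
    then have "p dvd (N2.tau n X - (N2.tau m X + N2.tau t X)) + (N2.tau m X - N2.tau n X)"
      using m(2)[OF X] by (rule dvd_add)
    then have "p dvd N2.tau t X" by simp
    then show ?thesis by (simp add: N2.tau_zero_iff)
  qed
  then have "t \<in> TG" using N2.antitrg_annihilator[OF t] t N2.subset by (auto simp: TG_def)
  then show "n \<in> N2 \<inter> (N1 <#>\<^bsub>G\<^esub> TG)" using m(1) mt n by (auto simp: set_mult_def)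
next
  fix n assume "n \<in> N2 \<inter> (N1 <#>\<^bsub>G\<^esub> TG)"
  then obtain m t where m: "m \<in> N1" and t: "t \<in> TG" and nmt: "n = m \<otimes>\<^bsub>G\<^esub> t" and n: "n \<in> N2"
    by (auto simp: set_mult_def)
  have mG: "m \<in> carrier G" "m \<in> N2" and tG: "t \<in> carrier G" using m t le N2.subset by (auto simp: TG_def)
  have "t = inv\<^bsub>G\<^esub> m \<otimes>\<^bsub>G\<^esub> n" unfolding nmt using mG tG by (simp flip: N1.m_assoc)
  then have tN: "t \<in> N2"
    using subgroup.m_closed[OF N2.subgroup_axioms subgroup.m_inv_closed[OF N2.subgroup_axioms mG(2)] n]
    by simp
  interpret P: mod_pairing "G\<lparr>carrier := N1\<rparr>" "N1.HQ\<lparr>carrier := N1.IK\<rparr>" p N1.tau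
    by (rule N1.mod_pairing_tau[OF N1.prime_p N1.subgroup_axioms order_refl N1.subgroup_IK order_refl])
  have "N2.tau n X = 0" if X: "X \<in> CC" for X
  proof -
    have XH: "X \<in> H2_pi G T p \<Omega> N2" and XI: "X \<in> N2.IK" and "infl X = \<one>\<^bsub>N1.HQ\<^esub>"
      using X CC_subset by (auto simp: CC_def)
    \<comment> \<open>On \<open>N1\<close> the value is that of the inflated class, which is trivial
      for \<open>X\<close> in \<open>CC\<close>; the factor \<open>t\<close> contributes nothing
      because it lies in T(G).\<close>
    then have "N2.tau m X = N1.tau m \<one>\<^bsub>N1.HQ\<^esub>" using inflation_antitrg(2)[OF XI m] by simp
    then have "p dvd N2.tau m X" using P.dvd_one_right[of m] m by simp
    moreover have "N2.tau t X = 0"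
      using N2.antitrg_annihilator[OF tN] t XH by (auto simp: TG_def)
    moreover have "p dvd N2.tau n X - (N2.tau m X + N2.tau t X)"
      unfolding nmt by (rule N2.tau_add_left[OF XI mG(2) tN])
    ultimately have "p dvd N2.tau n X" by (metis add.right_neutral dvd_diff_left_iff)
    then show ?thesis by (simp add: N2.tau_zero_iff)
  qed
  then show "n \<in> {n \<in> N2. \<forall>X\<in>CC. N2.tau n X = 0}" using n by simp
qed

text \<open>\<open>annihilator_CC\<close> identifies the left kernel, and
  \<open>tau_injective\<close> for \<open>N2\<close> gives nondegeneracy on the side of the classes;
  compactness of \<open>N2\<close> does the rest.\<close>

lemma perfect_pairing_exists:
  "\<exists>B. perfect_pairing p (G\<lparr>carrier := N2\<rparr> Mod (N2 \<inter> (N1 <#>\<^bsub>G\<^esub> TG)))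
     (quot_top (G\<lparr>carrier := N2\<rparr>) (subtopology T N2) (N2 \<inter> (N1 <#>\<^bsub>G\<^esub> TG)))
     (N2.HQ\<lparr>carrier := CC\<rparr>) B"
proof -
  interpret P: mod_pairing "G\<lparr>carrier := N2\<rparr>" "N2.HQ\<lparr>carrier := CC\<rparr>" p N2.tau
    by (rule N2.mod_pairing_tau[OF N1.prime_p N2.subgroup_axioms order_refl subgroup_CC CC_subset])
  show ?thesis
  proof (rule P.perfect_pairing_quotient[OF _ compact_N(2)])
    show "N2.tau m X \<in> {0..<p}" for m X by (rule N2.tau_range)
    show "topspace (subtopology T N2) = carrier (G\<lparr>carrier := N2\<rparr>)" using topspace_N by simp
    show "continuous_map (subtopology T N2) (Zp_top p) (\<lambda>m. N2.tau m X)"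
      if "X \<in> carrier (N2.HQ\<lparr>carrier := CC\<rparr>)" for X
      using N2.tau_continuous[of X N2] that CC_subset by auto
    show "X = \<one>\<^bsub>N2.HQ\<lparr>carrier := CC\<rparr>\<^esub>"
      if "X \<in> carrier (N2.HQ\<lparr>carrier := CC\<rparr>)" "\<forall>m\<in>carrier (G\<lparr>carrier := N2\<rparr>). N2.tau m X = 0" for X
      using N2.tau_injective[of X] that CC_subset by auto
    show "N2 \<inter> (N1 <#>\<^bsub>G\<^esub> TG) = {m \<in> carrier (G\<lparr>carrier := N2\<rparr>).
        \<forall>X\<in>carrier (N2.HQ\<lparr>carrier := CC\<rparr>). N2.tau m X = 0}"
      using annihilator_CC by simp
  qed
qed

end

theorem theorem7p1:
  fixes p :: int
    and \<Omega> :: "('u, 'v) cext set"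
    and G :: "'g monoid" and T :: "'g topology"
    and N1 N2 :: "'g set"
  assumes "prime p"
    and "\<Omega> \<noteq> {}"
    and "\<forall>w \<in> \<Omega>. central_ext p w \<and> cond_I w \<and> cond_II p w"
    and "profinite_group G T"
    and "N1 \<lhd> G" and "N2 \<lhd> G"
    and "closedin T N1" and "closedin T N2"
    and "N1 \<subseteq> N2"
    and "N2 \<subseteq> (\<Inter>w \<in> \<Omega>. TU G T (Ub_grp w) (Ub_top w))"
  shows "inflation G T p N1 N2 ` H2_pi G T p \<Omega> N2 = H2_pi G T p \<Omega> N1
     \<and> (let TG = carrier G \<inter> (\<Inter>w \<in> \<Omega>. TU G T (U_grp w) (U_top w));
            K = N2 \<inter> (N1 <#>\<^bsub>G\<^esub> TG);
            A = G\<lparr>carrier := N2\<rparr> Mod K;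
            TA = quot_top (G\<lparr>carrier := N2\<rparr>) (subtopology T N2) K;
            CC = {x \<in> H2_pi G T p \<Omega> N2.
                    inflation G T p N1 N2 x = \<one>\<^bsub>H2 (G Mod N1) (quot_top G T N1) p\<^esub>};
            C = (H2 (G Mod N2) (quot_top G T N2) p)\<lparr>carrier := CC\<rparr>
        in \<exists>B. perfect_pairing p A TA C B)"
proof -
  \<comment> \<open>\<open>N1\<close> inherits the containment in the intersection of kernels from
    \<open>N2\<close>.\<close>
  have "lifting_setting p \<Omega> G T N1" "lifting_setting p \<Omega> G T N2"
    using assms by (auto simp: lifting_setting_def)
  then interpret nested_setting p \<Omega> G T N1 N2
    by (intro nested_setting.intro nested_setting_axioms.intro assms)
  show ?thesis
    unfolding Let_def using inflation_image perfect_pairing_exists[unfolded TG_def CC_def] by blast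
qed

end
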